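(* Let $H$ be a cocommutative quantum groupoid, regarded as quasitriangular with $\mathcal{R}=\Delta^{cop}(1)\Delta(1)$, and let $F$ be a weak invertible unit 2-cocycle for $H$. Let $(\widetilde H,\widetilde{\mathcal{R}})$ be the twisted quasitriangular quantum groupoid. Regard the Hopf algebra $C_H(H_s)_F$ as an object in the category ${}_{\widetilde H}\mathcal{M}$ of left $\widetilde H$-modules. Then in this category there is an isomorphism of Hopf algebras $$\alpha: C_H(H_s)_F\;\cong\; C_{\widetilde H}(\widetilde H_s),$$ given by $\alpha(a)=\mathrm{Ad}_{F^{(1)}}(a)F^{(2)}$ for $a\in C_H(H_s)_F$.
   Context: Let $k$ be a field; Sweedler notation $\Delta(c)=c_1\otimes c_2$ is used, and $\Delta(1)=1_1\otimes 1_2=1'_1\otimes 1'_2$. Quantum groupoids (weak Hopf algebras). A weak bialgebra $H$ is a $k$-algebra and a $k$-coalgebra $(H,\Delta,\varepsilon)$ with $\Delta(hl)=\Delta(h)\Delta(l)$, $\Delta^2(1)=1_1\otimes 1_2 1'_1\otimes 1'_2=1_1\otimes 1'_1 1_2\otimes 1'_2$, and $\varepsilon(hgl)=\varepsilon(hg_1)\varepsilon(g_2l)=\varepsilon(hg_2)\varepsilon(g_1l)$. Put $\varepsilon_t(h)=\varepsilon(1_1h)1_2$ and $\varepsilon_s(h)=1_1\varepsilon(h1_2)$. $H$ is a quantum groupoid if there is a linear map $S:H\to H$ (the antipode) with $S*\mathrm{id}=\varepsilon_s$, $\mathrm{id}*S=\varepsilon_t$, $S*\mathrm{id}*S=S$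 ($*$ = convolution). The antipode is always assumed bijective. $H_t=\varepsilon_t(H)$, $H_s=\varepsilon_s(H)$. Cocommutative means $\Delta=\Delta^{cop}$. $C_H(H_s)=\{g\in H\mid gx=xg\ \forall x\in H_s\}$. $\mathrm{Ad}_h(g)=h_1gS(h_2)$ for $h,g\in H$. A quasitriangular quantum groupoid is a pair $(H,\mathcal{R})$ with $\mathcal{R}=R^{(1)}\otimes R^{(2)}\in\Delta^{cop}(1)(H\otimes H)\Delta(1)$ such that $(\mathrm{id}\otimes\Delta)\mathcal{R}=\mathcal{R}_{13}\mathcal{R}_{12}$, $(\Delta\otimes\mathrm{id})\mathcal{R}=\mathcal{R}_{13}\mathcal{R}_{23}$, $\Delta^{cop}(h)\mathcal{R}=\mathcal{R}\Delta(h)$ for all $h$, and there is $\mathcal{R}^{-1}\in\Delta(1)(H\otimes H)\Delta^{cop}(1)$ with $\mathcal{R}\mathcal{R}^{-1}=\Delta^{cop}(1)$, $\mathcal{R}^{-1}\mathcal{R}=\Delta(1)$. For such $(H,\mathcal R)$, ${}_H\mathcal{M}$ (left $H$-modules) is braided monoidal: $V\otimes_t W=\Delta(1)\cdot(V\otimes_k W)$ with $v\otimes_t w=1_1\cdot v\otimes 1_2\cdot w$ and action $h\cdot(v\otimes w)=h_1\cdot v\otimes h_2\cdot w$; unit object $H_t$ with $h\cdot z=\varepsilon_t(hz)$; trivial associator; unit constraints $z\otimes_t v\mapsto z\cdot v$, $v\otimes_t z\mapsto S^{-1}(z)\cdot v$; braiding $v\otimes_t w\mapsto R^{(2)}\cdot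 w\otimes R^{(1)}\cdot v$. A bialgebra in a braided monoidal category with braiding $\Psi$ is an object with an algebra structure $(\mu,\eta)$ and a coalgebra structure $(\Delta,\varepsilon)$ in the category such that $\Delta\circ\mu=(\mu\otimes\mu)\circ(\mathrm{id}\otimes\Psi\otimes\mathrm{id})\circ(\Delta\otimes\Delta)$, $\varepsilon\circ\mu=\varepsilon\otimes\varepsilon$ and $\Delta\circ\eta=\eta\otimes\eta$. It is a Hopf algebra if there is a morphism $S$ in the category with $\mu\circ(S\otimes\mathrm{id})\circ\Delta=\eta\circ\varepsilon=\mu\circ(\mathrm{id}\otimes S)\circ\Delta$. A weak invertible unit 2-cocycle is $F=F^{(1)}\otimes F^{(2)}\in\Delta(1)(H\otimes H)\Delta^{cop}(1)$ such that: (1) there is $F^{-1}=F^{-(1)}\otimes F^{-(2)}\in\Delta^{cop}(1)(H\otimes H)\Delta(1)$ with $FF^{-1}=\Delta(1)$, $F^{-1}F=\Delta^{cop}(1)$; (2) $((\Delta\otimes\mathrm{id})F)(F\otimes 1)=((\mathrm{id}\otimes\Delta)F)(1\otimes F)$; (3) for all $y\in H_s$, $z\in H_t$: $(1\otimes y)F=F(y\otimes 1)$, $(z\otimes 1)F=F(1\otimes z)$, $F^{-1}(1\otimes y)=(y\otimes 1)F^{-1}$, $F^{-1}(z\otimes 1)=(1\otimes z)F^{-1}$, $(1\otimes y)F^{-1}=(S^{-1}(y)\otimes 1)F^{-1}$, $F(z\otimes 1)=F(1\otimes S^{-1}(z))$. The Hopf algebra $C_H(H_s)_F$ ($H$ cocommutative).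 Let ${}_H\mathcal{M}_F$ be the category of left $H$-modules with $M\otimes_t N=\Delta(1)\cdot(M\otimes_k N)$, action $h\cdot(m\otimes_t n)=F^{-(1)}h_1F^{(1)}\cdot m\otimes_t F^{-(2)}h_2F^{(2)}\cdot n$, braiding $m\otimes_t n\mapsto F^{-(1)}F^{(2)}\cdot n\otimes_t F^{-(2)}F^{(1)}\cdot m$, and unit object $H_t$ and unit constraints as in ${}_H\mathcal{M}$. $C_H(H_s)_F$ is the space $C_H(H_s)$ with action $\mathrm{Ad}$, multiplication $a\cdot_F b=\mathrm{Ad}_{F^{(1)}}(a)\mathrm{Ad}_{F^{(2)}}(b)$, unit $\eta_F(x)=x$ ($x\in H_t$), comultiplication $\Delta_F(a)=\mathrm{Ad}_{F^{-(1)}}(a_1)\otimes_t\mathrm{Ad}_{F^{-(2)}}(a_2)$, counit $\varepsilon_F(a)=\varepsilon_t(a)$, antipode $S_F(a)=S(a)$; it is a Hopf algebra in ${}_H\mathcal{M}_F$. Twisting. $(\widetilde H,\widetilde{\mathcal{R}})$ is the quasitriangular quantum groupoid with the same multiplication, unit and counit as $H$ and $\widetilde\Delta(h)=F^{-1}\Delta(h)F$, $\widetilde{\mathcal{R}}=F_{21}^{-1}\mathcal{R}F$, $\widetilde S(h)=vS(h)v^{-1}$, where $F_{21}^{-1}=F^{-(2)}\otimes F^{-(1)}$, $v=F^{-(1)}S(F^{-(2)})$, $v^{-1}=S(F^{(1)})F^{(2)}$. Write $\widetilde\Delta(h)=h_{\tilde1}\otimes h_{\tilde2}$ and $\widetilde{\mathcal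 R}=\widetilde R^{(1)}\otimes\widetilde R^{(2)}$. The category ${}_{\widetilde H}\mathcal{M}$ is identified with ${}_H\mathcal{M}_F$ (same modules, since $\widetilde H=H$ as algebras), so that $C_H(H_s)_F$ is viewed in ${}_{\widetilde H}\mathcal{M}$ with $\widetilde H$ acting by $\mathrm{Ad}$. The Hopf algebra $C_{\widetilde H}(\widetilde H_s)$ in ${}_{\widetilde H}\mathcal{M}$: the centralizer in $\widetilde H$ of its source space $\widetilde H_s$, with action $\widetilde{\mathrm{Ad}}_h(g)=h_{\tilde1}g\widetilde S(h_{\tilde2})$, multiplication $g\otimes_t l\mapsto gl$, unit $x\mapsto x$ ($x\in\widetilde H_t$), comultiplication $g\mapsto g_{\tilde1}\widetilde S(\widetilde R^{(2)})\otimes_t\widetilde{\mathrm{Ad}}_{\widetilde R^{(1)}}(g_{\tilde2})$, counit $g\mapsto\widetilde\varepsilon_t(g)$ (target map of $\widetilde H$), antipode $g\mapsto\widetilde R^{(2)}\widetilde S(\widetilde{\mathrm{Ad}}_{\widetilde R^{(1)}}(g))$.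
   Formalization: The 2-cocycle F is additionally assumed normalised, (ε⊗id)F = 1 = (id⊗ε)F; without this the claim fails, e.g. H = k, F = c(1⊗1) with c ≠ 0, 1 satisfies (1)–(3), but α(1) = c and 1 is not a unit for the twisted product. *)

theory Defs
  imports Complex_Main
begin

text \<open>
  Tensors over a field. An element of \<open>V \<otimes> W\<close> is represented by a finite formal sum of pure tensors,
  i.e. a list of pairs (a Sweedler sum), and equality in \<open>V \<otimes> W\<close> is the least additive congruence that
  makes the pairing bilinear. So the quotient of lists by \<open>teq2\<close> is the usual tensor product over the
  field; likewise \<open>teq3\<close> for threefold tensors. Over a field, \<open>V' \<otimes> W'\<close> embeds into \<open>V \<otimes> W\<close> for
  subspaces \<open>V'\<close> and \<open>W'\<close>, so no separate notion of equality is needed for subspaces.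
\<close>

inductive sum_cong :: "('p list \<Rightarrow> 'p list \<Rightarrow> bool) \<Rightarrow> 'p list \<Rightarrow> 'p list \<Rightarrow> bool"
  for r :: "'p list \<Rightarrow> 'p list \<Rightarrow> bool" where
  base: "r xs ys \<Longrightarrow> sum_cong r xs ys"
| refl: "sum_cong r xs xs"
| sym: "sum_cong r xs ys \<Longrightarrow> sum_cong r ys xs"
| trans: "sum_cong r xs ys \<Longrightarrow> sum_cong r ys zs \<Longrightarrow> sum_cong r xs zs"
| append: "sum_cong r xs xs' \<Longrightarrow> sum_cong r ys ys' \<Longrightarrow> sum_cong r (xs @ ys) (xs' @ ys')"
| comm: "sum_cong r (xs @ ys) (ys @ xs)"

inductive bilinear_rel ::
  "('k::field \<Rightarrow> 'v::ab_group_add \<Rightarrow> 'v) \<Rightarrow> ('v \<times> 'v) list \<Rightarrow> ('v \<times> 'v) list \<Rightarrow> bool"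
  for s :: "'k \<Rightarrow> 'v \<Rightarrow> 'v" where
  "bilinear_rel s [(x + x', y)] [(x, y), (x', y)]"
| "bilinear_rel s [(x, y + y')] [(x, y), (x, y')]"
| "bilinear_rel s [(0, y)] []"
| "bilinear_rel s [(s c x, y)] [(x, s c y)]"

inductive trilinear_rel ::
  "('k::field \<Rightarrow> 'v::ab_group_add \<Rightarrow> 'v) \<Rightarrow> ('v \<times> 'v \<times> 'v) list \<Rightarrow> ('v \<times> 'v \<times> 'v) list \<Rightarrow> bool"
  for s :: "'k \<Rightarrow> 'v \<Rightarrow> 'v" where
  "trilinear_rel s [(x + x', y, z)] [(x, y, z), (x', y, z)]"
| "trilinear_rel s [(x, y + y', z)] [(x, y, z), (x, y', z)]"
| "trilinear_rel s [(x, y, z + z')] [(x, y, z), (x, y, z')]"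
| "trilinear_rel s [(0, y, z)] []"
| "trilinear_rel s [(s c x, y, z)] [(x, s c y, z)]"
| "trilinear_rel s [(x, s c y, z)] [(x, y, s c z)]"

definition teq2 ::
  "('k::field \<Rightarrow> 'v::ab_group_add \<Rightarrow> 'v) \<Rightarrow> ('v \<times> 'v) list \<Rightarrow> ('v \<times> 'v) list \<Rightarrow> bool" where
  "teq2 s = sum_cong (bilinear_rel s)"

definition teq3 ::
  "('k::field \<Rightarrow> 'v::ab_group_add \<Rightarrow> 'v) \<Rightarrow> ('v \<times> 'v \<times> 'v) list \<Rightarrow> ('v \<times> 'v \<times> 'v) list \<Rightarrow> bool" where
  "teq3 s = sum_cong (trilinear_rel s)"

text \<open>The linear map \<open>V \<otimes> W \<rightarrow> U\<close> induced by a bilinear map \<open>f\<close>.\<close>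
definition tsum :: "('a \<Rightarrow> 'b \<Rightarrow> 'u::ab_group_add) \<Rightarrow> ('a \<times> 'b) list \<Rightarrow> 'u" where
  "tsum f t = (\<Sum>(x, y)\<leftarrow>t. f x y)"

definition tswap :: "('a \<times> 'b) list \<Rightarrow> ('b \<times> 'a) list" where
  "tswap t = map (\<lambda>(x, y). (y, x)) t"

definition tmul :: "('a::times \<times> 'a) list \<Rightarrow> ('a \<times> 'a) list \<Rightarrow> ('a \<times> 'a) list" where
  "tmul t u = [(a * c, b * d). (a, b) \<leftarrow> t, (c, d) \<leftarrow> u]"

definition tmul3 ::
  "('a::times \<times> 'a \<times> 'a) list \<Rightarrow> ('a \<times> 'a \<times> 'a) list \<Rightarrow> ('a \<times> 'a \<times> 'a) list" where
  "tmul3 t u = [(a * a', b * b', c * c'). (a, b, c) \<leftarrow> t, (a', b', c') \<leftarrow> u]"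

definition map_left :: "('v \<Rightarrow> ('v \<times> 'v) list) \<Rightarrow> ('v \<times> 'v) list \<Rightarrow> ('v \<times> 'v \<times> 'v) list" where
  "map_left D t = [(x, y, b). (a, b) \<leftarrow> t, (x, y) \<leftarrow> D a]"

definition map_right :: "('v \<Rightarrow> ('v \<times> 'v) list) \<Rightarrow> ('v \<times> 'v) list \<Rightarrow> ('v \<times> 'v \<times> 'v) list" where
  "map_right D t = [(a, x, y). (a, b) \<leftarrow> t, (x, y) \<leftarrow> D b]"

definition bilinear_map ::
  "('k::field \<Rightarrow> 'a::ab_group_add \<Rightarrow> 'a) \<Rightarrow> ('k \<Rightarrow> 'b::ab_group_add \<Rightarrow> 'b) \<Rightarrow>
   ('k \<Rightarrow> 'c::ab_group_add \<Rightarrow> 'c) \<Rightarrow> ('a \<Rightarrow> 'b \<Rightarrow> 'c) \<Rightarrow> bool" where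
  "bilinear_map s1 s2 s3 f \<longleftrightarrow>
     (\<forall>y. Vector_Spaces.linear s1 s3 (\<lambda>x. f x y)) \<and> (\<forall>x. Vector_Spaces.linear s2 s3 (f x))"

definition tlinear ::
  "('k::field \<Rightarrow> 'v::ab_group_add \<Rightarrow> 'v) \<Rightarrow> ('v \<Rightarrow> ('v \<times> 'v) list) \<Rightarrow> bool" where
  "tlinear s D \<longleftrightarrow>
     (\<forall>x y. teq2 s (D (x + y)) (D x @ D y)) \<and>
     (\<forall>c x. teq2 s (D (s c x)) (map (\<lambda>(a, b). (s c a, b)) (D x)))"


text \<open>
  Weak bialgebras and quantum groupoids. Multiplication and unit are those of the type \<open>'h\<close>; the sort
  \<open>{ring, monoid_mult}\<close> is that of unital associative rings, the zero ring not being excluded.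
\<close>

record ('k, 'h) qgroupoid =
  scal :: "'k \<Rightarrow> 'h \<Rightarrow> 'h"
  comult :: "'h \<Rightarrow> ('h \<times> 'h) list"
  counit :: "'h \<Rightarrow> 'k"
  antipode :: "'h \<Rightarrow> 'h"

definition epst :: "('k::field, 'h::{ring, monoid_mult}) qgroupoid \<Rightarrow> 'h \<Rightarrow> 'h" where
  "epst H h = tsum (\<lambda>a b. scal H (counit H (a * h)) b) (comult H 1)"

definition epss :: "('k::field, 'h::{ring, monoid_mult}) qgroupoid \<Rightarrow> 'h \<Rightarrow> 'h" where
  "epss H h = tsum (\<lambda>a b. scal H (counit H (h * b)) a) (comult H 1)"

definition target_space :: "('k::field, 'h::{ring, monoid_mult}) qgroupoid \<Rightarrow> 'h set" where
  "target_space H = range (epst H)"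

definition source_space :: "('k::field, 'h::{ring, monoid_mult}) qgroupoid \<Rightarrow> 'h set" where
  "source_space H = range (epss H)"

definition weak_bialgebra :: "('k::field, 'h::{ring, monoid_mult}) qgroupoid \<Rightarrow> bool" where
  "weak_bialgebra H \<longleftrightarrow>
     \<comment> \<open>algebra over the field\<close>
     vector_space (scal H) \<and>
     bilinear_map (scal H) (scal H) (scal H) (*) \<and>
     \<comment> \<open>coalgebra\<close>
     tlinear (scal H) (comult H) \<and>
     Vector_Spaces.linear (scal H) (*) (counit H) \<and>
     (\<forall>h. teq3 (scal H) (map_left (comult H) (comult H h)) (map_right (comult H) (comult H h))) \<and>
     (\<forall>h. tsum (\<lambda>a b. scal H (counit H a) b) (comult H h) = h) \<and>
     (\<forall>h. tsum (\<lambda>a b. scal H (counit H b) a) (comult H h) = h) \<and>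
     \<comment> \<open>compatibility\<close>
     (\<forall>h l. teq2 (scal H) (comult H (h * l)) (tmul (comult H h) (comult H l))) \<and>
     teq3 (scal H) (map_left (comult H) (comult H 1))
       [(a, b * c, d). (a, b) \<leftarrow> comult H 1, (c, d) \<leftarrow> comult H 1] \<and>
     teq3 (scal H) (map_left (comult H) (comult H 1))
       [(a, c * b, d). (a, b) \<leftarrow> comult H 1, (c, d) \<leftarrow> comult H 1] \<and>
     (\<forall>h g l. counit H (h * g * l) = tsum (\<lambda>a b. counit H (h * a) * counit H (b * l)) (comult H g)) \<and>
     (\<forall>h g l. counit H (h * g * l) = tsum (\<lambda>a b. counit H (h * b) * counit H (a * l)) (comult H g))"

definition quantum_groupoid :: "('k::field, 'h::{ring, monoid_mult}) qgroupoid \<Rightarrow> bool" where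
  "quantum_groupoid H \<longleftrightarrow>
     weak_bialgebra H \<and>
     Vector_Spaces.linear (scal H) (scal H) (antipode H) \<and>
     (\<forall>h. tsum (\<lambda>a b. antipode H a * b) (comult H h) = epss H h) \<and>
     (\<forall>h. tsum (\<lambda>a b. a * antipode H b) (comult H h) = epst H h) \<and>
     (\<forall>h. (\<Sum>(a, b, c)\<leftarrow>map_left (comult H) (comult H h). antipode H a * b * antipode H c) = antipode H h) \<and>
     bij (antipode H)"

definition cocommutative :: "('k::field, 'h::{ring, monoid_mult}) qgroupoid \<Rightarrow> bool" where
  "cocommutative H \<longleftrightarrow> (\<forall>h. teq2 (scal H) (comult H h) (tswap (comult H h)))"

definition centralizer :: "'h::times set \<Rightarrow> 'h set" where
  "centralizer A = {g. \<forall>x\<in>A. g * x = x * g}"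

definition adj :: "('k::field, 'h::{ring, monoid_mult}) qgroupoid \<Rightarrow> 'h \<Rightarrow> 'h \<Rightarrow> 'h" where
  "adj H h g = tsum (\<lambda>a b. a * g * antipode H b) (comult H h)"


text \<open>
  Weak invertible unit 2-cocycles. The inverse \<open>Fi\<close> is uniquely determined by \<open>F\<close>. The last two clauses are
  the normalisation expressed by the word ``unit''. It does not follow from the other clauses: for the
  one-dimensional \<open>H\<close> they hold for every nonzero scalar \<open>F = c (1 \<otimes> 1)\<close>, whereas \<open>1\<close> is a unit
  for the multiplication \<open>c a b\<close> twisted by \<open>F\<close> only if \<open>c = 1\<close>.
\<close>

definition weak_inv_unit_2cocycle ::
  "('k::field, 'h::{ring, monoid_mult}) qgroupoid \<Rightarrow> ('h \<times> 'h) list \<Rightarrow> ('h \<times> 'h) list \<Rightarrow> bool" where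
  "weak_inv_unit_2cocycle H F Fi \<longleftrightarrow>
    (let eq = teq2 (scal H); D1 = comult H 1; D1c = tswap (comult H 1); Si = inv (antipode H) in
     (\<exists>t. eq F (tmul (tmul D1 t) D1c)) \<and>
     (\<exists>t. eq Fi (tmul (tmul D1c t) D1)) \<and>
     eq (tmul F Fi) D1 \<and> eq (tmul Fi F) D1c \<and>
     teq3 (scal H)
       (tmul3 (map_left (comult H) F) (map (\<lambda>(a, b). (a, b, 1)) F))
       (tmul3 (map_right (comult H) F) (map (\<lambda>(a, b). (1, a, b)) F)) \<and>
     (\<forall>y\<in>source_space H. eq (tmul [(1, y)] F) (tmul F [(y, 1)])) \<and>
     (\<forall>z\<in>target_space H. eq (tmul [(z, 1)] F) (tmul F [(1, z)])) \<and>
     (\<forall>y\<in>source_space H. eq (tmul Fi [(1, y)]) (tmul [(y, 1)] Fi)) \<and>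
     (\<forall>z\<in>target_space H. eq (tmul Fi [(z, 1)]) (tmul [(1, z)] Fi)) \<and>
     (\<forall>y\<in>source_space H. eq (tmul [(1, y)] Fi) (tmul [(Si y, 1)] Fi)) \<and>
     (\<forall>z\<in>target_space H. eq (tmul F [(z, 1)]) (tmul F [(1, Si z)])) \<and>
     tsum (\<lambda>a b. scal H (counit H a) b) F = 1 \<and>
     tsum (\<lambda>a b. scal H (counit H b) a) F = 1)"


definition cocomm_R :: "('k::field, 'h::{ring, monoid_mult}) qgroupoid \<Rightarrow> ('h \<times> 'h) list" where
  "cocomm_R H = tmul (tswap (comult H 1)) (comult H 1)"

definition twist ::
  "('k::field, 'h::{ring, monoid_mult}) qgroupoid \<Rightarrow> ('h \<times> 'h) list \<Rightarrow> ('h \<times> 'h) list \<Rightarrow>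
   ('k, 'h) qgroupoid" where
  "twist H F Fi = H
     \<lparr> comult := (\<lambda>h. tmul (tmul Fi (comult H h)) F),
       antipode := (\<lambda>h. tsum (\<lambda>a b. a * antipode H b) Fi * antipode H h * tsum (\<lambda>a b. antipode H a * b) F) \<rparr>"

definition twist_R :: "('h::times \<times> 'h) list \<Rightarrow> ('h \<times> 'h) list \<Rightarrow> ('h \<times> 'h) list \<Rightarrow> ('h \<times> 'h) list" where
  "twist_R R F Fi = tmul (tmul (tswap Fi) R) F"


text \<open>
  Hopf algebras in the braided category of left modules over a quasitriangular quantum groupoid \<open>(H, R)\<close>.
  The underlying space of an object is a subspace \<open>car A\<close> of \<open>'v\<close>, and linear maps between subspaces are
  given by linear maps of the ambient spaces (every linear map on a subspace extends); equations between
  morphisms are only required on the underlying subspaces. A morphism out of \<open>V \<otimes>\<^sub>t W\<close> is given by its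
  values on the generators \<open>v \<otimes>\<^sub>t w\<close>, as a bilinear map \<open>m v w\<close>.
\<close>

record ('k, 'h, 'v) hopf_data =
  car :: "'v set"
  vscal :: "'k \<Rightarrow> 'v \<Rightarrow> 'v"
  act :: "'h \<Rightarrow> 'v \<Rightarrow> 'v"
  mu :: "'v \<Rightarrow> 'v \<Rightarrow> 'v"
  eta :: "'h \<Rightarrow> 'v"
  delta :: "'v \<Rightarrow> ('v \<times> 'v) list"
  eps :: "'v \<Rightarrow> 'h"
  anti :: "'v \<Rightarrow> 'v"

definition left_module ::
  "('k::field, 'h::{ring, monoid_mult}) qgroupoid \<Rightarrow> ('k \<Rightarrow> 'v::ab_group_add \<Rightarrow> 'v) \<Rightarrow>
   'v set \<Rightarrow> ('h \<Rightarrow> 'v \<Rightarrow> 'v) \<Rightarrow> bool" where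
  "left_module H s V ac \<longleftrightarrow>
     vector_space s \<and> module.subspace s V \<and> bilinear_map (scal H) s s ac \<and>
     (\<forall>h. \<forall>v\<in>V. ac h v \<in> V) \<and>
     (\<forall>v\<in>V. ac 1 v = v) \<and>
     (\<forall>h l. \<forall>v\<in>V. ac (h * l) v = ac h (ac l v))"

definition module_morphism ::
  "('k::field \<Rightarrow> 'v::ab_group_add \<Rightarrow> 'v) \<Rightarrow> 'v set \<Rightarrow> ('h \<Rightarrow> 'v \<Rightarrow> 'v) \<Rightarrow>
   ('k \<Rightarrow> 'w::ab_group_add \<Rightarrow> 'w) \<Rightarrow> 'w set \<Rightarrow> ('h \<Rightarrow> 'w \<Rightarrow> 'w) \<Rightarrow> ('v \<Rightarrow> 'w) \<Rightarrow> bool" where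
  "module_morphism s V ac s' W ac' f \<longleftrightarrow>
     Vector_Spaces.linear s s' f \<and>
     (\<forall>v\<in>V. f v \<in> W) \<and>
     (\<forall>h. \<forall>v\<in>V. f (ac h v) = ac' h (f v))"

text \<open>The action of \<open>H\<close> on tensors.\<close>
definition tact ::
  "('k::field, 'h::{ring, monoid_mult}) qgroupoid \<Rightarrow> ('h \<Rightarrow> 'v \<Rightarrow> 'v) \<Rightarrow> 'h \<Rightarrow> ('v \<times> 'v) list \<Rightarrow> ('v \<times> 'v) list" where
  "tact H ac h t = [(ac a x, ac b y). (a, b) \<leftarrow> comult H h, (x, y) \<leftarrow> t]"

text \<open>The sum of the \<open>v \<otimes>\<^sub>t w\<close> with \<open>(v, w)\<close> running through \<open>t\<close>.\<close>
abbreviation tens_t ::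
  "('k::field, 'h::{ring, monoid_mult}) qgroupoid \<Rightarrow> ('h \<Rightarrow> 'v \<Rightarrow> 'v) \<Rightarrow> ('v \<times> 'v) list \<Rightarrow> ('v \<times> 'v) list" where
  "tens_t H ac t \<equiv> tact H ac 1 t"

text \<open>Membership in \<open>V \<otimes>\<^sub>t V\<close>.\<close>
definition in_tens_t ::
  "('k::field, 'h::{ring, monoid_mult}) qgroupoid \<Rightarrow> ('k \<Rightarrow> 'v::ab_group_add \<Rightarrow> 'v) \<Rightarrow> 'v set \<Rightarrow>
   ('h \<Rightarrow> 'v \<Rightarrow> 'v) \<Rightarrow> ('v \<times> 'v) list \<Rightarrow> bool" where
  "in_tens_t H s V ac t \<longleftrightarrow> (\<exists>u. set u \<subseteq> V \<times> V \<and> teq2 s t (tens_t H ac u))"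

text \<open>The action of \<open>H\<close> on the unit object, the target space. The left unit constraint of the unit object
  is therefore \<open>z \<otimes>\<^sub>t w \<mapsto> unit_act H z w\<close>.\<close>
definition unit_act :: "('k::field, 'h::{ring, monoid_mult}) qgroupoid \<Rightarrow> 'h \<Rightarrow> 'h \<Rightarrow> 'h" where
  "unit_act H h z = epst H (h * z)"

text \<open>In the \<open>H\<close>-linearity of \<open>mu\<close>, the case \<open>h = 1\<close> expresses that \<open>v \<otimes>\<^sub>t w \<mapsto> mu A v w\<close> is well defined.\<close>
definition algebra_in ::
  "('k::field, 'h::{ring, monoid_mult}) qgroupoid \<Rightarrow> ('k, 'h, 'v::ab_group_add) hopf_data \<Rightarrow> bool" where
  "algebra_in H A \<longleftrightarrow>
     left_module H (vscal A) (car A) (act A) \<and>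
     bilinear_map (vscal A) (vscal A) (vscal A) (mu A) \<and>
     (\<forall>a\<in>car A. \<forall>b\<in>car A. mu A a b \<in> car A) \<and>
     (\<forall>h. \<forall>a\<in>car A. \<forall>b\<in>car A. act A h (mu A a b) = tsum (mu A) (tact H (act A) h [(a, b)])) \<and>
     module_morphism (scal H) (target_space H) (unit_act H) (vscal A) (car A) (act A) (eta A) \<and>
     (\<forall>a\<in>car A. \<forall>b\<in>car A. \<forall>c\<in>car A. mu A (mu A a b) c = mu A a (mu A b c)) \<and>
     (\<forall>z\<in>target_space H. \<forall>a\<in>car A. mu A (eta A z) a = act A z a) \<and>
     (\<forall>z\<in>target_space H. \<forall>a\<in>car A. mu A a (eta A z) = act A (inv (antipode H) z) a)"

definition coalgebra_in ::
  "('k::field, 'h::{ring, monoid_mult}) qgroupoid \<Rightarrow> ('k, 'h, 'v::ab_group_add) hopf_data \<Rightarrow> bool" where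
  "coalgebra_in H A \<longleftrightarrow>
     left_module H (vscal A) (car A) (act A) \<and>
     tlinear (vscal A) (delta A) \<and>
     (\<forall>a\<in>car A. in_tens_t H (vscal A) (car A) (act A) (delta A a)) \<and>
     (\<forall>h. \<forall>a\<in>car A. teq2 (vscal A) (delta A (act A h a)) (tact H (act A) h (delta A a))) \<and>
     module_morphism (vscal A) (car A) (act A) (scal H) (target_space H) (unit_act H) (eps A) \<and>
     (\<forall>a\<in>car A. teq3 (vscal A) (map_left (delta A) (delta A a)) (map_right (delta A) (delta A a))) \<and>
     (\<forall>a\<in>car A. tsum (\<lambda>x y. act A (eps A x) y) (delta A a) = a) \<and>
     (\<forall>a\<in>car A. tsum (\<lambda>x y. act A (inv (antipode H) (eps A y)) x) (delta A a) = a)"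

text \<open>\<open>(\<mu> \<otimes> \<mu>) (id \<otimes> \<Psi> \<otimes> id)\<close> with \<open>\<Psi> (v \<otimes>\<^sub>t w) = R\<^sup>2 w \<otimes>\<^sub>t R\<^sup>1 v\<close>.\<close>
definition braided_mul ::
  "('k::field, 'h::{ring, monoid_mult}) qgroupoid \<Rightarrow> ('h \<times> 'h) list \<Rightarrow>
   ('k, 'h, 'v::ab_group_add) hopf_data \<Rightarrow> ('v \<times> 'v) list \<Rightarrow> ('v \<times> 'v) list \<Rightarrow> ('v \<times> 'v) list" where
  "braided_mul H R A t u = tens_t H (act A)
     [(mu A a (act A r2 c), mu A (act A r1 b) d). (a, b) \<leftarrow> t, (c, d) \<leftarrow> u, (r1, r2) \<leftarrow> R]"

text \<open>The condition \<open>\<Delta> \<circ> \<eta> = \<eta> \<otimes> \<eta>\<close> is stated after composition with the unit constraint \<open>z \<otimes>\<^sub>t w \<mapsto> z \<cdot> w\<close>,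
  an isomorphism from the tensor square of the unit object to the unit object.\<close>
definition bialgebra_in ::
  "('k::field, 'h::{ring, monoid_mult}) qgroupoid \<Rightarrow> ('h \<times> 'h) list \<Rightarrow>
   ('k, 'h, 'v::ab_group_add) hopf_data \<Rightarrow> bool" where
  "bialgebra_in H R A \<longleftrightarrow>
     algebra_in H A \<and> coalgebra_in H A \<and>
     (\<forall>a\<in>car A. \<forall>b\<in>car A.
        teq2 (vscal A) (delta A (mu A a b)) (braided_mul H R A (delta A a) (delta A b))) \<and>
     (\<forall>a\<in>car A. \<forall>b\<in>car A. eps A (mu A a b) = unit_act H (eps A a) (eps A b)) \<and>
     (\<forall>z\<in>target_space H. \<forall>w\<in>target_space H.
        teq2 (vscal A) (delta A (eta A (unit_act H z w))) (tens_t H (act A) [(eta A z, eta A w)]))"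

definition hopf_algebra_in ::
  "('k::field, 'h::{ring, monoid_mult}) qgroupoid \<Rightarrow> ('h \<times> 'h) list \<Rightarrow>
   ('k, 'h, 'v::ab_group_add) hopf_data \<Rightarrow> bool" where
  "hopf_algebra_in H R A \<longleftrightarrow>
     bialgebra_in H R A \<and>
     module_morphism (vscal A) (car A) (act A) (vscal A) (car A) (act A) (anti A) \<and>
     (\<forall>a\<in>car A. tsum (\<lambda>x y. mu A (anti A x) y) (delta A a) = eta A (eps A a)) \<and>
     (\<forall>a\<in>car A. tsum (\<lambda>x y. mu A x (anti A y)) (delta A a) = eta A (eps A a))"

definition hopf_isomorphism_in ::
  "('k::field, 'h::{ring, monoid_mult}) qgroupoid \<Rightarrow> ('h \<times> 'h) list \<Rightarrow>
   ('k, 'h, 'v::ab_group_add) hopf_data \<Rightarrow> ('k, 'h, 'w::ab_group_add) hopf_data \<Rightarrow> ('v \<Rightarrow> 'w) \<Rightarrow> bool" where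
  "hopf_isomorphism_in H R A B f \<longleftrightarrow>
     hopf_algebra_in H R A \<and> hopf_algebra_in H R B \<and>
     module_morphism (vscal A) (car A) (act A) (vscal B) (car B) (act B) f \<and>
     bij_betw f (car A) (car B) \<and>
     (\<forall>a\<in>car A. \<forall>b\<in>car A. f (mu A a b) = mu B (f a) (f b)) \<and>
     (\<forall>z\<in>target_space H. f (eta A z) = eta B z) \<and>
     (\<forall>a\<in>car A. teq2 (vscal B) (map (map_prod f f) (delta A a)) (delta B (f a))) \<and>
     (\<forall>a\<in>car A. eps B (f a) = eps A a) \<and>
     (\<forall>a\<in>car A. f (anti A a) = anti B (f a))"


text \<open>The Hopf algebra \<open>C\<^sub>H(H\<^sub>s)\<^sub>F\<close>.\<close>
definition centralizer_F ::
  "('k::field, 'h::{ring, monoid_mult}) qgroupoid \<Rightarrow> ('h \<times> 'h) list \<Rightarrow> ('h \<times> 'h) list \<Rightarrow>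
   ('k, 'h, 'h) hopf_data" where
  "centralizer_F H F Fi =
     \<lparr> car = centralizer (source_space H),
       vscal = scal H,
       act = adj H,
       mu = (\<lambda>a b. tsum (\<lambda>x y. adj H x a * adj H y b) F),
       eta = (\<lambda>x. x),
       delta = (\<lambda>a. tens_t H (adj H) [(adj H x a1, adj H y a2). (x, y) \<leftarrow> Fi, (a1, a2) \<leftarrow> comult H a]),
       eps = epst H,
       anti = antipode H \<rparr>"

text \<open>The Hopf algebra \<open>C\<^sub>H(H\<^sub>s)\<close> of a quasitriangular quantum groupoid \<open>(H, R)\<close>.\<close>
definition centralizer_hopf ::
  "('k::field, 'h::{ring, monoid_mult}) qgroupoid \<Rightarrow> ('h \<times> 'h) list \<Rightarrow> ('k, 'h, 'h) hopf_data" where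
  "centralizer_hopf H R =
     \<lparr> car = centralizer (source_space H),
       vscal = scal H,
       act = adj H,
       mu = (\<lambda>g l. g * l),
       eta = (\<lambda>x. x),
       delta = (\<lambda>g. tens_t H (adj H)
                  [(g1 * antipode H r2, adj H r1 g2). (g1, g2) \<leftarrow> comult H g, (r1, r2) \<leftarrow> R]),
       eps = epst H,
       anti = (\<lambda>g. tsum (\<lambda>r1 r2. r2 * antipode H (adj H r1 g)) R) \<rparr>"

end

theory Submission imports Defs begin

text \<open>
  For cocommutative \<open>H\<close> the two base algebras coincide, \<open>H\<^sub>s = H\<^sub>t = K\<close>, the antipode is involutive and the
  identity on \<open>K\<close>, and \<open>F\<close>, \<open>F\<^sup>-\<^sup>1\<close> commute with \<open>K\<close> in every leg. Since \<open>Ad\<close> turns elements of \<open>H\<^sup>\<otimes>\<^sup>n\<close> into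
  operators, each Hopf algebra axiom for \<open>C\<^sub>H(H\<^sub>s)\<^sub>F\<close> reduces to an identity between products of copies of \<open>F\<close> and
  \<open>F\<^sup>-\<^sup>1\<close> placed in several legs. The cocycle identity rewrites \<open>\<alpha>\<close> as \<open>\<alpha>(a) = F\<^sup>-\<^sup>(\<^sup>1\<^sup>) a S(F\<^sup>-\<^sup>(\<^sup>2\<^sup>)) v\<^sup>-\<^sup>1\<close>, whence it is
  bijective with inverse \<open>g \<mapsto> F\<^sup>(\<^sup>1\<^sup>) g v S(F\<^sup>(\<^sup>2\<^sup>))\<close> and intertwines the two adjoint actions. For the comultiplications
  one uses that \<open>(\<Delta> \<otimes> \<Delta>)(F) F\<^sub>1\<^sub>2 F\<^sub>3\<^sub>4\<close> changes by the factor \<open>F\<^sub>2\<^sub>3\<^sup>-\<^sup>1 F\<^sub>3\<^sub>2\<close>, i.e. by the twisted R-matrix, when the legs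
  2 and 3 are exchanged. As \<open>\<alpha>\<close> respects all structure maps, the Hopf algebra axioms carry over from
  \<open>C\<^sub>H(H\<^sub>s)\<^sub>F\<close> to the centralizer of the twisted groupoid.
\<close>

section \<open>Formal sums and their linear evaluation\<close>

text \<open>Tensors are formal sums modulo an inductively generated congruence, with no quotient
  type to compute in. Over a field a tensor vanishes as soon as all scalar multilinear forms vanish
  on it; hence a tensor identity is evaluated by an arbitrary form and becomes an equation between
  nested sums, in which an axiom rewrites one inner sum. Where several copies of \<open>F\<close>
  interact, such sums become unmanageable; these identities are derived instead in a semigroup of
  multi-leg tensors, by associativity alone, and only the results are evaluated. The second obstacle
  is that \<open>F\<close> is invertible only up to the idempotent Delta(1): each cancellation
  leaves a Delta(1) behind that has to reach a factor absorbing it. It can travel because Delta(1)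
  lies in K \<otimes> K, with \<open>K\<close> the base algebra. The twisted comultiplication takes
  the same value Delta(1) on the unit, so the tensor product over the base, both counital maps and
  the space \<open>C\<close> are common to \<open>H\<close> and its twist.\<close>

abbreviation lin where "lin \<equiv> Vector_Spaces.linear"

syntax "_tsum" :: "pttrn \<Rightarrow> pttrn \<Rightarrow> 'a \<Rightarrow> 'b \<Rightarrow> 'b"  ("(3\<Sum>_ _\<in>_./ _)" [0, 0, 51, 10] 10)
translations "\<Sum>x y\<in>t. b" == "CONST tsum (\<lambda>x y. b) t"

lemma vector_space_field: "vector_space ((*) :: 'k::field \<Rightarrow> 'k \<Rightarrow> 'k)"
  by unfold_locales (auto simp: algebra_simps)

lemma tsum_Nil [simp]: "tsum f [] = 0"
  and tsum_Cons [simp]: "tsum f (p # t) = f (fst p) (snd p) + tsum f t"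
  and tsum_append [simp]: "tsum f (t @ u) = tsum f t + tsum f u"
  by (auto simp: tsum_def split: prod.splits)

lemma tsum_map: "tsum f (map g t) = (\<Sum>x y\<in>t. f (fst (g (x, y))) (snd (g (x, y))))"
  by (induction t) auto

lemma tsum_concat_map: "tsum f (concat (map g t)) = (\<Sum>x y\<in>t. tsum f (g (x, y)))"
  by (induction t) auto

lemma tsum_cong: "(\<And>x y. (x, y) \<in> set t \<Longrightarrow> f x y = g x y) \<Longrightarrow> tsum f t = tsum g t"
  by (induction t) auto

lemma tsum_add: "(\<Sum>x y\<in>t. f x y + g x y) = tsum f t + tsum g t"
  by (induction t) (auto simp: algebra_simps)

lemma tsum_zero: "(\<Sum>x y\<in>t. 0) = 0"
  by (induction t) auto

lemma tsum_commute: "(\<Sum>x y\<in>t. \<Sum>a b\<in>u. f x y a b) = (\<Sum>a b\<in>u. \<Sum>x y\<in>t. f x y a b)"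
  by (induction t) (simp_all add: tsum_zero tsum_add)

text \<open>The lists are distinct variables here, although the applications instantiate several of
  them with the same \<open>F\<close> or \<open>Fi\<close>: \<open>tsum_commute\<close> restricted
  to one named list then moves exactly that sum, while with repeated lists the restriction would no
  longer single out one of them.\<close>

lemma tsum_permute6:
  "(\<Sum>a1 b1\<in>t1. \<Sum>a2 b2\<in>t2. \<Sum>a3 b3\<in>t3. \<Sum>a4 b4\<in>t4. \<Sum>a5 b5\<in>t5. \<Sum>a6 b6\<in>t6. f a1 b1 a2 b2 a3 b3 a4 b4 a5 b5 a6 b6) =
   (\<Sum>a6 b6\<in>t6. \<Sum>a5 b5\<in>t5. \<Sum>a3 b3\<in>t3. \<Sum>a4 b4\<in>t4. \<Sum>a1 b1\<in>t1. \<Sum>a2 b2\<in>t2. f a1 b1 a2 b2 a3 b3 a4 b4 a5 b5 a6 b6)"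
  unfolding tsum_commute[where u = t5]
  unfolding tsum_commute[where u = t6]
  unfolding tsum_commute[where t = t1]
  unfolding tsum_commute[where t = t2] ..

lemma tsum_move_in9:
  "(\<Sum>u w\<in>T. \<Sum>a1 b1\<in>t1. \<Sum>a2 b2\<in>t2. \<Sum>p q\<in>t3. \<Sum>a4 b4\<in>t4 p. \<Sum>a5 b5\<in>t5 q. \<Sum>x y\<in>t6. \<Sum>a7 b7\<in>t7 x. \<Sum>a8 b8\<in>t8 y.
        \<Sum>a9 b9\<in>t9. f u w a1 b1 a2 b2 p q a4 b4 a5 b5 x y a7 b7 a8 b8 a9 b9) =
   (\<Sum>a1 b1\<in>t1. \<Sum>a2 b2\<in>t2. \<Sum>p q\<in>t3. \<Sum>a4 b4\<in>t4 p. \<Sum>a5 b5\<in>t5 q. \<Sum>x y\<in>t6. \<Sum>a7 b7\<in>t7 x. \<Sum>a8 b8\<in>t8 y. \<Sum>a9 b9\<in>t9.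
         \<Sum>u w\<in>T. f u w a1 b1 a2 b2 p q a4 b4 a5 b5 x y a7 b7 a8 b8 a9 b9)"
  unfolding tsum_commute[where t = T] ..

lemma tsum_rotate3:
  "(\<Sum>p q\<in>t1. \<Sum>x y\<in>t2. \<Sum>u w\<in>t3. f p q x y u w) =
   (\<Sum>u w\<in>t3. \<Sum>p q\<in>t1. \<Sum>x y\<in>t2. f p q x y u w)"
  unfolding tsum_commute[where u = t3] ..

lemma tsum_permute4:
  "(\<Sum>p q\<in>t1. \<Sum>x y\<in>t2. \<Sum>u w\<in>t3. \<Sum>r t\<in>t4. f p q x y u w r t) =
   (\<Sum>u w\<in>t3. \<Sum>r t\<in>t4. \<Sum>p q\<in>t1. \<Sum>x y\<in>t2. f p q x y u w r t)"
  "(\<Sum>p q\<in>t1. \<Sum>x y\<in>t2. \<Sum>u w\<in>t3. \<Sum>r t\<in>t4. f p q x y u w r t) =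
   (\<Sum>r t\<in>t4. \<Sum>u w\<in>t3. \<Sum>p q\<in>t1. \<Sum>x y\<in>t2. f p q x y u w r t)"
proof -
  show "(\<Sum>p q\<in>t1. \<Sum>x y\<in>t2. \<Sum>u w\<in>t3. \<Sum>r t\<in>t4. f p q x y u w r t) =
   (\<Sum>u w\<in>t3. \<Sum>r t\<in>t4. \<Sum>p q\<in>t1. \<Sum>x y\<in>t2. f p q x y u w r t)"
    unfolding tsum_commute[where u = t4] unfolding tsum_commute[where u = t3] ..
  show "(\<Sum>p q\<in>t1. \<Sum>x y\<in>t2. \<Sum>u w\<in>t3. \<Sum>r t\<in>t4. f p q x y u w r t) =
   (\<Sum>r t\<in>t4. \<Sum>u w\<in>t3. \<Sum>p q\<in>t1. \<Sum>x y\<in>t2. f p q x y u w r t)"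
    unfolding tsum_commute[where u = t3] unfolding tsum_commute[where u = t4] ..
qed

lemma tsum_tmul: "tsum f (tmul t u) = (\<Sum>a b\<in>t. \<Sum>c d\<in>u. f (a * c) (b * d))"
  unfolding tmul_def by (simp add: tsum_concat_map tsum_map case_prod_beta)

lemma tmul_assoc: "tmul (tmul t u) v = tmul t (tmul u (v :: ('h::semigroup_mult \<times> 'h) list))"
proof -
  have "tmul (map (\<lambda>(c, d). (a * c, b * d)) u) v = map (\<lambda>(c, d). (a * c, b * d)) (tmul u v)" for a b and u :: "('h \<times> 'h) list"
    unfolding tmul_def by (induction u) (auto simp: mult.assoc)
  then show ?thesis
    by (induction t) (auto simp: tmul_def)
qed

lemma tsum_tswap: "tsum f (tswap t) = (\<Sum>a b\<in>t. f b a)"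
  unfolding tswap_def by (simp add: tsum_map)

lemma tsum_tact: "tsum f (tact H ac h t) = (\<Sum>a b\<in>comult H h. \<Sum>x y\<in>t. f (ac a x) (ac b y))"
  unfolding tact_def by (simp add: tsum_concat_map tsum_map case_prod_beta)

lemma tsum_times_right: "tsum f t * (c :: 'h::ring) = (\<Sum>x y\<in>t. f x y * c)"
  by (induction t) (auto simp: algebra_simps)

lemma tsum_times_left: "(c :: 'h::ring) * tsum f t = (\<Sum>x y\<in>t. c * f x y)"
  by (induction t) (auto simp: algebra_simps)

definition tsum3 :: "('a \<Rightarrow> 'b \<Rightarrow> 'c \<Rightarrow> 'u::ab_group_add) \<Rightarrow> ('a \<times> 'b \<times> 'c) list \<Rightarrow> 'u" where
  "tsum3 f t = (\<Sum>(x, y, z)\<leftarrow>t. f x y z)"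

lemma tsum3_Nil [simp]: "tsum3 f [] = 0"
  and tsum3_Cons [simp]: "tsum3 f (p # t) = f (fst p) (fst (snd p)) (snd (snd p)) + tsum3 f t"
  and tsum3_append [simp]: "tsum3 f (t @ u) = tsum3 f t + tsum3 f u"
  by (auto simp: tsum3_def split: prod.splits)

lemma tsum3_map: "tsum3 f (map g t) =
    (\<Sum>x y\<in>t. f (fst (g (x, y))) (fst (snd (g (x, y)))) (snd (snd (g (x, y)))))"
  by (induction t) auto

lemma tsum3_map3: "tsum3 f (map g t) =
    tsum3 (\<lambda>x y z. f (fst (g (x, y, z))) (fst (snd (g (x, y, z)))) (snd (snd (g (x, y, z))))) t"
  by (induction t) auto

lemma tsum3_concat_map: "tsum3 f (concat (map g t)) = (\<Sum>x y\<in>t. tsum3 f (g (x, y)))"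
  by (induction t) auto

lemma tsum3_concat_map3: "tsum3 f (concat (map g t)) = tsum3 (\<lambda>x y z. tsum3 f (g (x, y, z))) t"
  by (induction t) auto

lemma tsum3_map_left: "tsum3 f (map_left D t) = (\<Sum>a b\<in>t. \<Sum>x y\<in>D a. f x y b)"
  unfolding map_left_def by (simp add: tsum3_concat_map tsum3_map case_prod_beta)

lemma tsum3_map_right: "tsum3 f (map_right D t) = (\<Sum>a b\<in>t. \<Sum>x y\<in>D b. f a x y)"
  unfolding map_right_def by (simp add: tsum3_concat_map tsum3_map case_prod_beta)

lemma tsum3_tmul3: "tsum3 f (tmul3 t u) =
    tsum3 (\<lambda>a b c. tsum3 (\<lambda>a' b' c'. f (a * a') (b * b') (c * c')) u) t"
  unfolding tmul3_def by (simp add: tsum3_concat_map3 tsum3_map3 case_prod_beta)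

lemma lin_tsum_apply:
  assumes "lin s1 s2 f" shows "f (tsum g t) = (\<Sum>x y\<in>t. f (g x y))"
proof -
  have "f (0 + 0) = f 0 + f 0" using assms unfolding Vector_Spaces.linear_iff by blast
  then have "f 0 = 0" by simp
  then show ?thesis using assms by (induction t) (auto simp: Vector_Spaces.linear_iff)
qed

lemma linI:
  assumes "vector_space s1" "vector_space s2"
    and "\<And>x y. f (x + y) = f x + f y" "\<And>c x. f (s1 c x) = s2 c (f x)"
  shows "lin s1 s2 f"
  using assms by (simp add: Vector_Spaces.linear_iff)

lemma lin_add: "lin s1 s2 f \<Longrightarrow> f (x + y) = f x + f y"
  and lin_scale: "lin s1 s2 f \<Longrightarrow> f (s1 c x) = s2 c (f x)"
  and lin_vs1: "lin s1 s2 f \<Longrightarrow> vector_space s1"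
  and lin_vs2: "lin s1 s2 f \<Longrightarrow> vector_space s2"
  by (auto simp: Vector_Spaces.linear_iff)

lemma lin_zero: "lin s1 s2 f \<Longrightarrow> f 0 = 0"
  by (metis lin_add add_cancel_right_right)

lemma lin_minus: assumes "lin s1 s2 f" shows "f (- x) = - f x"
proof -
  have "f (- x) + f x = 0" using lin_add[OF assms, of "- x" x] lin_zero[OF assms] by simp
  then show ?thesis by (simp add: eq_neg_iff_add_eq_0)
qed

lemma lin_comp: "lin s1 s2 f \<Longrightarrow> lin s2 s3 g \<Longrightarrow> lin s1 s3 (\<lambda>x. g (f x))"
  by (simp add: Vector_Spaces.linear_iff)

lemma bilI:
  "(\<And>y. lin s1 s3 (\<lambda>x. f x y)) \<Longrightarrow> (\<And>x. lin s2 s3 (\<lambda>y. f x y)) \<Longrightarrow> bilinear_map s1 s2 s3 f"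
  unfolding bilinear_map_def by simp

lemma bil_lin1: "bilinear_map s1 s2 s3 f \<Longrightarrow> lin s s1 g \<Longrightarrow> lin s s3 (\<lambda>x. f (g x) y)"
  unfolding bilinear_map_def using lin_comp by blast

lemma bil_lin2: "bilinear_map s1 s2 s3 f \<Longrightarrow> lin s s2 g \<Longrightarrow> lin s s3 (\<lambda>x. f y (g x))"
  unfolding bilinear_map_def using lin_comp by blast

lemma bil_tsum:
  assumes "bilinear_map s1 s2 sc f"
  shows "f (tsum g t) (tsum h u) = (\<Sum>a b\<in>t. \<Sum>c d\<in>u. f (g a b) (h c d))"
proof -
  have l: "lin s1 sc (\<lambda>x. f x y)" "lin s2 sc (f x)" for x y using assms unfolding bilinear_map_def by auto
  show ?thesis unfolding lin_tsum_apply[OF l(1)] lin_tsum_apply[OF l(2)] by (rule tsum_commute)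
qed

lemma bil_comp_same: "bilinear_map s2 s2 s3 f \<Longrightarrow> lin s1 s2 g \<Longrightarrow> bilinear_map s1 s1 s3 (\<lambda>x y. f (g x) (g y))"
  by (rule bilI) (auto intro: bil_lin1 bil_lin2)

definition trilinear_map where
  "trilinear_map s sc f \<longleftrightarrow> (\<forall>y z. lin s sc (\<lambda>x. f x y z)) \<and> (\<forall>x z. lin s sc (\<lambda>y. f x y z)) \<and> (\<forall>x y. lin s sc (\<lambda>z. f x y z))"

lemma triI:
  "(\<And>y z. lin s sc (\<lambda>x. f x y z)) \<Longrightarrow> (\<And>x z. lin s sc (\<lambda>y. f x y z)) \<Longrightarrow> (\<And>x y. lin s sc (\<lambda>z. f x y z))
    \<Longrightarrow> trilinear_map s sc f"
  unfolding trilinear_map_def by simp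

lemma tri_lin1: "trilinear_map s1 s3 f \<Longrightarrow> lin s s1 g \<Longrightarrow> lin s s3 (\<lambda>x. f (g x) y z)"
  and tri_lin2: "trilinear_map s1 s3 f \<Longrightarrow> lin s s1 g \<Longrightarrow> lin s s3 (\<lambda>x. f y (g x) z)"
  and tri_lin3: "trilinear_map s1 s3 f \<Longrightarrow> lin s s1 g \<Longrightarrow> lin s s3 (\<lambda>x. f y z (g x))"
  unfolding trilinear_map_def using lin_comp by blast+

definition quadrilinear_map where
  "quadrilinear_map s sc f \<longleftrightarrow>
     (\<forall>y z w. lin s sc (\<lambda>x. f x y z w)) \<and> (\<forall>x z w. lin s sc (\<lambda>y. f x y z w)) \<and>
     (\<forall>x y w. lin s sc (\<lambda>z. f x y z w)) \<and> (\<forall>x y z. lin s sc (\<lambda>w. f x y z w))"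

lemma quadI:
  "(\<And>y z w. lin s sc (\<lambda>x. f x y z w)) \<Longrightarrow> (\<And>x z w. lin s sc (\<lambda>y. f x y z w)) \<Longrightarrow>
   (\<And>x y w. lin s sc (\<lambda>z. f x y z w)) \<Longrightarrow> (\<And>x y z. lin s sc (\<lambda>w. f x y z w)) \<Longrightarrow> quadrilinear_map s sc f"
  unfolding quadrilinear_map_def by simp

lemma quad_lin:
  assumes "quadrilinear_map s1 s3 f" "lin s s1 g"
  shows "lin s s3 (\<lambda>x. f (g x) y z w)" "lin s s3 (\<lambda>x. f y (g x) z w)"
    "lin s s3 (\<lambda>x. f y z (g x) w)" "lin s s3 (\<lambda>x. f y z w (g x))"
  by (rule lin_comp[OF assms(2)], use assms(1) in \<open>simp add: quadrilinear_map_def\<close>)+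

lemma lin_tsum:
  assumes "vector_space s1" "vector_space s2" "\<And>a b. lin s1 s2 (\<lambda>x. G x a b)"
  shows "lin s1 s2 (\<lambda>x. \<Sum>a b\<in>t. G x a b)"
proof -
  interpret vector_space s2 by fact
  show ?thesis
  proof (rule linI)
    fix x y show "tsum (G (x + y)) t = tsum (G x) t + tsum (G y) t"
      unfolding tsum_add[symmetric] using lin_add[OF assms(3)] by (intro tsum_cong) simp
  next
    fix c x show "tsum (G (s1 c x)) t = s2 c (tsum (G x) t)"
      by (induction t) (simp_all add: lin_scale[OF assms(3)] scale_right_distrib)
  qed (use assms in auto)
qed

section \<open>Equality of tensors is detected by multilinear forms\<close>

text \<open>Each generator of \<open>bilinear_rel\<close> is respected by a bilinear map into any
  space, so evaluation descends to the tensor product. The converse for scalar forms is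
  \<open>teq2I\<close>.\<close>

lemma teq2_tsum:
  assumes "teq2 s t u" and b: "bilinear_map s s sc f"
  shows "tsum f t = tsum f u"
proof -
  note l = bil_lin1[OF b, where g = "\<lambda>x. x"] bil_lin2[OF b, where g = "\<lambda>x. x"]
  have l1: "lin s sc (\<lambda>x. f x y)" and l2: "lin s sc (f x)" for x y
    using b unfolding bilinear_map_def by auto
  from assms(1) have "sum_cong (bilinear_rel s) t u" unfolding teq2_def .
  then show ?thesis
  proof (induction rule: sum_cong.induct)
    case (base xs ys)
    then show ?case
      by (induction rule: bilinear_rel.induct)
        (simp_all add: lin_add[OF l1] lin_add[OF l2] lin_zero[OF l1] lin_scale[OF l1] lin_scale[OF l2])
  qed (auto simp: add.commute)
qed

lemma teq3_tsum3:
  assumes "teq3 s t u" and b: "trilinear_map s sc f"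
  shows "tsum3 f t = tsum3 f u"
proof -
  have l1: "lin s sc (\<lambda>x. f x y z)" and l2: "lin s sc (\<lambda>y. f x y z)" and l3: "lin s sc (\<lambda>z. f x y z)"
    for x y z using b unfolding trilinear_map_def by auto
  from assms(1) have "sum_cong (trilinear_rel s) t u" unfolding teq3_def .
  then show ?thesis
  proof (induction rule: sum_cong.induct)
    case (base xs ys)
    then show ?case
      by (induction rule: trilinear_rel.induct)
        (simp_all add: lin_add[OF l1] lin_add[OF l2] lin_add[OF l3] lin_zero[OF l1]
          lin_scale[OF l1] lin_scale[OF l2] lin_scale[OF l3])
  qed (auto simp: add.commute)
qed

lemma teq2_sym: "teq2 s t u \<Longrightarrow> teq2 s u t"
  and teq2_trans [trans]: "teq2 s t u \<Longrightarrow> teq2 s u v \<Longrightarrow> teq2 s t v"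
  unfolding teq2_def by (blast intro: sum_cong.sym sum_cong.trans)+

lemma teq3_sym: "teq3 s t u \<Longrightarrow> teq3 s u t"
  and teq3_trans [trans]: "teq3 s t u \<Longrightarrow> teq3 s u v \<Longrightarrow> teq3 s t v"
  unfolding teq3_def by (blast intro: sum_cong.sym sum_cong.trans)+

lemma teq2_refl: "teq2 s t t"
  unfolding teq2_def by (rule sum_cong.refl)

lemma sum_cong_transp [trans]: "sum_cong r a b \<Longrightarrow> sum_cong r b c \<Longrightarrow> sum_cong r a c"
  by (rule sum_cong.trans)

lemma sum_cong_Cons: "sum_cong r xs ys \<Longrightarrow> sum_cong r (x # xs) (x # ys)"
  using sum_cong.append[OF sum_cong.refl[of r "[x]"], of xs ys] by simp

lemma sum_cong_CConsD: "sum_cong r [x] [] \<Longrightarrow> sum_cong r xs [] \<Longrightarrow> sum_cong r (x # xs) []"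
  using sum_cong.append[of r "[x]" "[]" xs "[]"] by simp

lemma sum_cong_move: "sum_cong r (x # ys @ zs) (ys @ x # zs)"
  using sum_cong.append[OF sum_cong.comm[of r "[x]" ys] sum_cong.refl[of r zs]] by simp

text \<open>An element of \<open>V \<otimes> W\<close>, as a list of pairs of a vector and a formal sum over \<open>W\<close>.\<close>
definition flat :: "('v \<times> 'q list) list \<Rightarrow> ('v \<times> 'q) list" where
  "flat W = concat (map (\<lambda>(x, t). map (Pair x) t) W)"

lemma flat_simps [simp]:
  "flat [] = []" "flat ((x, t) # W) = map (Pair x) t @ flat W" "flat (W @ W') = flat W @ flat W'"
  by (simp_all add: flat_def)

text \<open>A left factor in the span of \<open>L\<close> adds nothing to a formal sum with left
  factors \<open>L\<close>: its coefficients move to the right factors. These have an arbitrary type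
  \<open>'q\<close>, scaled by \<open>sq\<close>, so that pairs and triples are covered at once. The
  quantifiers over \<open>t\<close> and \<open>W\<close> stand inside because the additive step of
  the span induction uses the hypothesis for two sums and the scalar step changes
  \<open>t\<close>.\<close>

lemma flat_absorb:
  fixes s :: "'k::field \<Rightarrow> 'v::ab_group_add \<Rightarrow> 'v" and r :: "('v \<times> 'q) list \<Rightarrow> ('v \<times> 'q) list \<Rightarrow> bool"
  assumes "vector_space s"
    and add: "\<And>x x' q. sum_cong r [(x + x', q)] [(x, q), (x', q)]"
    and zero: "\<And>q. sum_cong r [(0, q)] []"
    and scale: "\<And>c x q. sum_cong r [(s c x, q)] [(x, sq c q)]"
    and x: "x \<in> module.span s (set L)"
  shows "\<forall>t W. map fst W = L \<longrightarrow> (\<exists>W'. map fst W' = L \<and> sum_cong r (map (Pair x) t @ flat W) (flat W'))"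
proof -
  interpret vector_space s by fact
  have pz: "sum_cong r (map (Pair 0) t) []" for t
    by (induction t) (auto intro: sum_cong.refl zero sum_cong_CConsD)
  have pa: "sum_cong r (map (Pair (x + y)) t) (map (Pair x) t @ map (Pair y) t)" for x y t
  proof (induction t)
    case (Cons q t)
    have "sum_cong r ([(x + y, q)] @ map (Pair (x + y)) t) ([(x, q), (y, q)] @ map (Pair x) t @ map (Pair y) t)"
      by (rule sum_cong.append[OF add Cons])
    also have "sum_cong r \<dots> ((x, q) # map (Pair x) t @ (y, q) # map (Pair y) t)"
      using sum_cong_Cons[OF sum_cong_move] by simp
    finally show ?case by simp
  qed (auto intro: sum_cong.refl)
  have ps: "sum_cong r (map (Pair (s c x)) t) (map (Pair x) (map (sq c) t))" for c x t
  proof (induction t)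
    case (Cons q t)
    then show ?case using sum_cong.append[OF scale Cons] by simp
  qed (auto intro: sum_cong.refl)
  show ?thesis
    using x
  proof (induction rule: span_induct)
    case base
    show ?case
    proof (rule subspaceI, goal_cases)
      case 1
      then show ?case
        using sum_cong.append[OF pz sum_cong.refl] by fastforce
    next
      case (2 x y)
      show ?case
      proof (unfold mem_Collect_eq, intro allI impI)
        fix t :: "'q list" and W :: "('v \<times> 'q list) list" assume "map fst W = L"
        then obtain W1 where W1: "map fst W1 = L" "sum_cong r (map (Pair y) t @ flat W) (flat W1)"
          using 2 by blast
        then obtain W2 where W2: "map fst W2 = L" "sum_cong r (map (Pair x) t @ flat W1) (flat W2)"
          using 2 by blast
        have "sum_cong r (map (Pair (x + y)) t @ flat W) ((map (Pair x) t @ map (Pair y) t) @ flat W)"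
          by (rule sum_cong.append[OF pa sum_cong.refl])
        also have "sum_cong r \<dots> (map (Pair x) t @ flat W1)"
          using sum_cong.append[OF sum_cong.refl W1(2)] by simp
        also note W2(2)
        finally show "\<exists>W'. map fst W' = L \<and> sum_cong r (map (Pair (x + y)) t @ flat W) (flat W')"
          using W2(1) by blast
      qed
    next
      case (3 c x)
      show ?case
      proof (unfold mem_Collect_eq, intro allI impI)
        fix t :: "'q list" and W :: "('v \<times> 'q list) list" assume "map fst W = L"
        then obtain W1 where W1: "map fst W1 = L" "sum_cong r (map (Pair x) (map (sq c) t) @ flat W) (flat W1)"
          using 3 by blast
        have "sum_cong r (map (Pair (s c x)) t @ flat W) (map (Pair x) (map (sq c) t) @ flat W)"
          by (rule sum_cong.append[OF ps sum_cong.refl])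
        also note W1(2)
        finally show "\<exists>W'. map fst W' = L \<and> sum_cong r (map (Pair (s c x)) t @ flat W) (flat W')"
          using W1(1) by blast
      qed
    qed
  next
    case (step x)
    show ?case
    proof (intro allI impI)
      fix t :: "'q list" and W :: "('v \<times> 'q list) list" assume W: "map fst W = L"
      then have "x \<in> fst ` set W" using step by (metis set_map)
      then obtain t' where "(x, t') \<in> set W" by force
      then obtain W1 W2 where W': "W = W1 @ (x, t') # W2" by (auto dest: split_list)
      have "sum_cong r (map (Pair x) t @ flat W1) (flat W1 @ map (Pair x) t)"
        by (rule sum_cong.comm)
      from sum_cong.append[OF this sum_cong.refl[of r "map (Pair x) t' @ flat W2"]]
      have "sum_cong r (map (Pair x) t @ flat W) (flat (W1 @ (x, t @ t') # W2))"
        by (simp add: W')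
      moreover have "map fst (W1 @ (x, t @ t') # W2) = L" using W W' by simp
      ultimately show "\<exists>W'. map fst W' = L \<and> sum_cong r (map (Pair x) t @ flat W) (flat W')"
        by blast
    qed
  qed
qed

text \<open>Absorbing a left factor that depends on the others, repetitions included, shortens the
  list; when none is left, the left factors are distinct and linearly independent.\<close>

lemma flat_reduce:
  fixes s :: "'k::field \<Rightarrow> 'v::ab_group_add \<Rightarrow> 'v"
  assumes vs: "vector_space s"
    and add: "\<And>x x' q. sum_cong r [(x + x', q)] [(x, q), (x', q)]"
    and zero: "\<And>q. sum_cong r [(0, q)] []"
    and scale: "\<And>c x q. sum_cong r [(s c x, q)] [(x, sq c q)]"
  shows "\<exists>W'. distinct (map fst W') \<and> \<not> module.dependent s (set (map fst W')) \<and> sum_cong r (flat W) (flat W')"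
proof (induction "length W" arbitrary: W rule: less_induct)
  case less
  interpret vector_space s by fact
  show ?case
  proof (cases "\<exists>W1 x t W2. W = W1 @ (x, t) # W2 \<and> x \<in> span (set (map fst (W1 @ W2)))")
    case True
    then obtain W1 x t W2 where W: "W = W1 @ (x, t) # W2" and x: "x \<in> span (set (map fst (W1 @ W2)))"
      by blast
    obtain W' where W': "map fst W' = map fst (W1 @ W2)" "sum_cong r (map (Pair x) t @ flat (W1 @ W2)) (flat W')"
      using flat_absorb[OF vs add zero scale x] by blast
    have "length W' < length W" using arg_cong[OF W'(1), of length] W by simp
    then obtain W'' where W'': "distinct (map fst W'')" "\<not> dependent (set (map fst W''))" "sum_cong r (flat W') (flat W'')"
      using less by blast
    have "sum_cong r (flat W) (map (Pair x) t @ flat (W1 @ W2))"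
      using sum_cong.append[OF sum_cong.comm sum_cong.refl] by (simp add: W)
    also note W'(2)
    also note W''(3)
    finally show ?thesis using W'' by blast
  next
    case False
    have "\<not> dependent (set (map fst W))"
    proof
      assume "dependent (set (map fst W))"
      then obtain a where a: "a \<in> set (map fst W)" "a \<in> span (set (map fst W) - {a})"
        unfolding dependent_def by blast
      then obtain t where "(a, t) \<in> set W" by auto
      then obtain W1 W2 where W': "W = W1 @ (a, t) # W2" by (auto dest: split_list)
      have "a \<in> span (set (map fst (W1 @ W2)))"
        using a(2) by (rule rev_subsetD[OF _ span_mono]) (auto simp: W')
      with False W' show False by blast
    qed
    moreover have "distinct (map fst W)"
    proof (rule ccontr)
      assume "\<not> distinct (map fst W)"
      then obtain xs ys zs y where "map fst W = xs @ [y] @ ys @ [y] @ zs"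
        using not_distinct_decomp by blast
      then obtain W1 W' where W': "W = W1 @ W'" "map fst W' = y # (ys @ y # zs)"
        by (auto simp: map_eq_append_conv)
      then obtain t W2 where W2: "W' = (y, t) # W2" "map fst W2 = ys @ y # zs"
        by (cases W') auto
      have "y \<in> span (set (map fst (W1 @ W2)))"
        using W2(2) by (intro span_base) simp
      with False W' W2 show False by blast
    qed
    ultimately show ?thesis by (auto intro: sum_cong.refl)
  qed
qed

lemma separating_functional:
  fixes s :: "'k::field \<Rightarrow> 'v::ab_group_add \<Rightarrow> 'v"
  assumes "vector_space s" "\<not> module.dependent s B" "b \<in> B"
  obtains g where "lin s (*) g" "g b = 1" "\<And>x. x \<in> B \<Longrightarrow> x \<noteq> b \<Longrightarrow> g x = 0"
proof -
  interpret vector_space_pair s "(*) :: 'k \<Rightarrow> _"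
    using assms(1) vector_space_field by (simp add: vector_space_pair_def)
  obtain g where "lin s (*) g" "\<forall>x\<in>B. g x = (if x = b then 1 else 0)"
    using linear_independent_extend[OF assms(2), of "\<lambda>x. if x = b then 1 else 0"] by blast
  then show ?thesis using that assms(3) by auto
qed

text \<open>A nonzero difference is an independent set by itself, so some functional takes the value
  1 on it.\<close>

lemma eq_by_functionals:
  fixes s :: "'k::field \<Rightarrow> 'v::ab_group_add \<Rightarrow> 'v"
  assumes vs: "vector_space s" and eq: "\<And>g. lin s (*) g \<Longrightarrow> g x = g y"
  shows "x = y"
proof (rule ccontr)
  interpret vector_space s by fact
  assume "x \<noteq> y"
  then have "\<not> dependent {x - y}"
    using dependent_insertD by (auto simp: dependent_def)
  then obtain g where g: "lin s (*) g" "g (x - y) = 1"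
    using separating_functional[OF vs, of "{x - y}"] by blast
  have "g (x - y) = g x - g y" using lin_add[OF g(1), of x "- y"] lin_minus[OF g(1), of y] by simp
  with g eq[OF g(1)] show False by simp
qed

lemma sum_list_separate:
  fixes g :: "'v \<Rightarrow> 'k::field"
  assumes "distinct (map fst W)" "(b, t) \<in> set W" "g b = 1"
    and "\<And>x. x \<in> set (map fst W) \<Longrightarrow> x \<noteq> b \<Longrightarrow> g x = 0"
  shows "(\<Sum>(x, t)\<leftarrow>W. g x * h t) = h t"
  using assms
proof (induction W)
  case (Cons p W)
  obtain x t' where p: "p = (x, t')" by force
  have z: "(\<Sum>(x, t)\<leftarrow>W'. g x * h t) = 0" if "\<forall>x\<in>set (map fst W'). g x = 0" for W'
    using that by (induction W') auto
  show ?case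
  proof (cases "p = (b, t)")
    case True
    have "g y = 0" if "y \<in> set (map fst W)" for y
      using that Cons.prems True p by auto
    then have "(\<Sum>(x, t)\<leftarrow>W. g x * h t) = 0" by (intro z) blast
    then show ?thesis using Cons.prems(3) True by simp
  next
    case False
    then have "(b, t) \<in> set W" "x \<noteq> b" using Cons.prems p by force+
    then show ?thesis using Cons p by auto
  qed
qed simp

text \<open>Formal sums have no subtraction; the negative of \<open>u\<close> is formed on the left
  factors, and adding and cancelling it turns a vanishing difference into an equality.\<close>

lemma sum_cong_of_null:
  fixes r :: "('v::ab_group_add \<times> 'q) list \<Rightarrow> ('v \<times> 'q) list \<Rightarrow> bool"
  assumes neg: "\<And>x q. sum_cong r [(- x, q), (x, q)] []"
    and "sum_cong r (t @ map (\<lambda>(x, q). (- x, q)) u) []"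
  shows "sum_cong r t u"
proof -
  let ?n = "map (\<lambda>(x, q). (- x, q))"
  have n: "sum_cong r (?n u @ u) []" for u :: "('v \<times> 'q) list"
  proof (induction u)
    case (Cons p u)
    obtain x q where p: "p = (x, q)" by force
    have "sum_cong r (?n (p # u) @ p # u) ([(- x, q), (x, q)] @ ?n u @ u)"
      using sum_cong_Cons[OF sum_cong.sym[OF sum_cong_move]] by (simp add: p)
    also have "sum_cong r \<dots> ([] @ [])"
      by (rule sum_cong.append[OF neg Cons])
    finally show ?case by simp
  qed (auto intro: sum_cong.refl)
  have "sum_cong r (t @ []) (t @ ?n u @ u)"
    by (rule sum_cong.append[OF sum_cong.refl sum_cong.sym[OF n]])
  also have "sum_cong r \<dots> ([] @ u)"
    using sum_cong.append[OF assms(2) sum_cong.refl[of r u]] by simp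
  finally show ?thesis by simp
qed

lemma flat_single: "flat (map (\<lambda>(x, q). (x, [q])) t) = t"
  by (induction t) auto

text \<open>Once the left factors are independent, the test form g(x) h(y), with g dual to one left
  factor, isolates h of the sum of its right factors. As h is arbitrary, that sum is zero, and each
  block of the formal sum collapses.\<close>

lemma teq2_nullI:
  fixes s :: "'k::field \<Rightarrow> 'v::ab_group_add \<Rightarrow> 'v"
  assumes vs: "vector_space s" and null: "\<And>f. bilinear_map s s (*) f \<Longrightarrow> tsum f t = 0"
  shows "teq2 s t []"
proof -
  interpret vector_space s by fact
  let ?r = "bilinear_rel s"
  obtain W where W: "distinct (map fst W)" "\<not> dependent (set (map fst W))" "sum_cong ?r t (flat W)"
    using flat_reduce[OF vs, where r = ?r and W = "map (\<lambda>(x, q). (x, [q])) t" and sq = s]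
    by (auto simp: flat_single intro: sum_cong.base bilinear_rel.intros)
  have [simp]: "tsum f (flat W) = 0" if "bilinear_map s s (*) f" for f
    using null[OF that] teq2_tsum[of s t "flat W" "(*)" f] W(3) that by (simp add: teq2_def)
  have z: "sum_list q = 0" if xq: "(x, q) \<in> set W" for x q
  proof (rule eq_by_functionals[OF vs])
    fix h assume h: "lin s (*) h"
    obtain g where g: "lin s (*) g" "g x = 1" "\<And>y. y \<in> set (map fst W) \<Longrightarrow> y \<noteq> x \<Longrightarrow> g y = 0"
      using separating_functional[OF vs W(2), of x] xq by (metis image_eqI fst_conv set_map)
    have "bilinear_map s s (*) (\<lambda>x y. g x * h y)"
      using g(1) h vs by (intro bilI) (auto simp: Vector_Spaces.linear_iff algebra_simps)
    then have "0 = (\<Sum>x y\<in>flat W. g x * h y)" by simp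
    also have "\<dots> = (\<Sum>(x, q)\<leftarrow>W. g x * h (sum_list q))"
    proof -
      have "(\<Sum>x y\<in>map (Pair x) q. g x * h y) = g x * h (sum_list q)" for x q
        by (induction q) (auto simp: lin_add[OF h] lin_zero[OF h] algebra_simps)
      then show ?thesis by (induction W) auto
    qed
    also have "\<dots> = h (sum_list q)"
      by (rule sum_list_separate[where h = "\<lambda>q. h (sum_list q)" and g = g, OF W(1) xq g(2,3)])
    finally show "h (sum_list q) = h 0" by (simp add: lin_zero[OF h])
  qed
  \<comment> \<open>A zero right factor is not a generator of \<open>bilinear_rel\<close>; the
    scalar 0 is carried over from the left factor.\<close>
  have x0: "sum_cong ?r [(x, 0)] []" for x
  proof -
    have "sum_cong ?r [(0, 0)] [(x, s 0 0)]"
      using sum_cong.base[of ?r, OF bilinear_rel.intros(4)[of s 0 x 0]] by simp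
    then show ?thesis
      using sum_cong.trans[OF sum_cong.sym sum_cong.base[of ?r, OF bilinear_rel.intros(3)]] by simp
  qed
  have "sum_cong ?r (map (Pair x) q) [(x, sum_list q)]" for x q
  proof (induction q)
    case (Cons y q)
    have "sum_cong ?r (map (Pair x) (y # q)) ([(x, y)] @ [(x, sum_list q)])"
      using sum_cong_Cons[OF Cons] by simp
    also have "sum_cong ?r \<dots> [(x, sum_list (y # q))]"
      using sum_cong.sym[OF sum_cong.base[of ?r, OF bilinear_rel.intros(2)]] by simp
    finally show ?case .
  qed (auto intro: sum_cong.sym x0)
  then have "sum_cong ?r (map (Pair x) q) []" if "(x, q) \<in> set W" for x q
    using z[OF that] x0 sum_cong.trans by metis
  then have "sum_cong ?r (flat W) []"
  proof (induction W)
    case (Cons p W)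
    obtain x q where p: "p = (x, q)" by force
    show ?case using sum_cong.append[of ?r "map (Pair x) q" "[]" "flat W" "[]"] Cons p by auto
  qed (auto intro: sum_cong.refl)
  with W(3) show ?thesis unfolding teq2_def by (rule sum_cong.trans)
qed

lemma teq2I:
  fixes s :: "'k::field \<Rightarrow> 'v::ab_group_add \<Rightarrow> 'v"
  assumes vs: "vector_space s" and eq: "\<And>f. bilinear_map s s (*) f \<Longrightarrow> tsum f t = tsum f u"
  shows "teq2 s t u"
  unfolding teq2_def
proof (rule sum_cong_of_null)
  show "sum_cong (bilinear_rel s) [(- x, q), (x, q)] []" for x q
    using bilinear_rel.intros(1)[of s "- x" x q] bilinear_rel.intros(3)[of s q]
    by (auto intro: sum_cong.trans[OF sum_cong.sym] sum_cong.base)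
  have "teq2 s (t @ map (\<lambda>(x, q). (- x, q)) u) []"
  proof (rule teq2_nullI[OF vs])
    fix f :: "'v \<Rightarrow> 'v \<Rightarrow> 'k" assume f: "bilinear_map s s (*) f"
    then have "f (- x) y = - f x y" for x y
      using lin_minus unfolding bilinear_map_def by blast
    then have "tsum f (map (\<lambda>(x, q). (- x, q)) u) = - tsum f u"
      by (induction u) (auto simp: case_prod_beta)
    then show "tsum f (t @ map (\<lambda>(x, q). (- x, q)) u) = 0" using eq[OF f] by simp
  qed
  then show "sum_cong (bilinear_rel s) (t @ map (\<lambda>(x, q). (- x, q)) u) []" unfolding teq2_def .
qed

text \<open>Independent left factors reduce three legs to two: the right factor of each is a formal
  sum of pairs, null by \<open>teq2_nullI\<close>, and a congruence of pairs becomes one of triples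
  when a fixed left factor is attached.\<close>

lemma teq3_nullI:
  fixes s :: "'k::field \<Rightarrow> 'v::ab_group_add \<Rightarrow> 'v"
  assumes vs: "vector_space s" and null: "\<And>f. trilinear_map s (*) f \<Longrightarrow> tsum3 f t = 0"
  shows "teq3 s t []"
proof -
  interpret vector_space s by fact
  let ?r = "trilinear_rel s"
  obtain W where W: "distinct (map fst W)" "\<not> dependent (set (map fst W))" "sum_cong ?r t (flat W)"
    using flat_reduce[OF vs, where r = ?r and W = "map (\<lambda>(x, q). (x, [q])) t" and sq = "\<lambda>c (y, z). (s c y, z)"]
    by (auto simp: flat_single intro: sum_cong.base trilinear_rel.intros)
  have [simp]: "tsum3 f (flat W) = 0" if "trilinear_map s (*) f" for f
    using null[OF that] teq3_tsum3[of s t "flat W" "(*)" f] W(3) that by (simp add: teq3_def)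
  have "teq2 s q []" if xq: "(x, q) \<in> set W" for x q
  proof (rule teq2_nullI[OF vs])
    fix h :: "'v \<Rightarrow> 'v \<Rightarrow> 'k" assume h: "bilinear_map s s (*) h"
    obtain g where g: "lin s (*) g" "g x = 1" "\<And>y. y \<in> set (map fst W) \<Longrightarrow> y \<noteq> x \<Longrightarrow> g y = 0"
      using separating_functional[OF vs W(2), of x] xq by (metis image_eqI fst_conv set_map)
    have "trilinear_map s (*) (\<lambda>x y z. g x * h y z)"
      using g(1) h vs unfolding bilinear_map_def by (intro triI) (auto simp: Vector_Spaces.linear_iff algebra_simps)
    then have "0 = tsum3 (\<lambda>x y z. g x * h y z) (flat W)" by simp
    also have "\<dots> = (\<Sum>(x, q)\<leftarrow>W. g x * tsum h q)"
    proof -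
      have "tsum3 (\<lambda>x y z. g x * h y z) (map (Pair x) q) = g x * tsum h q" for x q
        by (induction q) (auto simp: algebra_simps)
      then show ?thesis by (induction W) auto
    qed
    also have "\<dots> = tsum h q"
      by (rule sum_list_separate[where h = "tsum h" and g = g, OF W(1) xq g(2,3)])
    finally show "tsum h q = 0" by simp
  qed
  moreover have "sum_cong ?r (map (Pair x) q) (map (Pair x) q')" if "teq2 s q q'" for x q q'
    using that unfolding teq2_def
  proof (induction rule: sum_cong.induct)
    case (base xs ys)
    then show ?case
    proof (induction rule: bilinear_rel.induct)
      \<comment> \<open>Zero in the middle leg is again reached only by moving the scalar 0 out of
        the first leg.\<close>
      case (3 y)
      have "sum_cong ?r [(x, 0, y)] [(0, 0, y)]"
        using sum_cong.sym[OF sum_cong.base[of ?r, OF trilinear_rel.intros(5)[of s 0 x 0 y]]] by simp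
      then show ?case
        using sum_cong.trans[OF _ sum_cong.base[of ?r, OF trilinear_rel.intros(4)]] by simp
    qed (auto intro: sum_cong.base trilinear_rel.intros)
  qed (auto intro: sum_cong.intros)
  ultimately have "sum_cong ?r (map (Pair x) q) []" if "(x, q) \<in> set W" for x q
    using that by fastforce
  then have "sum_cong ?r (flat W) []"
  proof (induction W)
    case (Cons p W)
    obtain x q where p: "p = (x, q)" by force
    show ?case using sum_cong.append[of ?r "map (Pair x) q" "[]" "flat W" "[]"] Cons p by auto
  qed (auto intro: sum_cong.refl)
  with W(3) show ?thesis unfolding teq3_def by (rule sum_cong.trans)
qed

lemma teq3I:
  fixes s :: "'k::field \<Rightarrow> 'v::ab_group_add \<Rightarrow> 'v"
  assumes vs: "vector_space s" and eq: "\<And>f. trilinear_map s (*) f \<Longrightarrow> tsum3 f t = tsum3 f u"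
  shows "teq3 s t u"
  unfolding teq3_def
proof (rule sum_cong_of_null)
  show "sum_cong (trilinear_rel s) [(- x, q), (x, q)] []" for x q
    using trilinear_rel.intros(1)[of s "- x" x "fst q" "snd q"] trilinear_rel.intros(4)[of s "fst q" "snd q"]
    by (auto intro: sum_cong.trans[OF sum_cong.sym] sum_cong.base)
  have "teq3 s (t @ map (\<lambda>(x, q). (- x, q)) u) []"
  proof (rule teq3_nullI[OF vs])
    fix f :: "'v \<Rightarrow> 'v \<Rightarrow> 'v \<Rightarrow> 'k" assume f: "trilinear_map s (*) f"
    then have "f (- x) y z = - f x y z" for x y z
      using lin_minus[where f = "\<lambda>x. f x y z"] unfolding trilinear_map_def by blast
    then have "tsum3 f (map (\<lambda>(x, q). (- x, q)) u) = - tsum3 f u"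
      by (induction u) (auto simp: case_prod_beta)
    then show "tsum3 f (t @ map (\<lambda>(x, q). (- x, q)) u) = 0" using eq[OF f] by simp
  qed
  then show "sum_cong (trilinear_rel s) (t @ map (\<lambda>(x, q). (- x, q)) u) []" unfolding teq3_def .
qed

section \<open>Cocommutative quantum groupoids\<close>

text \<open>Every evaluated axiom has a multilinearity side condition. These introduction rules
  discharge it along the structure of the term; a proof about a test form adds the linearity of that
  form locally.\<close>

named_theorems lin_rules

lemmas [lin_rules] = bilI triI quadI

text \<open>A map into formal sums is linear only up to \<open>teq2\<close>, but becomes honestly
  linear after evaluation by a bilinear map; in this way \<open>D\<close> enters the linearity
  rules.\<close>

lemma lin_tsum_tlinear:
  assumes vs: "vector_space s" and T: "tlinear s T" and G: "bilinear_map s s sc G" and f: "lin s s f"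
  shows "lin s sc (\<lambda>x. tsum G (T (f x)))"
proof (rule lin_comp[OF f], rule linI[OF vs])
  have G1: "lin s sc (\<lambda>x. G x y)" for y using G unfolding bilinear_map_def by blast
  show sc: "vector_space sc" using lin_vs2[OF G1] .
  show "tsum G (T (x + y)) = tsum G (T x) + tsum G (T y)" for x y
    using T teq2_tsum[OF _ G] unfolding tlinear_def by (metis tsum_append)
  fix c x
  have "tsum G (T (s c x)) = tsum G (map (\<lambda>(a, b). (s c a, b)) (T x))"
    using T teq2_tsum[OF _ G] unfolding tlinear_def by blast
  also have "\<dots> = (\<Sum>a b\<in>T x. sc c (G a b))"
    unfolding tsum_map by (simp add: lin_scale[OF G1])
  also have "\<dots> = sc c (tsum G (T x))"
  proof -
    interpret vector_space sc by (rule sc)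
    have "(\<Sum>a b\<in>t. sc c (G a b)) = sc c (tsum G t)" for t
      by (induction t) (simp_all add: scale_right_distrib)
    then show ?thesis .
  qed
  finally show "tsum G (T (s c x)) = sc c (tsum G (T x))" .
qed

locale cocomm_groupoid =
  fixes H :: "('k::field, 'h::{ring, monoid_mult}) qgroupoid"
  assumes qg: "quantum_groupoid H" and cc: "cocommutative H"
begin

abbreviation "sH \<equiv> scal H"
abbreviation "D \<equiv> comult H"
abbreviation "S \<equiv> antipode H"
abbreviation "cu \<equiv> counit H"
abbreviation "bil \<equiv> bilinear_map sH sH"
abbreviation "tri \<equiv> trilinear_map sH"
abbreviation "quad \<equiv> quadrilinear_map sH"
abbreviation "et \<equiv> epst H"
abbreviation "es \<equiv> epss H"
abbreviation "Ad \<equiv> adj H"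
abbreviation "K \<equiv> target_space H"
abbreviation "C \<equiv> centralizer (source_space H)"

lemma wb: "weak_bialgebra H"
  using qg unfolding quantum_groupoid_def by blast

lemma vs: "vector_space sH" and mult_bil: "bil sH (*)" and D_tlinear: "tlinear sH D"
  and cu_lin: "lin sH (*) cu"
  using wb unfolding weak_bialgebra_def by blast+

lemma S_lin: "lin sH sH S"
  using qg unfolding quantum_groupoid_def by blast

lemma lin_ident [lin_rules]: "lin sH sH (\<lambda>x. x)"
  using vs by (simp add: Vector_Spaces.linear_iff)

lemma lin_times [lin_rules]:
  "lin s0 sH f \<Longrightarrow> lin s0 sH (\<lambda>x. f x * c)" "lin s0 sH f \<Longrightarrow> lin s0 sH (\<lambda>x. c * f x)"
  by (rule bil_lin1[OF mult_bil] bil_lin2[OF mult_bil], assumption)+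

lemma lin_S [lin_rules]: "lin s0 sH f \<Longrightarrow> lin s0 sH (\<lambda>x. S (f x))"
  by (rule lin_comp[OF _ S_lin])

lemma lin_cu [lin_rules]: "lin s0 sH f \<Longrightarrow> lin s0 (*) (\<lambda>x. cu (f x))"
  by (rule lin_comp[OF _ cu_lin])

lemma lin_scaled [lin_rules]:
  "lin s0 (*) f \<Longrightarrow> lin s0 sH (\<lambda>x. sH (f x) c)" "lin s0 sH g \<Longrightarrow> lin s0 sH (\<lambda>x. sH r (g x))"
proof -
  interpret vector_space sH by (rule vs)
  show "lin s0 (*) f \<Longrightarrow> lin s0 sH (\<lambda>x. sH (f x) c)" "lin s0 sH g \<Longrightarrow> lin s0 sH (\<lambda>x. sH r (g x))"
    using vs by (auto simp: Vector_Spaces.linear_iff algebra_simps)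
qed

lemma lin_times_field [lin_rules]:
  "lin s0 (*) f \<Longrightarrow> lin s0 (*) (\<lambda>x. f x * c)" "lin s0 (*) f \<Longrightarrow> lin s0 (*) (\<lambda>x. (c::'k) * f x)"
  by (auto simp: Vector_Spaces.linear_iff algebra_simps)

lemma lin_tsum_H [lin_rules]:
  "(\<And>a b. lin sH sH (\<lambda>x. G x a b)) \<Longrightarrow> lin sH sH (\<lambda>x. \<Sum>a b\<in>t. G x a b)"
  by (rule lin_tsum[OF vs vs])

lemma lin_tsum_field [lin_rules]:
  "(\<And>a b. lin sH (*) (\<lambda>x. G x a b)) \<Longrightarrow> lin sH (*) (\<lambda>x. \<Sum>a b\<in>t. (G x a b :: 'k))"
  by (rule lin_tsum[OF vs vector_space_field])

lemma lin_tsum_sc [lin_rules]: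
  "vector_space sc \<Longrightarrow> (\<And>a b. lin sH sc (\<lambda>x. G x a b)) \<Longrightarrow> lin sH sc (\<lambda>x. \<Sum>a b\<in>t. G x a b)"
  by (rule lin_tsum[OF vs])

lemmas lin_D [lin_rules] = lin_tsum_tlinear[OF vs D_tlinear]

lemma bil_vs: "bil sc f \<Longrightarrow> vector_space sc"
  unfolding bilinear_map_def using lin_vs2 by blast

lemmas bil_rules = bil_lin1 bil_lin2 bil_vs
lemmas tri_rules = tri_lin1 tri_lin2 tri_lin3

lemma tri_vs: "tri sc f \<Longrightarrow> vector_space sc"
  unfolding trilinear_map_def using lin_vs2 by blast

text \<open>Here and below an axiom is read through a multilinear map. The target space
  \<open>sc\<close> is left free, since maps into \<open>H\<close> are needed as well as scalar
  forms.\<close>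

lemma coassoc:
  "tri sc f \<Longrightarrow>
    (\<Sum>a b\<in>D h. \<Sum>x y\<in>D a. f x y b) = (\<Sum>a b\<in>D h. \<Sum>x y\<in>D b. f a x y)"
  using wb teq3_tsum3[of sH "map_left D (D h)" "map_right D (D h)" sc f] unfolding weak_bialgebra_def
  by (simp add: tsum3_map_left tsum3_map_right)

lemma counit_left: "(\<Sum>a b\<in>D h. sH (cu a) b) = h"
  and counit_right: "(\<Sum>a b\<in>D h. sH (cu b) a) = h"
  using wb unfolding weak_bialgebra_def by blast+

lemma D_mult:
  "bil sc f \<Longrightarrow>
    tsum f (D (h * l)) = (\<Sum>a b\<in>D h. \<Sum>c d\<in>D l. f (a * c) (b * d))"
  using wb teq2_tsum[of sH "D (h * l)" "tmul (D h) (D l)" sc f] unfolding weak_bialgebra_def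
  by (simp add: tsum_tmul)

lemma cocomm: "bil sc f \<Longrightarrow> tsum f (D h) = (\<Sum>a b\<in>D h. f b a)"
  using cc teq2_tsum[of sH "D h" "tswap (D h)" sc f] unfolding cocommutative_def
  by (simp add: tsum_tswap)

lemma E_assoc1: "tri sc f \<Longrightarrow>
    (\<Sum>a b\<in>D 1. \<Sum>x y\<in>D a. f x y b) = (\<Sum>a b\<in>D 1. \<Sum>c d\<in>D 1. f a (b * c) d)"
  and E_assoc2: "tri sc f \<Longrightarrow>
    (\<Sum>a b\<in>D 1. \<Sum>x y\<in>D a. f x y b) = (\<Sum>a b\<in>D 1. \<Sum>c d\<in>D 1. f a (c * b) d)"
proof -
  have "teq3 sH (map_left D (D 1)) [(a, b * c, d). (a, b) \<leftarrow> D 1, (c, d) \<leftarrow> D 1]"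
    "teq3 sH (map_left D (D 1)) [(a, c * b, d). (a, b) \<leftarrow> D 1, (c, d) \<leftarrow> D 1]"
    using wb unfolding weak_bialgebra_def by blast+
  from this[THEN teq3_tsum3[of sH _ _ sc f]]
  show "tri sc f \<Longrightarrow>
    (\<Sum>a b\<in>D 1. \<Sum>x y\<in>D a. f x y b) = (\<Sum>a b\<in>D 1. \<Sum>c d\<in>D 1. f a (b * c) d)"
    "tri sc f \<Longrightarrow>
    (\<Sum>a b\<in>D 1. \<Sum>x y\<in>D a. f x y b) = (\<Sum>a b\<in>D 1. \<Sum>c d\<in>D 1. f a (c * b) d)"
    by (simp_all add: tsum3_map_left tsum3_concat_map tsum3_map case_prod_beta)
qed

lemma cu_mult: "cu (h * g * l) = (\<Sum>a b\<in>D g. cu (h * a) * cu (b * l))"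
  using wb unfolding weak_bialgebra_def by blast

lemma id_S: "(\<Sum>a b\<in>D h. a * S b) = et h"
  and S_id: "(\<Sum>a b\<in>D h. S a * b) = es h"
  using qg unfolding quantum_groupoid_def by blast+

lemma S_id_S: "(\<Sum>a b\<in>D h. \<Sum>x y\<in>D a. S x * y * S b) = S h"
  using qg tsum3_map_left[of "\<lambda>a b c. S a * b * S c" D "D h"] unfolding quantum_groupoid_def tsum3_def by auto

lemma et_lin: "lin sH sH et" and es_lin: "lin sH sH es"
  unfolding epst_def[abs_def] epss_def[abs_def] by (intro lin_rules)+

lemma lin_et [lin_rules]: "lin s0 sH f \<Longrightarrow> lin s0 sH (\<lambda>x. et (f x))"
  and lin_es [lin_rules]: "lin s0 sH f \<Longrightarrow> lin s0 sH (\<lambda>x. es (f x))"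
  using lin_comp[OF _ et_lin] lin_comp[OF _ es_lin] by blast+

lemma Ad_bil: "bil sH Ad"
  unfolding adj_def[abs_def] by (intro lin_rules)

lemma lin_Ad [lin_rules]: "lin s0 sH f \<Longrightarrow> lin s0 sH (\<lambda>x. Ad (f x) c)" "lin s0 sH f \<Longrightarrow> lin s0 sH (\<lambda>x. Ad c (f x))"
  by (rule bil_lin1[OF Ad_bil] bil_lin2[OF Ad_bil], assumption)+

lemma D_E_left:
  assumes "bil sc f"
  shows "tsum f (D h) = (\<Sum>x y\<in>D 1. \<Sum>a b\<in>D h. f (x * a) (y * b))"
  using D_mult[OF assms, of 1 h] by simp

lemma D_E_right:
  assumes "bil sc f"
  shows "tsum f (D h) = (\<Sum>a b\<in>D h. \<Sum>x y\<in>D 1. f (a * x) (b * y))"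
  using D_mult[OF assms, of h 1] by simp

text \<open>Inserting Delta(1) in front of Delta(h) gives 1_1 h_1 \<otimes> eps(1'_1 1_2 h_2) 1'_2.
  The axiom for Delta^2(1) makes this (1_1 h)_1 eps((1_1 h)_2) \<otimes> 1_2, and the counit
  finishes.\<close>

lemma et_comult:
  assumes f: "bil sc f"
  shows "(\<Sum>a b\<in>D h. f a (et b)) = (\<Sum>x y\<in>D 1. f (x * h) y)"
proof -
  note [lin_rules] = bil_rules[OF f]
  have *: "f a (et (y * b)) = (\<Sum>e e'\<in>D 1. f a (sH (cu (e * y * b)) e'))" for a y b
    unfolding epst_def mult.assoc by (rule lin_tsum_apply[of sH sc "f a"]) (intro lin_rules)
  have "(\<Sum>a b\<in>D h. f a (et b)) = (\<Sum>x y\<in>D 1. \<Sum>a b\<in>D h. f (x * a) (et (y * b)))"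
    by (rule D_E_left[where sc = sc]) (intro lin_rules)
  also have "\<dots> = (\<Sum>x y\<in>D 1. \<Sum>a b\<in>D h. \<Sum>e e'\<in>D 1. f (x * a) (sH (cu (e * y * b)) e'))"
    by (simp only: *)
  also have "\<dots> = (\<Sum>a b\<in>D h. \<Sum>x y\<in>D 1. \<Sum>e e'\<in>D 1. f (x * a) (sH (cu (e * y * b)) e'))"
    by (rule tsum_commute)
  also have "\<dots> = (\<Sum>a b\<in>D h. \<Sum>x y\<in>D 1. \<Sum>p q\<in>D x. f (p * a) (sH (cu (q * b)) y))"
    by (rule tsum_cong, rule E_assoc2[of sc "\<lambda>p r z. f (p * _) (sH (cu (r * _)) z)", symmetric]) (intro lin_rules)
  also have "\<dots> = (\<Sum>x y\<in>D 1. \<Sum>a b\<in>D h. \<Sum>p q\<in>D x. f (p * a) (sH (cu (q * b)) y))"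
    by (rule tsum_commute)
  also have "\<dots> = (\<Sum>x y\<in>D 1. \<Sum>p q\<in>D x. \<Sum>a b\<in>D h. f (p * a) (sH (cu (q * b)) y))"
    by (rule tsum_cong, rule tsum_commute)
  also have "\<dots> = (\<Sum>x y\<in>D 1. \<Sum>a b\<in>D (x * h). f a (sH (cu b) y))"
    by (rule tsum_cong, rule D_mult[of sc "\<lambda>a b. f a (sH (cu b) _)", symmetric]) (intro lin_rules)
  also have "\<dots> = (\<Sum>x y\<in>D 1. f (x * h) y)"
  proof (rule tsum_cong)
    fix x y
    have "f a (sH c z) = f (sH c a) z" for a c z
      using lin_scale[of sH sc "f a" c z] lin_scale[of sH sc "\<lambda>x. f x z" c a] f
      unfolding bilinear_map_def by simp
    then have "(\<Sum>a b\<in>D (x * h). f a (sH (cu b) y)) = (\<Sum>a b\<in>D (x * h). f (sH (cu b) a) y)"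
      by simp
    also have "\<dots> = f (\<Sum>a b\<in>D (x * h). sH (cu b) a) y"
      by (rule lin_tsum_apply[of sH sc "\<lambda>x. f x y", symmetric]) (intro lin_rules)
    finally show "(\<Sum>a b\<in>D (x * h). f a (sH (cu b) y)) = f (x * h) y"
      by (simp add: counit_right)
  qed
  finally show ?thesis .
qed

end

section \<open>Counital maps and the base algebra\<close>

context cocomm_groupoid begin

lemma scale_shift:
  assumes "bil sc f" shows "f a (sH c b) = f (sH c a) b"
  using lin_scale[of sH sc "f a" c b] lin_scale[of sH sc "\<lambda>x. f x b" c a] assms
  unfolding bilinear_map_def by simp

lemma D_scale:
  assumes f: "bil sc f"
  shows "tsum f (D (sH c x)) = (\<Sum>a b\<in>D x. f (sH c a) b)"
  using D_tlinear teq2_tsum[OF _ f, of "D (sH c x)" "map (\<lambda>(a, b). (sH c a, b)) (D x)"]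
  unfolding tlinear_def by (simp add: tsum_map)

text \<open>Cocommutativity of Delta(1) brings eps_s to the shape of eps_t, with the value in the
  second leg; only the side on which \<open>h\<close> is multiplied differs.\<close>

lemma es_alt: "es h = (\<Sum>a b\<in>D 1. sH (cu (h * a)) b)"
  unfolding epss_def by (rule cocomm[of sH]) (intro lin_rules)

lemma es_comult:
  assumes f: "bil sc f"
  shows "(\<Sum>a b\<in>D h. f a (es b)) = (\<Sum>x y\<in>D 1. f (h * x) y)"
proof -
  note [lin_rules] = bil_rules[OF f]
  have *: "f a (es (b * y)) = (\<Sum>e e'\<in>D 1. f a (sH (cu (b * (y * e))) e'))" for a y b
    unfolding es_alt mult.assoc by (rule lin_tsum_apply[of sH sc "f a"]) (intro lin_rules)
  have "(\<Sum>a b\<in>D h. f a (es b)) = (\<Sum>a b\<in>D h. \<Sum>x y\<in>D 1. f (a * x) (es (b * y)))"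
    by (rule D_E_right[where sc = sc]) (intro lin_rules)
  also have "\<dots> = (\<Sum>a b\<in>D h. \<Sum>x y\<in>D 1. \<Sum>e e'\<in>D 1. f (a * x) (sH (cu (b * (y * e))) e'))"
    by (simp only: *)
  also have "\<dots> = (\<Sum>a b\<in>D h. \<Sum>x y\<in>D 1. \<Sum>p q\<in>D x. f (a * p) (sH (cu (b * q)) y))"
    by (rule tsum_cong, rule E_assoc1[of sc "\<lambda>p r z. f (_ * p) (sH (cu (_ * r)) z)", symmetric]) (intro lin_rules)
  also have "\<dots> = (\<Sum>x y\<in>D 1. \<Sum>a b\<in>D h. \<Sum>p q\<in>D x. f (a * p) (sH (cu (b * q)) y))"
    by (rule tsum_commute)
  also have "\<dots> = (\<Sum>x y\<in>D 1. \<Sum>a b\<in>D (h * x). f a (sH (cu b) y))"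
    by (rule tsum_cong, rule D_mult[of sc "\<lambda>a b. f a (sH (cu b) _)", symmetric]) (intro lin_rules)
  also have "\<dots> = (\<Sum>x y\<in>D 1. f (h * x) y)"
  proof (rule tsum_cong)
    fix x y
    have "(\<Sum>a b\<in>D (h * x). f a (sH (cu b) y)) = (\<Sum>a b\<in>D (h * x). f (sH (cu b) a) y)"
      by (simp add: scale_shift[OF f])
    also have "\<dots> = f (\<Sum>a b\<in>D (h * x). sH (cu b) a) y"
      by (rule lin_tsum_apply[of sH sc "\<lambda>x. f x y", symmetric]) (intro lin_rules)
    finally show "(\<Sum>a b\<in>D (h * x). f a (sH (cu b) y)) = f (h * x) y"
      by (simp add: counit_right)
  qed
  finally show ?thesis .
qed

text \<open>At h = 1, \<open>et_comult\<close> inserts eps_t in the second leg for free, and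
  cocommutativity carries it to the first. The entries of the list \<open>D 1\<close> need not lie
  in the base algebra; they are hereby replaced by entries that do.\<close>

lemma E_et:
  assumes f: "bil sc f"
  shows "(\<Sum>a b\<in>D 1. f (et a) (et b)) = tsum f (D 1)"
proof -
  note [lin_rules] = bil_rules[OF f]
  have b: "bil sc (\<lambda>a b. f (et a) b)" "bil sc (\<lambda>a b. f b a)"
    by (intro lin_rules)+
  have "(\<Sum>a b\<in>D 1. f (et a) (et b)) = (\<Sum>a b\<in>D 1. f (et a) b)"
    unfolding et_comult[OF b(1)] by simp
  also have "\<dots> = (\<Sum>a b\<in>D 1. f (et b) a)"
    by (rule cocomm[of sc]) (intro lin_rules)
  also have "\<dots> = (\<Sum>a b\<in>D 1. f b a)"
    unfolding et_comult[OF b(2)] by simp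
  also have "\<dots> = tsum f (D 1)"
    by (rule cocomm[of sc, symmetric]) (intro lin_rules)
  finally show ?thesis .
qed

text \<open>Coassociativity turns Delta of the second leg of Delta(1) into Delta^2(1), and the two
  forms of the axiom for Delta^2(1) put the base element on either side of the first leg.\<close>

lemma D_et:
  assumes f: "bil sc f"
  shows "tsum f (D (et h)) = (\<Sum>x y\<in>D 1. f (x * et h) y)"
    and "tsum f (D (et h)) = (\<Sum>x y\<in>D 1. f (et h * x) y)"
    and "tsum f (D (es h)) = (\<Sum>x y\<in>D 1. f (x * es h) y)"
proof -
  note [lin_rules] = bil_rules[OF f]
  have g: "tsum f (D (\<Sum>x y\<in>D 1. sH (g x) y)) = (\<Sum>x y\<in>D 1. \<Sum>p q\<in>D x. f (sH (g p) q) y)"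
    if g: "lin sH (*) g" for g
  proof -
    note [lin_rules] = lin_comp[OF _ g]
    have "tsum f (D (\<Sum>x y\<in>D 1. sH (g x) y)) = (\<Sum>x y\<in>D 1. tsum f (D (sH (g x) y)))"
      by (rule lin_tsum_apply[of sH sc "\<lambda>x. tsum f (D x)"]) (intro lin_rules f)
    also have "\<dots> = (\<Sum>x y\<in>D 1. \<Sum>a b\<in>D y. f (sH (g x) a) b)"
      by (simp add: D_scale[OF f])
    also have "\<dots> = (\<Sum>x y\<in>D 1. \<Sum>p q\<in>D x. f (sH (g p) q) y)"
      by (rule coassoc[of sc "\<lambda>x a b. f (sH (g x) a) b", symmetric]) (intro lin_rules)
    finally show ?thesis .
  qed
  have r: "(\<Sum>c d\<in>D 1. \<Sum>a b\<in>D 1. f (G a b c) d) = (\<Sum>c d\<in>D 1. f (\<Sum>a b\<in>D 1. G a b c) d)" for G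
    by (rule tsum_cong, rule lin_tsum_apply[of sH sc "\<lambda>x. f x _", symmetric]) (intro lin_rules)
  interpret vector_space sH by (rule vs)
  have sm: "sH c a * b = sH c (a * b)" "a * sH c b = sH c (a * b)" for a b c
    using mult_bil unfolding bilinear_map_def by (auto simp: lin_scale[of sH sH "\<lambda>x. x * _"] lin_scale[of sH sH "(*) _"])
  have "tsum f (D (et h)) = (\<Sum>x y\<in>D 1. \<Sum>p q\<in>D x. f (sH (cu (p * h)) q) y)"
    unfolding epst_def by (rule g) (intro lin_rules)
  also have "\<dots> = (\<Sum>a b\<in>D 1. \<Sum>c d\<in>D 1. f (sH (cu (a * h)) (b * c)) d)"
    by (rule E_assoc1[of sc]) (intro lin_rules)
  also have "\<dots> = (\<Sum>c d\<in>D 1. f (et h * c) d)"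
    unfolding epst_def tsum_times_right sm by (subst tsum_commute) (rule r)
  finally show "tsum f (D (et h)) = (\<Sum>x y\<in>D 1. f (et h * x) y)" .
  have "tsum f (D (et h)) = (\<Sum>x y\<in>D 1. \<Sum>p q\<in>D x. f (sH (cu (p * h)) q) y)"
    unfolding epst_def by (rule g) (intro lin_rules)
  also have "\<dots> = (\<Sum>a b\<in>D 1. \<Sum>c d\<in>D 1. f (sH (cu (a * h)) (c * b)) d)"
    by (rule E_assoc2[of sc]) (intro lin_rules)
  also have "\<dots> = (\<Sum>c d\<in>D 1. f (c * et h) d)"
    unfolding epst_def tsum_times_left sm by (subst tsum_commute) (rule r)
  finally show "tsum f (D (et h)) = (\<Sum>x y\<in>D 1. f (x * et h) y)" .
  have "tsum f (D (es h)) = (\<Sum>x y\<in>D 1. \<Sum>p q\<in>D x. f (sH (cu (h * p)) q) y)"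
    unfolding es_alt by (rule g) (intro lin_rules)
  also have "\<dots> = (\<Sum>a b\<in>D 1. \<Sum>c d\<in>D 1. f (sH (cu (h * a)) (c * b)) d)"
    by (rule E_assoc2[of sc]) (intro lin_rules)
  also have "\<dots> = (\<Sum>c d\<in>D 1. f (c * es h) d)"
    unfolding es_alt tsum_times_left sm by (subst tsum_commute) (rule r)
  finally show "tsum f (D (es h)) = (\<Sum>x y\<in>D 1. f (x * es h) y)" .
qed

lemma mult_scale: "sH c a * b = sH c (a * b)" "a * sH c b = sH c (a * b)"
  using mult_bil unfolding bilinear_map_def by (auto simp: lin_scale[of sH sH "\<lambda>x. x * _"] lin_scale[of sH sH "(*) _"])

lemma et_es: "et (es h) = es h"
proof -
  have "et (es h) = (\<Sum>a b\<in>D (es h). sH (cu a) b)"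
    unfolding epst_def by (rule D_et(3)[of sH, symmetric]) (intro lin_rules)
  then show ?thesis by (simp add: counit_left)
qed

lemma et_et: "et (et h) = et h"
proof -
  have "et (et h) = (\<Sum>a b\<in>D (et h). sH (cu a) b)"
    unfolding epst_def[of H "et h"] by (rule D_et(1)[of sH, symmetric]) (intro lin_rules)
  then show ?thesis by (simp add: counit_left)
qed

lemma es_et: "es (et h) = et h"
proof -
  have "es (et h) = (\<Sum>a b\<in>D (et h). sH (cu a) b)"
    unfolding es_alt by (rule D_et(2)[of sH, symmetric]) (intro lin_rules)
  then show ?thesis by (simp add: counit_left)
qed

lemma et_K: "z \<in> K \<Longrightarrow> et z = z" and es_K: "z \<in> K \<Longrightarrow> es z = z"
  unfolding target_space_def by (auto simp: et_et es_et)

lemma et_in_K: "et h \<in> K"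
  unfolding target_space_def by blast

text \<open>Each counital map fixes the image of the other, because by \<open>D_et\<close> its value
  there is the counit applied to the first leg of the comultiplication.\<close>

lemma source_K: "source_space H = K"
  unfolding source_space_def target_space_def by (auto intro: rev_image_eqI) (metis es_et et_es rangeI)+

lemma es_in_K: "es h \<in> K"
  unfolding source_K[symmetric] source_space_def by blast

lemma D_K:
  assumes f: "bil sc f" and z: "z \<in> K"
  shows "tsum f (D z) = (\<Sum>x y\<in>D 1. f (x * z) y)"
    and "tsum f (D z) = (\<Sum>x y\<in>D 1. f (z * x) y)"
    and "tsum f (D z) = (\<Sum>x y\<in>D 1. f x (y * z))"
    and "tsum f (D z) = (\<Sum>x y\<in>D 1. f x (z * y))"
proof -
  note [lin_rules] = bil_rules[OF f]
  have f': "bil sc (\<lambda>x y. f y x)" by (intro lin_rules)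
  show 1: "tsum f (D z) = (\<Sum>x y\<in>D 1. f (x * z) y)" "tsum f (D z) = (\<Sum>x y\<in>D 1. f (z * x) y)"
    using D_et(1,2)[OF f, of z] by (simp_all add: et_K z)
  show "tsum f (D z) = (\<Sum>x y\<in>D 1. f x (y * z))"
    using D_et(1)[OF f', of z] cocomm[OF f, of z] cocomm[of sc "\<lambda>x y. f x (y * z)" 1, OF bilI]
    by (simp add: et_K z lin_rules)
  show "tsum f (D z) = (\<Sum>x y\<in>D 1. f x (z * y))"
    using D_et(2)[OF f', of z] cocomm[OF f, of z] cocomm[of sc "\<lambda>x y. f x (z * y)" 1, OF bilI]
    by (simp add: et_K z lin_rules)
qed

text \<open>Multiplying the second leg of Delta(1) by z from the left or from the right gives
  Delta(z) both times, and eps_t(w) is read off from that second leg.\<close>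

lemma K_comm: assumes z: "z \<in> K" and w: "w \<in> K" shows "z * w = w * z"
proof -
  have "z * et w = (\<Sum>x y\<in>D 1. sH (cu (x * w)) (z * y))"
    unfolding epst_def tsum_times_left mult_scale ..
  also have "\<dots> = (\<Sum>x y\<in>D z. sH (cu (x * w)) y)"
    by (rule D_K(4)[of sH, symmetric]) (intro lin_rules z)+
  also have "\<dots> = (\<Sum>x y\<in>D 1. sH (cu (x * w)) (y * z))"
    by (rule D_K(3)[of sH]) (intro lin_rules z)+
  also have "\<dots> = et w * z"
    unfolding epst_def tsum_times_right mult_scale ..
  finally show ?thesis by (simp add: et_K w)
qed

lemma et_1: "et 1 = 1"
  unfolding epst_def by (simp add: counit_left)

lemma es_1: "es 1 = 1"
  using es_et[of 1] by (simp add: et_1)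

lemma one_K: "1 \<in> K"
  using et_in_K[of 1] by (simp add: et_1)

text \<open>Weak multiplicativity of the counit with 1 in the middle, the legs of Delta(1) being
  exchangeable.\<close>

lemma cu_et: "cu (h * et l) = cu (h * l)"
proof -
  have "cu (h * et l) = (\<Sum>a b\<in>D 1. cu (h * b) * cu (a * l))"
    unfolding epst_def tsum_times_left mult_scale
    by (subst lin_tsum_apply[OF cu_lin]) (simp add: lin_scale[OF cu_lin] mult.commute)
  also have "\<dots> = (\<Sum>a b\<in>D 1. cu (h * a) * cu (b * l))"
    by (rule cocomm[of "(*)"]) (intro lin_rules)
  finally show ?thesis using cu_mult[of h 1 l] by simp
qed

lemma cu_es: "cu (es h * l) = cu (h * l)"
proof -
  have "cu (es h * l) = (\<Sum>a b\<in>D 1. cu (h * a) * cu (b * l))"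
    unfolding es_alt tsum_times_right mult_scale
    by (subst lin_tsum_apply[OF cu_lin]) (simp add: lin_scale[OF cu_lin])
  then show ?thesis using cu_mult[of h 1 l] by simp
qed

lemma et_mult_et: "et (h * et l) = et (h * l)"
  unfolding epst_def[of H "h * _"] using cu_et by (simp add: mult.assoc[symmetric])

lemma es_es_mult: "es (es h * l) = es (h * l)"
  unfolding es_alt[of "_ * l"] using cu_es by (simp add: mult.assoc)

lemma et_z_mult: assumes z: "z \<in> K" shows "et (z * h) = z * et h"
proof -
  have "et (z * h) = (\<Sum>x y\<in>D z. sH (cu (x * h)) y)"
    unfolding epst_def mult.assoc[symmetric] by (rule D_K(1)[of sH, symmetric]) (intro lin_rules z)+
  also have "\<dots> = (\<Sum>x y\<in>D 1. sH (cu (x * h)) (z * y))"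
    by (rule D_K(4)[of sH]) (intro lin_rules z)+
  also have "\<dots> = z * et h"
    unfolding epst_def tsum_times_left mult_scale ..
  finally show ?thesis .
qed

lemma es_mult_z: assumes z: "z \<in> K" shows "es (h * z) = es h * z"
proof -
  have "es (h * z) = (\<Sum>x y\<in>D z. sH (cu (h * x)) y)"
    unfolding es_alt mult.assoc by (rule D_K(2)[of sH, symmetric]) (intro lin_rules z)+
  also have "\<dots> = (\<Sum>x y\<in>D 1. sH (cu (h * x)) (y * z))"
    by (rule D_K(3)[of sH]) (intro lin_rules z)+
  also have "\<dots> = es h * z"
    unfolding es_alt tsum_times_right mult_scale ..
  finally show ?thesis .
qed

lemma K_mult: "z \<in> K \<Longrightarrow> w \<in> K \<Longrightarrow> z * w \<in> K"
  by (metis et_K et_in_K et_z_mult)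

text \<open>The usable form of Delta(1) lying in K \<otimes> K: bilinear maps need only be compared
  on \<open>K\<close>.\<close>

lemma E_K:
  assumes f: "bil sc f" and g: "\<And>x y. x \<in> K \<Longrightarrow> y \<in> K \<Longrightarrow> f x y = g x y"
    and g': "bil sc g"
  shows "tsum f (D 1) = tsum g (D 1)"
  using E_et[OF f] E_et[OF g'] g et_in_K by simp

lemma D_K_mult:
  assumes f: "bil sc f" and z: "z \<in> K"
  shows "tsum f (D (z * h)) = (\<Sum>a b\<in>D h. f (z * a) b)"
    and "tsum f (D (z * h)) = (\<Sum>a b\<in>D h. f a (z * b))"
    and "tsum f (D (h * z)) = (\<Sum>a b\<in>D h. f (a * z) b)"
    and "tsum f (D (h * z)) = (\<Sum>a b\<in>D h. f a (b * z))"
proof -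
  note [lin_rules] = bil_rules[OF f]
  have b: "bil sc (\<lambda>a b. \<Sum>c d\<in>D h. f (a * c) (b * d))"
    "bil sc (\<lambda>a b. \<Sum>c d\<in>D h. f (c * a) (d * b))" by (intro lin_rules)+
  have "tsum f (D (h * z)) = (\<Sum>c d\<in>D h. \<Sum>a b\<in>D z. f (c * a) (d * b))"
    by (rule D_mult[OF f])
  also have "\<dots> = (\<Sum>a b\<in>D z. \<Sum>c d\<in>D h. f (c * a) (d * b))"
    by (rule tsum_commute)
  finally have hz: "tsum f (D (h * z)) = (\<Sum>a b\<in>D z. \<Sum>c d\<in>D h. f (c * a) (d * b))" .
  have 1: "bil sc (\<lambda>a b. f (z * a) b)" "bil sc (\<lambda>a b. f a (z * b))"
    "bil sc (\<lambda>a b. f (a * z) b)" "bil sc (\<lambda>a b. f a (b * z))"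
    by (intro lin_rules)+
  note c = tsum_commute[where t = "D 1" and u = "D h"]
  show "tsum f (D (z * h)) = (\<Sum>a b\<in>D h. f (z * a) b)"
    unfolding D_mult[OF f] D_K(2)[OF b(1) z] D_E_left[OF 1(1)] mult.assoc ..
  show "tsum f (D (z * h)) = (\<Sum>a b\<in>D h. f a (z * b))"
    unfolding D_mult[OF f] D_K(4)[OF b(1) z] D_E_left[OF 1(2)] mult.assoc ..
  show "tsum f (D (h * z)) = (\<Sum>a b\<in>D h. f (a * z) b)"
    unfolding hz D_K(1)[OF b(2) z] D_E_right[OF 1(3)] mult.assoc c ..
  show "tsum f (D (h * z)) = (\<Sum>a b\<in>D h. f a (b * z))"
    unfolding hz D_K(3)[OF b(2) z] D_E_right[OF 1(4)] mult.assoc c ..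
qed

text \<open>In S = S * id * S the first two factors give eps_s, which fixes z 1_1; what remains
  after pulling out z is 1_1 S(1_2) = eps_t(1) = 1.\<close>

lemma S_K: assumes z: "z \<in> K" shows "S z = z"
proof -
  have "S z = (\<Sum>a b\<in>D z. es a * S b)"
    using S_id_S[of z] by (simp add: tsum_times_right[symmetric] S_id)
  also have "\<dots> = (\<Sum>x y\<in>D 1. es (z * x) * S y)"
    by (rule D_K(2)[of sH]) (intro lin_rules z)+
  also have "\<dots> = (\<Sum>x y\<in>D 1. z * x * S y)"
    by (rule E_K[of sH]) ((intro lin_rules)+, simp add: es_K K_mult z, intro lin_rules)
  also have "\<dots> = z"
    using id_S[of 1] by (simp add: tsum_times_left[symmetric] mult.assoc et_1)
  finally show ?thesis .
qed

end

section \<open>Antipode, centralizer and adjoint action in the cocommutative case\<close>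

context cocomm_groupoid begin

lemma quad_vs: "quad sc f \<Longrightarrow> vector_space sc"
  unfolding quadrilinear_map_def using lin_vs2 by blast

text \<open>Coassociativity regroups the four legs so that the two middle ones come from a single
  comultiplication, where cocommutativity exchanges them.\<close>

lemma comult4_swap:
  assumes f: "quad sc f"
  shows "(\<Sum>a b\<in>D h. \<Sum>p q\<in>D a. \<Sum>x y\<in>D b. f p q x y) =
    (\<Sum>a b\<in>D h. \<Sum>p q\<in>D a. \<Sum>x y\<in>D b. f p x q y)"
proof -
  note [lin_rules] = quad_lin[OF f] quad_vs[OF f]
  have *: "(\<Sum>a b\<in>D h. \<Sum>p q\<in>D a. \<Sum>x y\<in>D b. g p q x y) =
      (\<Sum>p b\<in>D h. \<Sum>m y\<in>D b. \<Sum>q x\<in>D m. g p q x y)"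
    if g: "quad sc g" for g
  proof -
    note [lin_rules] = quad_lin[OF g]
    have "(\<Sum>a b\<in>D h. \<Sum>p q\<in>D a. \<Sum>x y\<in>D b. g p q x y) =
      (\<Sum>p c\<in>D h. \<Sum>q b\<in>D c. \<Sum>x y\<in>D b. g p q x y)"
      by (rule coassoc[of sc "\<lambda>p q b. \<Sum>x y\<in>D b. g p q x y"]) (intro lin_rules)
    also have "\<dots> = (\<Sum>p b\<in>D h. \<Sum>m y\<in>D b. \<Sum>q x\<in>D m. g p q x y)"
      by (rule tsum_cong, rule coassoc[of sc "g _", symmetric]) (intro lin_rules)
    finally show ?thesis .
  qed
  have c: "(\<Sum>q x\<in>D m. f p q x y) = (\<Sum>q x\<in>D m. f p x q y)" for p y m
    by (rule cocomm[of sc]) (intro lin_rules)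
  show ?thesis
    unfolding *[OF f] c by (rule *[symmetric]) (intro lin_rules)
qed

lemma S_et: "(\<Sum>a b\<in>D h. S a * et b) = S h"
  and es_S: "(\<Sum>a b\<in>D h. es a * S b) = S h"
proof -
  show 1: "(\<Sum>a b\<in>D h. es a * S b) = S h"
    using S_id_S[of h] by (simp add: tsum_times_right[symmetric] S_id)
  have "S h = (\<Sum>a b\<in>D h. \<Sum>x y\<in>D b. S a * x * S y)"
    unfolding S_id_S[of h, symmetric] by (rule coassoc[of sH "\<lambda>x y b. S x * y * S b"]) (intro lin_rules)
  then show "(\<Sum>a b\<in>D h. S a * et b) = S h"
    by (simp add: id_S[symmetric] tsum_times_left mult.assoc)
qed

lemma Ad_K: assumes "z \<in> K" shows "Ad h z = et (h * z)"
  unfolding adj_def id_S[symmetric] by (rule D_K_mult(3)[of sH, symmetric]) (intro lin_rules assms)+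

text \<open>The usual convolution argument, with the counital maps in place of the counit. S(hl) is
  S(h_1 l_1) eps_t(h_2 l_2), and the last factor is h_2 l_2 S(l_3) S(h_3). Then S(h_1 l_1) h_2 l_2
  recombines to eps_s(h_1 l_1), which is expanded once more as S(l_1) eps_s(h_1) l_2.\<close>

lemma S_mult: "S (h * l) = S l * S h"
proof -
  have e: "es (a * c) = (\<Sum>r t\<in>D c. S r * (es a * t))" for a c
  proof -
    have "es (a * c) = (\<Sum>r t\<in>D (es a * c). S r * t)" by (simp add: S_id es_es_mult)
    also have "\<dots> = (\<Sum>r t\<in>D c. S r * (es a * t))"
      by (rule D_K_mult(2)[of sH]) (intro lin_rules es_in_K)+
    finally show ?thesis .
  qed
  have t: "et (b * d) = (\<Sum>p q\<in>D b. \<Sum>r t\<in>D d. p * (r * (S t * S q)))" for b d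
    unfolding et_mult_et[of b d, symmetric] Ad_K[OF et_in_K, symmetric] adj_def
    by (simp add: id_S[symmetric] tsum_times_left tsum_times_right mult.assoc)
  have "S (h * l) = (\<Sum>a b\<in>D (h * l). S a * et b)" by (rule S_et[symmetric])
  also have "\<dots> = (\<Sum>a b\<in>D h. \<Sum>c d\<in>D l. S (a * c) * et (b * d))"
    by (rule D_mult[of sH]) (intro lin_rules)
  also have "\<dots> = (\<Sum>a b\<in>D h. \<Sum>p q\<in>D b. \<Sum>c d\<in>D l. \<Sum>r t\<in>D d. S (a * c) * (p * (r * (S t * S q))))"
    unfolding t tsum_times_left by (rule tsum_cong, rule tsum_commute)
  also have "\<dots> = (\<Sum>a b\<in>D h. \<Sum>p q\<in>D a. \<Sum>c d\<in>D l. \<Sum>r t\<in>D c. S (p * r) * (q * (t * (S d * S b))))"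
    apply (subst coassoc[of sH "\<lambda>p q b. \<Sum>c d\<in>D l. \<Sum>r t\<in>D c. S (p * r) * (q * (t * (S d * S b)))"])
     apply (intro lin_rules)
    by (rule tsum_cong, rule tsum_cong, rule coassoc[of sH "\<lambda>r t d. S (_ * r) * (_ * (t * (S d * S _)))", symmetric]) (intro lin_rules)
  also have "\<dots> = (\<Sum>a b\<in>D h. \<Sum>c d\<in>D l. \<Sum>p q\<in>D a. \<Sum>r t\<in>D c. S (p * r) * (q * (t * (S d * S b))))"
    by (rule tsum_cong, rule tsum_commute)
  also have "\<dots> = (\<Sum>a b\<in>D h. \<Sum>c d\<in>D l. es (a * c) * (S d * S b))"
  proof (rule tsum_cong, rule tsum_cong)
    fix a b c d
    have "es (a * c) = (\<Sum>p q\<in>D a. \<Sum>r t\<in>D c. S (p * r) * (q * t))"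
      unfolding S_id[symmetric] by (rule D_mult[of sH]) (intro lin_rules)
    then show "(\<Sum>p q\<in>D a. \<Sum>r t\<in>D c. S (p * r) * (q * (t * (S d * S b)))) = es (a * c) * (S d * S b)"
      by (simp add: tsum_times_right mult.assoc)
  qed
  also have "\<dots> = (\<Sum>a b\<in>D h. \<Sum>c d\<in>D l. \<Sum>r t\<in>D c. S r * (es a * (t * (S d * S b))))"
    by (simp add: e tsum_times_right mult.assoc)
  also have "\<dots> = (\<Sum>a b\<in>D h. \<Sum>r d\<in>D l. \<Sum>t x\<in>D d. S r * (es a * (t * (S x * S b))))"
    by (rule tsum_cong, rule coassoc[of sH "\<lambda>r t d. S r * (es _ * (t * (S d * S _)))"]) (intro lin_rules)
  \<comment> \<open>The factors belonging to \<open>h\<close> and to \<open>l\<close> are separated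
    by exchanging a value of eps_s with a value of eps_t, both in the commutative
    \<open>K\<close>.\<close>
  also have "\<dots> = (\<Sum>a b\<in>D h. \<Sum>r d\<in>D l. (S r * et d) * (es a * S b))"
  proof (rule tsum_cong, rule tsum_cong)
    fix a b r d
    have "S r * (es a * (et d * S b)) = S r * et d * (es a * S b)"
      using K_comm[OF et_in_K es_in_K, of d a] by (metis mult.assoc)
    then show "(\<Sum>t x\<in>D d. S r * (es a * (t * (S x * S b)))) = S r * et d * (es a * S b)"
      by (simp add: id_S[symmetric] tsum_times_right tsum_times_left mult.assoc)
  qed
  also have "\<dots> = S l * S h"
    unfolding S_et[of l, symmetric] es_S[of h, symmetric] by (simp add: tsum_times_left tsum_times_right)
  finally show ?thesis .
qed

text \<open>On K \<otimes> K the second leg may be replaced by its image under S, which turns the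
  product into eps_t(1).\<close>

lemma E_mult: "(\<Sum>a b\<in>D 1. a * b) = 1"
proof -
  have "(\<Sum>a b\<in>D 1. a * b) = (\<Sum>a b\<in>D 1. a * S b)"
    by (rule E_K[of sH]) ((intro lin_rules)+, simp add: S_K, intro lin_rules)
  then show ?thesis by (simp add: id_S et_1)
qed

lemma mult_es: "(\<Sum>a b\<in>D h. a * es b) = h"
  and et_mult: "(\<Sum>a b\<in>D h. et a * b) = h"
proof -
  show "(\<Sum>a b\<in>D h. a * es b) = h"
    using es_comult[of sH "\<lambda>a b. a * b" h, OF mult_bil] E_mult
    by (simp add: mult.assoc tsum_times_left[symmetric])
  have "(\<Sum>a b\<in>D h. et a * b) = (\<Sum>a b\<in>D h. et b * a)"
    by (rule cocomm[of sH]) (intro lin_rules)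
  also have "\<dots> = (\<Sum>x y\<in>D 1. y * (x * h))"
    by (rule et_comult[of sH]) (intro lin_rules)
  also have "\<dots> = (\<Sum>x y\<in>D 1. y * x) * h"
    by (simp add: tsum_times_right mult.assoc)
  also have "(\<Sum>x y\<in>D 1. y * x) = (\<Sum>x y\<in>D 1. x * y)"
    by (rule cocomm[of sH, symmetric]) (intro lin_rules)
  finally show "(\<Sum>a b\<in>D h. et a * b) = h" by (simp add: E_mult)
qed

text \<open>Applying S to S * id = eps_s and exchanging the legs gives S * S^2 = eps_s, since S
  fixes \<open>K\<close>. Thus h = h_1 S(h_2) S^2(h_3) = eps_t(h_1) S^2(h_2) = S^2(eps_t(h_1) h_2) =
  S^2(h).\<close>

lemma S_S: "S (S h) = h"
proof -
  have 1: "es x = (\<Sum>a b\<in>D x. S a * S (S b))" for x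
  proof -
    have "es x = (\<Sum>a b\<in>D x. S (S a * b))"
      unfolding lin_tsum_apply[OF S_lin, symmetric] S_id by (simp add: S_K es_in_K)
    also have "\<dots> = (\<Sum>a b\<in>D x. S b * S (S a))" by (simp add: S_mult)
    also have "\<dots> = (\<Sum>a b\<in>D x. S a * S (S b))"
      by (rule cocomm[of sH]) (intro lin_rules)
    finally show ?thesis .
  qed
  have "h = (\<Sum>a b\<in>D h. \<Sum>p q\<in>D b. a * (S p * S (S q)))"
    by (simp add: mult_es 1[symmetric] tsum_times_left[symmetric])
  also have "\<dots> = (\<Sum>a b\<in>D h. \<Sum>p q\<in>D a. p * (S q * S (S b)))"
    by (rule coassoc[of sH "\<lambda>a p q. a * (S p * S (S q))", symmetric]) (intro lin_rules)
  also have "\<dots> = (\<Sum>a b\<in>D h. S (S (et a * b)))"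
    by (simp add: id_S[symmetric] mult.assoc[symmetric] tsum_times_right[symmetric] S_mult)
      (simp add: id_S S_K et_in_K)
  also have "\<dots> = S (S h)"
    by (simp add: lin_tsum_apply[OF S_lin, symmetric] et_mult)
  finally show ?thesis by simp
qed

text \<open>By \<open>et_comult\<close> both sides describe Delta(1) (eps_t(h) \<otimes> 1).\<close>

lemma D_et_et:
  assumes f: "bil sc f"
  shows "tsum f (D (et h)) = (\<Sum>a b\<in>D h. f (et a) (et b))"
proof -
  note [lin_rules] = bil_rules[OF f]
  have "(\<Sum>a b\<in>D h. f (et a) (et b)) = (\<Sum>x y\<in>D 1. f (et (x * h)) y)"
    by (rule et_comult[of sc]) (intro lin_rules)
  also have "\<dots> = (\<Sum>x y\<in>D 1. f (x * et h) y)"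
    by (rule E_K[of sc]) ((intro lin_rules)+, simp add: et_z_mult, intro lin_rules)
  also have "\<dots> = tsum f (D (et h))"
    by (rule D_et(1)[OF f, symmetric])
  finally show ?thesis by simp
qed

lemma D_es_es:
  assumes f: "bil sc f"
  shows "tsum f (D (es h)) = (\<Sum>a b\<in>D h. f (es a) (es b))"
proof -
  note [lin_rules] = bil_rules[OF f]
  have "(\<Sum>a b\<in>D h. f (es a) (es b)) = (\<Sum>x y\<in>D 1. f (es (h * x)) y)"
    by (rule es_comult[of sc]) (intro lin_rules)
  also have "\<dots> = (\<Sum>x y\<in>D 1. f (es h * x) y)"
    by (rule E_K[of sc]) ((intro lin_rules)+, simp add: es_mult_z, intro lin_rules)
  also have "\<dots> = tsum f (D (es h))"
    by (rule D_K(2)[OF f es_in_K, symmetric])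
  finally show ?thesis by simp
qed

text \<open>Dual to the argument for \<open>S_mult\<close>: Delta is applied to S(h_1) eps_t(h_2),
  eps_t is expanded in both legs, and exchanging the middle legs lets Delta(S(h_1)) recombine with
  Delta(h_2) to Delta of a value of eps_s.\<close>

lemma S_comult:
  assumes f: "bil sc f"
  shows "tsum f (D (S h)) = (\<Sum>a b\<in>D h. f (S a) (S b))"
proof -
  note [lin_rules] = bil_rules[OF f]
  have i: "(\<Sum>a b\<in>D x. \<Sum>r t\<in>D y. f (p * (a * S b)) (q * (r * S t))) = f (p * et x) (q * et y)" for p q x y
  proof -
    have "(\<Sum>a b\<in>D x. \<Sum>r t\<in>D y. f (p * (a * S b)) (q * (r * S t))) =
        (\<Sum>a b\<in>D x. f (p * (a * S b)) (q * et y))"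
      unfolding id_S[symmetric] tsum_times_left
      by (rule tsum_cong, rule lin_tsum_apply[of sH sc "f _", symmetric]) (intro lin_rules)
    also have "\<dots> = f (p * et x) (q * et y)"
      unfolding id_S[of x, symmetric] tsum_times_left
      by (rule lin_tsum_apply[of sH sc "\<lambda>x. f x _", symmetric]) (intro lin_rules)
    finally show ?thesis .
  qed
  have j: "(\<Sum>a b\<in>D x. \<Sum>r t\<in>D y. f (es a * S b) (es r * S t)) = f (S x) (S y)" for x y
  proof -
    have "(\<Sum>a b\<in>D x. \<Sum>r t\<in>D y. f (es a * S b) (es r * S t)) =
        (\<Sum>a b\<in>D x. f (es a * S b) (S y))"
      unfolding es_S[of y, symmetric]
      by (rule tsum_cong, rule lin_tsum_apply[of sH sc "f _", symmetric]) (intro lin_rules)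
    also have "\<dots> = f (S x) (S y)"
      unfolding es_S[of x, symmetric]
      by (rule lin_tsum_apply[of sH sc "\<lambda>x. f x _", symmetric]) (intro lin_rules)
    finally show ?thesis .
  qed
  have "tsum f (D (S h)) = (\<Sum>a b\<in>D h. tsum f (D (S a * et b)))"
    unfolding S_et[of h, symmetric]
    by (rule lin_tsum_apply[of sH sc "\<lambda>x. tsum f (D x)"]) (intro lin_rules f)
  also have "\<dots> = (\<Sum>a b\<in>D h. \<Sum>p q\<in>D (S a). \<Sum>r t\<in>D (et b). f (p * r) (q * t))"
    by (simp only: D_mult[OF f])
  also have "\<dots> = (\<Sum>a b\<in>D h. \<Sum>p q\<in>D (S a). \<Sum>r t\<in>D b. f (p * et r) (q * et t))"
    by (rule tsum_cong, rule tsum_cong, rule D_et_et[of sc "\<lambda>r t. f (_ * r) (_ * t)"]) (intro lin_rules)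
  also have "\<dots> = (\<Sum>a b\<in>D h. \<Sum>p q\<in>D (S a). \<Sum>r t\<in>D b. \<Sum>x y\<in>D r. \<Sum>u w\<in>D t. f (p * (x * S y)) (q * (u * S w)))"
    unfolding i ..
  also have "\<dots> = (\<Sum>a b\<in>D h. \<Sum>p q\<in>D (S a). \<Sum>r t\<in>D b. \<Sum>x y\<in>D r. \<Sum>u w\<in>D t. f (p * (x * S u)) (q * (y * S w)))"
    by (rule tsum_cong, rule tsum_cong, rule comult4_swap[of sc "\<lambda>x y u w. f (_ * (x * S y)) (_ * (u * S w))"]) (intro lin_rules)
  also have "\<dots> = (\<Sum>a b\<in>D h. \<Sum>r t\<in>D b. \<Sum>p q\<in>D (S a). \<Sum>x y\<in>D r. \<Sum>u w\<in>D t. f (p * (x * S u)) (q * (y * S w)))"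
    by (rule tsum_cong, rule tsum_commute)
  also have "\<dots> = (\<Sum>a b\<in>D h. \<Sum>r t\<in>D b. \<Sum>p q\<in>D (S a * r). \<Sum>u w\<in>D t. f (p * S u) (q * S w))"
    by (simp only: mult.assoc[symmetric],
        rule tsum_cong, rule tsum_cong, rule D_mult[of sc "\<lambda>p q. \<Sum>u w\<in>D _. f (p * S u) (q * S w)", symmetric])
      (intro lin_rules)
  also have "\<dots> = (\<Sum>a b\<in>D h. \<Sum>r t\<in>D a. \<Sum>p q\<in>D (S r * t). \<Sum>u w\<in>D b. f (p * S u) (q * S w))"
    by (rule coassoc[of sc "\<lambda>a r t. \<Sum>p q\<in>D (S a * r). \<Sum>u w\<in>D t. f (p * S u) (q * S w)", symmetric])
      (intro lin_rules)
  also have "\<dots> = (\<Sum>a b\<in>D h. \<Sum>p q\<in>D (es a). \<Sum>u w\<in>D b. f (p * S u) (q * S w))"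
    unfolding S_id[symmetric]
    by (rule tsum_cong, rule lin_tsum_apply[of sH sc "\<lambda>x. \<Sum>p q\<in>D x. \<Sum>u w\<in>D _.
          f (p * S u) (q * S w)", symmetric])
      (intro lin_rules)
  also have "\<dots> = (\<Sum>a b\<in>D h. \<Sum>p q\<in>D a. \<Sum>u w\<in>D b. f (es p * S u) (es q * S w))"
    by (rule tsum_cong, rule D_es_es[of sc "\<lambda>p q. \<Sum>u w\<in>D _. f (p * S u) (q * S w)"]) (intro lin_rules)
  also have "\<dots> = (\<Sum>a b\<in>D h. \<Sum>p q\<in>D a. \<Sum>u w\<in>D b. f (es p * S q) (es u * S w))"
    by (rule comult4_swap[of sc "\<lambda>p q u w. f (es p * S u) (es q * S w)"]) (intro lin_rules)
  also have "\<dots> = (\<Sum>a b\<in>D h. f (S a) (S b))"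
    unfolding j ..
  finally show ?thesis .
qed

lemma C_iff: "x \<in> C \<longleftrightarrow> (\<forall>z\<in>K. x * z = z * x)"
  unfolding centralizer_def source_K by simp

lemma C_comm: "x \<in> C \<Longrightarrow> z \<in> K \<Longrightarrow> x * z = z * x"
  by (simp add: C_iff)

lemma K_sub_C: "K \<subseteq> C"
  using K_comm by (auto simp: C_iff)

lemma C_mult: "x \<in> C \<Longrightarrow> y \<in> C \<Longrightarrow> x * y \<in> C"
  unfolding C_iff by (metis mult.assoc)

lemma S_C: assumes "x \<in> C" shows "S x \<in> C"
  unfolding C_iff
proof
  fix z assume z: "z \<in> K"
  have "S (x * z) = S (z * x)" using C_comm[OF assms z] by simp
  then show "S x * z = z * S x" by (simp add: S_mult S_K z)
qed

lemma C_subspace: "module.subspace sH C"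
proof -
  interpret vector_space sH by (rule vs)
  show ?thesis
    by (rule subspaceI) (auto simp: C_iff mult_scale distrib_left distrib_right)
qed

lemma Ad_mult: "Ad (h * l) x = Ad h (Ad l x)"
proof -
  have "Ad (h * l) x = (\<Sum>a b\<in>D h. \<Sum>c d\<in>D l. a * c * x * S (b * d))"
    unfolding adj_def by (rule D_mult[of sH]) (intro lin_rules)
  then show ?thesis
    unfolding adj_def by (simp add: S_mult tsum_times_left tsum_times_right mult.assoc)
qed

text \<open>An element of \<open>K\<close> to the left of h_1 may be placed to the left of h_2
  instead; the antipode fixes it and carries it to the right end.\<close>

lemma Ad_C: "Ad h x \<in> C"
  unfolding C_iff
proof
  fix z assume z: "z \<in> K"
  have "z * Ad h x = (\<Sum>a b\<in>D h. (z * a) * x * S b)"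
    unfolding adj_def tsum_times_left by (simp add: mult.assoc)
  also have "\<dots> = (\<Sum>a b\<in>D (z * h). a * x * S b)"
    by (rule D_K_mult(1)[of sH, symmetric]) (intro lin_rules z)+
  also have "\<dots> = (\<Sum>a b\<in>D h. a * x * S (z * b))"
    by (rule D_K_mult(2)[of sH]) (intro lin_rules z)+
  also have "\<dots> = Ad h x * z"
    unfolding adj_def tsum_times_right by (simp add: S_mult S_K z mult.assoc)
  finally show "Ad h x * z = z * Ad h x" by simp
qed

lemma Ad_K_C: assumes "z \<in> K" "x \<in> C" shows "Ad z x = z * x"
proof -
  have "Ad z x = (\<Sum>a b\<in>D 1. z * a * x * S b)"
    unfolding adj_def by (rule D_K(2)[of sH]) (intro lin_rules assms)+
  also have "\<dots> = (\<Sum>a b\<in>D 1. z * x * (a * b))"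
    by (rule E_K[of sH])
      ((intro lin_rules)+, metis S_K C_comm[OF assms(2)] mult.assoc, intro lin_rules)
  finally show ?thesis by (simp add: tsum_times_left[symmetric] E_mult)
qed

lemma Ad_1: "x \<in> C \<Longrightarrow> Ad 1 x = x"
  by (simp add: Ad_K_C one_K)

text \<open>The factors S(h_2) h_3 form a value of eps_s, which can pass \<open>a\<close> because
  \<open>a\<close> centralizes the base. This smash product rule underlies both the product formula
  for the adjoint action and the multiplicativity of \<open>alpha\<close>.\<close>

lemma mult_Ad:
  assumes a: "a \<in> C" shows "h * a = (\<Sum>p q\<in>D h. Ad p a * q)"
proof -
  have "(\<Sum>p q\<in>D h. Ad p a * q) = (\<Sum>p q\<in>D h. \<Sum>u w\<in>D p. u * a * S w * q)"
    unfolding adj_def tsum_times_right ..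
  also have "\<dots> = (\<Sum>p q\<in>D h. \<Sum>w x\<in>D q. p * a * S w * x)"
    by (rule coassoc[of sH "\<lambda>u w q. u * a * S w * q"]) (intro lin_rules)
  also have "\<dots> = (\<Sum>p q\<in>D h. p * es q * a)"
    by (rule tsum_cong) (simp add: S_id mult.assoc tsum_times_left[symmetric] C_comm[OF a es_in_K, symmetric])
  also have "\<dots> = h * a"
    by (simp add: tsum_times_right[symmetric] mult_es)
  finally show ?thesis by simp
qed

lemma Ad_prod:
  assumes a: "a \<in> C" shows "Ad h (a * b) = (\<Sum>p q\<in>D h. Ad p a * Ad q b)"
proof -
  have "Ad h (a * b) = (\<Sum>p q\<in>D h. (p * a) * b * S q)"
    unfolding adj_def by (simp add: mult.assoc)
  also have "\<dots> = (\<Sum>p q\<in>D h. \<Sum>u w\<in>D p. Ad u a * (w * b * S q))"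
    unfolding mult_Ad[OF a] tsum_times_right by (simp add: mult.assoc)
  also have "\<dots> = (\<Sum>p q\<in>D h. \<Sum>u w\<in>D q. Ad p a * (u * b * S w))"
    by (rule coassoc[of sH "\<lambda>u w q. Ad u a * (w * b * S q)"]) (intro lin_rules)
  also have "\<dots> = (\<Sum>p q\<in>D h. Ad p a * Ad q b)"
    unfolding adj_def[of H _ b] tsum_times_left ..
  finally show ?thesis .
qed

text \<open>Cocommutativity puts S next to the factor it cancels against: S(h_1) h_2 c S(h_3) = c
  eps_s(h_1) S(h_2) = c S(h).\<close>

lemma S_mult_Ad:
  assumes c: "c \<in> C" shows "(\<Sum>p q\<in>D h. S q * Ad p c) = c * S h"
proof -
  have "(\<Sum>p q\<in>D h. S q * Ad p c) = (\<Sum>p q\<in>D h. S p * Ad q c)"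
    by (rule cocomm[of sH]) (intro lin_rules)
  also have "\<dots> = (\<Sum>p q\<in>D h. \<Sum>u w\<in>D q. S p * (u * c * S w))"
    unfolding adj_def tsum_times_left ..
  also have "\<dots> = (\<Sum>p q\<in>D h. \<Sum>u w\<in>D p. S u * (w * c * S q))"
    by (rule coassoc[of sH "\<lambda>p u w. S p * (u * c * S w)", symmetric]) (intro lin_rules)
  also have "\<dots> = (\<Sum>p q\<in>D h. c * (es p * S q))"
    by (rule tsum_cong) (simp add: S_id mult.assoc[symmetric] tsum_times_right[symmetric] C_comm[OF c es_in_K])
  also have "\<dots> = c * S h"
    by (simp add: tsum_times_left[symmetric] es_S)
  finally show ?thesis .
qed

text \<open>Delta splits h_1 a S(h_2) into four legs of \<open>h\<close>; the two middle ones arrive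
  in the wrong order, which cocommutativity corrects.\<close>

lemma D_Ad:
  assumes f: "bil sc f"
  shows "tsum f (D (Ad h a)) = (\<Sum>p q\<in>D h. \<Sum>x y\<in>D a. f (Ad p x) (Ad q y))"
proof -
  note [lin_rules] = bil_rules[OF f]
  have b: "bil sc (\<lambda>x y. f (p * x) (q * y))" for p q by (intro lin_rules)
  have j: "(\<Sum>u u'\<in>D p. \<Sum>r t\<in>D q. f (u * x * S u') (r * y * S t)) = f (Ad p x) (Ad q y)" for p q x y
  proof -
    have "(\<Sum>u u'\<in>D p. \<Sum>r t\<in>D q. f (u * x * S u') (r * y * S t)) =
        (\<Sum>u u'\<in>D p. f (u * x * S u') (Ad q y))"
      unfolding adj_def
      by (rule tsum_cong, rule lin_tsum_apply[of sH sc "f _", symmetric]) (intro lin_rules)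
    also have "\<dots> = f (Ad p x) (Ad q y)"
      unfolding adj_def[of H p]
      by (rule lin_tsum_apply[of sH sc "\<lambda>x. f x _", symmetric]) (intro lin_rules)
    finally show ?thesis .
  qed
  have "tsum f (D (Ad h a)) = (\<Sum>p q\<in>D h. tsum f (D (p * a * S q)))"
    unfolding adj_def
    by (rule lin_tsum_apply[of sH sc "\<lambda>x. tsum f (D x)"]) (intro lin_rules f)
  also have "\<dots> = (\<Sum>p q\<in>D h. \<Sum>u u'\<in>D p. \<Sum>x y\<in>D a. \<Sum>r t\<in>D (S q). f (u * x * r) (u' * y * t))"
    unfolding mult.assoc D_mult[OF f] D_mult[OF b] ..
  also have "\<dots> = (\<Sum>p q\<in>D h. \<Sum>u u'\<in>D p. \<Sum>x y\<in>D a. \<Sum>r t\<in>D q. f (u * x * S r) (u' * y * S t))"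
    by (rule tsum_cong, rule tsum_cong, rule tsum_cong, rule S_comult[of sc "\<lambda>r t. f (_ * r) (_ * t)"]) (intro lin_rules)
  also have "\<dots> = (\<Sum>p q\<in>D h. \<Sum>u u'\<in>D p. \<Sum>r t\<in>D q. \<Sum>x y\<in>D a. f (u * x * S r) (u' * y * S t))"
    by (rule tsum_cong, rule tsum_cong, rule tsum_commute)
  also have "\<dots> = (\<Sum>p q\<in>D h. \<Sum>u u'\<in>D p. \<Sum>r t\<in>D q. \<Sum>x y\<in>D a. f (u * x * S u') (r * y * S t))"
    by (rule comult4_swap[of sc "\<lambda>u u' r t. \<Sum>x y\<in>D a. f (u * x * S r) (u' * y * S t)"]) (intro lin_rules)
  also have "\<dots> = (\<Sum>p q\<in>D h. \<Sum>x y\<in>D a. \<Sum>u u'\<in>D p. \<Sum>r t\<in>D q. f (u * x * S u') (r * y * S t))"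
    unfolding tsum_commute[where u = "D a"] ..
  also have "\<dots> = (\<Sum>p q\<in>D h. \<Sum>x y\<in>D a. f (Ad p x) (Ad q y))"
    unfolding j ..
  finally show ?thesis .
qed

lemma S_Ad: "S (Ad h a) = Ad h (S a)"
proof -
  have "S (Ad h a) = (\<Sum>p q\<in>D h. q * S a * S p)"
    unfolding adj_def lin_tsum_apply[OF S_lin] by (simp add: S_mult S_S mult.assoc)
  also have "\<dots> = Ad h (S a)"
    unfolding adj_def by (rule cocomm[of sH]) (intro lin_rules)
  finally show ?thesis .
qed

lemma et_S: "et (S h) = es h"
proof -
  have "et (S h) = (\<Sum>a b\<in>D h. S a * S (S b))"
    unfolding id_S[symmetric] by (rule S_comult[of sH]) (intro lin_rules)
  then show ?thesis by (simp add: S_S S_id)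
qed

text \<open>Under eps_t the factor S(h_2) can be replaced by eps_t(S(h_2)) = eps_s(h_2), which
  passes \<open>a\<close> and is absorbed by h_1.\<close>

lemma et_Ad: assumes a: "a \<in> C" shows "et (Ad h a) = et (h * a)"
proof -
  have "et (Ad h a) = (\<Sum>p q\<in>D h. et (p * a * et (S q)))"
    unfolding adj_def lin_tsum_apply[OF et_lin] et_mult_et ..
  also have "\<dots> = (\<Sum>p q\<in>D h. et (p * es q * a))"
    by (simp add: et_S mult.assoc C_comm[OF a es_in_K])
  also have "\<dots> = et (h * a)"
    by (simp add: lin_tsum_apply[OF et_lin, symmetric] tsum_times_right[symmetric] mult_es)
  finally show ?thesis .
qed

lemma es_C: assumes a: "a \<in> C" shows "es a = et a"
  unfolding es_alt epst_def by (rule E_K[of sH]) ((intro lin_rules)+, simp add: C_comm[OF a], intro lin_rules)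

text \<open>The legs of Delta(a) need not lie in \<open>C\<close>, but Ad maps into
  \<open>C\<close>. Letting the legs of Delta(1) act supplies centralizing representatives without
  changing the tensor.\<close>

lemma comult_C:
  assumes f: "bil sc f" and a: "a \<in> C"
  shows "tsum f (D a) = (\<Sum>p q\<in>D 1. \<Sum>x y\<in>D a. f (Ad p x) (Ad q y))"
  using D_Ad[OF f, of 1 a] by (simp add: Ad_1 a)

end

section \<open>Elements of tensor powers placed in numbered legs\<close>

text \<open>A word assigns a factor to every leg, so a list of words with almost all factors 1 is a formal sum
  of pure tensors in which the legs are addressed by number.\<close>

definition ev :: "((nat \<Rightarrow> 'h) \<Rightarrow> 'u::ab_group_add) \<Rightarrow> (nat \<Rightarrow> 'h) list \<Rightarrow> 'u" where
  "ev G t = (\<Sum>w\<leftarrow>t. G w)"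

definition wmul :: "(nat \<Rightarrow> 'h::times) list \<Rightarrow> (nat \<Rightarrow> 'h) list \<Rightarrow> (nat \<Rightarrow> 'h) list" where
  "wmul t u = [\<lambda>i. w i * w' i. w \<leftarrow> t, w' \<leftarrow> u]"

definition legs2 :: "nat \<Rightarrow> nat \<Rightarrow> ('h::one \<times> 'h) list \<Rightarrow> (nat \<Rightarrow> 'h) list" where
  "legs2 i j t = [(\<lambda>_. 1)(i := a, j := b). (a, b) \<leftarrow> t]"

definition legs3 :: "nat \<Rightarrow> nat \<Rightarrow> nat \<Rightarrow> ('h::one \<times> 'h \<times> 'h) list \<Rightarrow> (nat \<Rightarrow> 'h) list" where
  "legs3 i j k t = [(\<lambda>_. 1)(i := a, j := b, k := c). (a, b, c) \<leftarrow> t]"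

lemma ev_Nil [simp]: "ev G [] = 0" and ev_Cons [simp]: "ev G (w # t) = G w + ev G t"
  and ev_append [simp]: "ev G (t @ u) = ev G t + ev G u"
  by (simp_all add: ev_def)

lemma ev_map: "ev G (map g t) = ev (\<lambda>w. G (g w)) t"
  by (induction t) auto

lemma ev_wmul: "ev G (wmul t u) = ev (\<lambda>w. ev (\<lambda>w'. G (\<lambda>i. w i * w' i)) u) t"
  unfolding wmul_def by (induction t) (auto simp: ev_map)

lemma ev_legs2: "ev G (legs2 i j t) = (\<Sum>a b\<in>t. G ((\<lambda>_. 1)(i := a, j := b)))"
  unfolding legs2_def by (induction t) (simp_all add: case_prod_beta del: fun_upd_apply)

lemma ev_legs3: "ev G (legs3 i j k t) = tsum3 (\<lambda>a b c. G ((\<lambda>_. 1)(i := a, j := b, k := c))) t"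
  unfolding legs3_def by (induction t) (simp_all add: case_prod_beta del: fun_upd_apply)

lemma wmul_assoc: "wmul (wmul t u) v = wmul t (wmul u (v :: (nat \<Rightarrow> 'h::semigroup_mult) list))"
proof -
  have "wmul (map f u) v = map (\<lambda>w i. x i * w i) (wmul u v)" if "f = (\<lambda>w i. x i * w i)" for f x and u :: "(nat \<Rightarrow> 'h) list"
    unfolding wmul_def that by (simp add: map_concat comp_def mult.assoc)
  then show ?thesis
    by (induction t) (simp_all add: wmul_def)
qed

lemma wmul_legs2:
  "i \<noteq> j \<Longrightarrow> wmul (legs2 i j t) (legs2 i j u) = legs2 i j (tmul t (u :: ('h::monoid_mult \<times> 'h) list))"
  unfolding wmul_def legs2_def tmul_def
  by (auto simp: map_concat comp_def case_prod_beta fun_eq_iff intro!: arg_cong[where f = concat])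

lemma wmul_legs3:
  "i \<noteq> j \<Longrightarrow> j \<noteq> k \<Longrightarrow> i \<noteq> k \<Longrightarrow>
    wmul (legs3 i j k t) (legs3 i j k u) = legs3 i j k (tmul3 t (u :: ('h::monoid_mult \<times> 'h \<times> 'h) list))"
  unfolding wmul_def legs3_def tmul3_def
  by (auto simp: map_concat comp_def case_prod_beta fun_eq_iff intro!: arg_cong[where f = concat])

definition mlin where
  "mlin s sc I G \<longleftrightarrow> (\<forall>i\<in>I. \<forall>w. lin s sc (\<lambda>x. G (w(i := x))))"

text \<open>A name of its own keeps the leg identities out of the existing instances of \<^locale>\<open>semigroup\<close>.\<close>
locale leg_semigroup = semigroup

context cocomm_groupoid begin

text \<open>Equality for any number of legs is tested directly by scalar forms, linear in each leg
  of \<open>I\<close>; for two and three legs it follows from \<open>teq2\<close> and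
  \<open>teq3\<close>.\<close>

definition weq :: "nat set \<Rightarrow> (nat \<Rightarrow> 'h) list \<Rightarrow> (nat \<Rightarrow> 'h) list \<Rightarrow> bool" where
  "weq I t u \<longleftrightarrow> (\<forall>G. mlin sH ((*) :: 'k \<Rightarrow> _) I G \<longrightarrow> ev G t = ev G u)"

definition cls :: "nat set \<Rightarrow> (nat \<Rightarrow> 'h) list \<Rightarrow> (nat \<Rightarrow> 'h) list set" where
  "cls I t = {u. weq I t u}"

text \<open>The product is defined on arbitrary sets of lists, not only on classes, so that it is
  associative on the whole type, as the semigroup locale demands. Tensor identities become genuine
  equations between classes.\<close>

definition cmul :: "nat set \<Rightarrow> (nat \<Rightarrow> 'h) list set \<Rightarrow> (nat \<Rightarrow> 'h) list set \<Rightarrow> (nat \<Rightarrow> 'h) list set" where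
  "cmul I X Y = {w. \<exists>x\<in>X. \<exists>y\<in>Y. weq I (wmul x y) w}"

lemma weqI: "(\<And>G. mlin sH ((*) :: 'k \<Rightarrow> _) I G \<Longrightarrow> ev G t = ev G u) \<Longrightarrow> weq I t u"
  unfolding weq_def by blast

lemma cls_eq: "cls I t = cls I u \<longleftrightarrow> weq I t u"
  unfolding cls_def weq_def by auto

text \<open>Only scalar forms occur in \<open>weq\<close>; functionals on the target space extend it
  to vector-valued ones.\<close>

lemma weq_ev:
  assumes "weq I t u" and G: "mlin sH sc I G" and sc: "vector_space sc"
  shows "ev G t = ev G u"
proof (rule eq_by_functionals[OF sc])
  fix g assume g: "lin sc (*) g"
  have "g (ev G t) = ev (\<lambda>w. g (G w)) t" for t
    by (induction t) (simp_all add: lin_zero[OF g] lin_add[OF g])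
  moreover have "mlin sH (*) I (\<lambda>w. g (G w))"
    using G unfolding mlin_def by (intro ballI allI lin_comp[OF _ g]) blast
  ultimately show "g (ev G t) = g (ev G u)" using assms(1) unfolding weq_def by metis
qed

lemma ev_lin:
  assumes "\<And>w. lin sH (*) (\<lambda>x. G x w)" shows "lin sH (*) (\<lambda>x. ev (\<lambda>w. (G x w :: 'k)) t)"
proof (rule linI[OF vs vector_space_field])
  show "ev (G (x + y)) t = ev (G x) t + ev (G y) t" for x y
    by (induction t) (simp_all add: lin_add[OF assms])
  show "ev (G (sH c x)) t = c * ev (G x) t" for c x
    by (induction t) (simp_all add: lin_scale[OF assms] algebra_simps)
qed

lemma mlin_times:
  assumes "mlin sH sc I G"
  shows "mlin sH sc I (\<lambda>w. G (\<lambda>i. w i * w' i))" "mlin sH sc I (\<lambda>w. G (\<lambda>i. w' i * w i))"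
proof -
  have "lin sH sc (\<lambda>x. G (\<lambda>j. (w(i := x)) j * w' j))" "lin sH sc (\<lambda>x. G (\<lambda>j. w' j * (w(i := x)) j))"
    if "i \<in> I" for i w
  proof -
    have "(\<lambda>j. (w(i := x)) j * w' j) = (\<lambda>j. w j * w' j)(i := x * w' i)"
      "(\<lambda>j. w' j * (w(i := x)) j) = (\<lambda>j. w' j * w j)(i := w' i * x)" for x by auto
    moreover have *: "lin sH sc (\<lambda>x. G (u(i := x)))" for u using assms that unfolding mlin_def by blast
    moreover have "lin sH sH (\<lambda>x. x * w' i)" "lin sH sH (\<lambda>x. w' i * x)" by (intro lin_rules)+
    ultimately show "lin sH sc (\<lambda>x. G (\<lambda>j. (w(i := x)) j * w' j))" "lin sH sc (\<lambda>x. G (\<lambda>j. w' j * (w(i := x)) j))"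
      using lin_comp[OF _ *] by simp_all
  qed
  then show "mlin sH sc I (\<lambda>w. G (\<lambda>i. w i * w' i))" "mlin sH sc I (\<lambda>w. G (\<lambda>i. w' i * w i))"
    unfolding mlin_def by blast+
qed

lemma weq_wmul:
  assumes "weq I t t'" "weq I u u'" shows "weq I (wmul t u) (wmul t' u')"
proof (rule weqI)
  fix G :: "(nat \<Rightarrow> 'h) \<Rightarrow> 'k" assume G: "mlin sH (*) I G"
  have m: "mlin sH (*) I (\<lambda>w. ev (\<lambda>w'. G (\<lambda>i. w i * w' i)) u')"
    unfolding mlin_def using mlin_times(1)[OF G] by (auto simp: mlin_def intro!: ev_lin)
  have "ev G (wmul t u) = ev (\<lambda>w. ev (\<lambda>w'. G (\<lambda>i. w i * w' i)) u') t"
    unfolding ev_wmul using assms(2) mlin_times(2)[OF G] unfolding weq_def by simp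
  also have "\<dots> = ev G (wmul t' u')"
    unfolding ev_wmul using assms(1) m unfolding weq_def by simp
  finally show "ev G (wmul t u) = ev G (wmul t' u')" .
qed

lemma cmul_cls: "cmul I (cls I t) (cls I u) = cls I (wmul t u)"
proof -
  have "weq I (wmul t u) w" if "weq I t x" "weq I u y" "weq I (wmul x y) w" for x y w
    using weq_wmul[OF that(1,2)] that(3) unfolding weq_def by simp
  then show ?thesis unfolding cmul_def cls_def weq_def by fastforce
qed

lemma cmul_semigroup: "semigroup (cmul I)"
proof
  fix X Y Z
  have "cmul I (cmul I X Y) Z = {w. \<exists>x\<in>X. \<exists>y\<in>Y. \<exists>z\<in>Z. weq I (wmul (wmul x y) z) w}" (is "?L = ?R")
  proof
    show "?L \<subseteq> ?R"
    proof
      fix w assume "w \<in> ?L"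
      then obtain x y p z where h: "x \<in> X" "y \<in> Y" "z \<in> Z" "weq I (wmul x y) p" "weq I (wmul p z) w"
        unfolding cmul_def by blast
      have "weq I (wmul (wmul x y) z) w"
        using weq_wmul[OF h(4), of z z] h(5) unfolding weq_def by simp
      with h show "w \<in> ?R" by blast
    qed
    show "?R \<subseteq> ?L" unfolding cmul_def weq_def by blast
  qed
  moreover have "cmul I X (cmul I Y Z) = {w. \<exists>x\<in>X. \<exists>y\<in>Y. \<exists>z\<in>Z. weq I (wmul x (wmul y z)) w}" (is "?L = ?R")
  proof
    show "?L \<subseteq> ?R"
    proof
      fix w assume "w \<in> ?L"
      then obtain x y p z where h: "x \<in> X" "y \<in> Y" "z \<in> Z" "weq I (wmul y z) p" "weq I (wmul x p) w"
        unfolding cmul_def by blast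
      have "weq I (wmul x (wmul y z)) w"
        using weq_wmul[OF _ h(4), of x x] h(5) unfolding weq_def by simp
      with h show "w \<in> ?R" by blast
    qed
    show "?R \<subseteq> ?L" unfolding cmul_def weq_def by blast
  qed
  ultimately show "cmul I (cmul I X Y) Z = cmul I X (cmul I Y Z)" by (simp add: wmul_assoc)
qed

lemmas cmul_leg_semigroup = leg_semigroup.intro[OF cmul_semigroup]

lemma mlin_upd:
  assumes "mlin sH sc I G" "i \<in> I" "\<And>x. u x = w(i := x)"
  shows "lin sH sc (\<lambda>x. G (u x))"
  using assms unfolding mlin_def by simp

lemma mlin_legs2:
  assumes G: "mlin sH sc I G" and "i \<in> I" "j \<in> I" "i \<noteq> j"
  shows "bil sc (\<lambda>a b. G (w(i := a, j := b)))"
proof (rule bilI)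
  show "lin sH sc (\<lambda>x. G (w(i := x, j := b)))" for b
    by (rule mlin_upd[OF G \<open>i \<in> I\<close>, of _ "w(j := b)"]) (use \<open>i \<noteq> j\<close> in auto)
  show "lin sH sc (\<lambda>x. G (w(i := a, j := x)))" for a
    by (rule mlin_upd[OF G \<open>j \<in> I\<close>, of _ "w(i := a)"]) (rule HOL.refl)
qed

lemma mlin_legs3:
  assumes G: "mlin sH sc I G" and I: "i \<in> I" "j \<in> I" "k \<in> I" and ne: "i \<noteq> j" "j \<noteq> k" "i \<noteq> k"
  shows "tri sc (\<lambda>a b c. G (w(i := a, j := b, k := c)))"
proof (rule triI)
  show "lin sH sc (\<lambda>x. G (w(i := x, j := b, k := c)))" for b c
    by (rule mlin_upd[OF G I(1), of _ "w(j := b, k := c)"]) (use ne in auto)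
  show "lin sH sc (\<lambda>x. G (w(i := a, j := x, k := c)))" for a c
    by (rule mlin_upd[OF G I(2), of _ "w(i := a, k := c)"]) (use ne in auto)
  show "lin sH sc (\<lambda>x. G (w(i := a, j := b, k := x)))" for a b
    by (rule mlin_upd[OF G I(3), of _ "w(i := a, j := b)"]) (rule HOL.refl)
qed

lemma mlin_legs4:
  assumes G: "mlin sH sc I G" and I: "i \<in> I" "j \<in> I" "k \<in> I" "l \<in> I" and ne: "distinct [i, j, k, l]"
  shows "quad sc (\<lambda>a b c d. G (w(i := a, j := b, k := c, l := d)))"
proof (rule quadI)
  show "lin sH sc (\<lambda>x. G (w(i := x, j := b, k := c, l := d)))" for b c d
    by (rule mlin_upd[OF G I(1), of _ "w(j := b, k := c, l := d)"]) (use ne in auto)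
  show "lin sH sc (\<lambda>x. G (w(i := a, j := x, k := c, l := d)))" for a c d
    by (rule mlin_upd[OF G I(2), of _ "w(i := a, k := c, l := d)"]) (use ne in auto)
  show "lin sH sc (\<lambda>x. G (w(i := a, j := b, k := x, l := d)))" for a b d
    by (rule mlin_upd[OF G I(3), of _ "w(i := a, j := b, l := d)"]) (use ne in auto)
  show "lin sH sc (\<lambda>x. G (w(i := a, j := b, k := c, l := x)))" for a b c
    by (rule mlin_upd[OF G I(4), of _ "w(i := a, j := b, k := c)"]) (rule HOL.refl)
qed

lemma mlin3:
  assumes "tri sc g" shows "mlin sH sc {0, 1, 2} (\<lambda>w. g (w 0) (w 1) (w (2 :: nat)))"
  using assms unfolding mlin_def trilinear_map_def by auto

lemma mlin4:
  assumes "quad sc g" shows "mlin sH sc {0, 1, 2, 3} (\<lambda>w. g (w 0) (w 1) (w 2) (w (3 :: nat)))"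
  using assms unfolding mlin_def quadrilinear_map_def by auto

lemmas ev_simps = ev_wmul ev_legs2 ev_legs3 tsum3_map_left tsum3_map_right

lemma weq_legs2:
  assumes "teq2 sH t u" "i \<in> I" "j \<in> I" "i \<noteq> j"
  shows "weq I (legs2 i j t) (legs2 i j u)"
  by (rule weqI, unfold ev_legs2, rule teq2_tsum[OF assms(1)], rule mlin_legs2) (use assms in auto)

lemma weq_legs3:
  assumes "teq3 sH t u" "i \<in> I" "j \<in> I" "k \<in> I" "i \<noteq> j" "j \<noteq> k" "i \<noteq> k"
  shows "weq I (legs3 i j k t) (legs3 i j k u)"
  by (rule weqI, unfold ev_legs3, rule teq3_tsum3[OF assms(1)], rule mlin_legs3) (use assms in auto)

lemma teq3_map_left_tmul: "teq3 sH (map_left D (tmul t u)) (tmul3 (map_left D t) (map_left D u))"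
proof (rule teq3I[OF vs])
  fix f assume f: "tri ((*) :: 'k \<Rightarrow> _) f"
  note [lin_rules] = tri_rules[OF f]
  have "(\<Sum>a b\<in>D (x * y). f a b z) = (\<Sum>a b\<in>D x. \<Sum>c d\<in>D y. f (a * c) (b * d) z)" for x y z
    by (rule D_mult[of "(*)"]) (intro lin_rules)
  then show "tsum3 f (map_left D (tmul t u)) = tsum3 f (tmul3 (map_left D t) (map_left D u))"
    by (simp add: tsum3_map_left tsum3_tmul3 tsum_tmul tsum_commute[where t = u])
qed

lemma teq3_map_right_tmul: "teq3 sH (map_right D (tmul t u)) (tmul3 (map_right D t) (map_right D u))"
proof (rule teq3I[OF vs])
  fix f assume f: "tri ((*) :: 'k \<Rightarrow> _) f"
  note [lin_rules] = tri_rules[OF f]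
  have "(\<Sum>a b\<in>D (x * y). f z a b) = (\<Sum>a b\<in>D x. \<Sum>c d\<in>D y. f z (a * c) (b * d))" for x y z
    by (rule D_mult[of "(*)"]) (intro lin_rules)
  then show "tsum3 f (map_right D (tmul t u)) = tsum3 f (tmul3 (map_right D t) (map_right D u))"
    by (simp add: tsum3_map_right tsum3_tmul3 tsum_tmul tsum_commute[where t = u])
qed

lemma teq3_map_cong:
  assumes "teq2 sH t u"
  shows "teq3 sH (map_left D t) (map_left D u)" "teq3 sH (map_right D t) (map_right D u)"
proof -
  show "teq3 sH (map_left D t) (map_left D u)"
  proof (rule teq3I[OF vs])
    fix f assume f: "tri ((*) :: 'k \<Rightarrow> _) f"
    note [lin_rules] = tri_rules[OF f]
    show "tsum3 f (map_left D t) = tsum3 f (map_left D u)"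
      unfolding tsum3_map_left by (rule teq2_tsum[OF assms, of "(*)"]) (intro lin_rules)
  qed
  show "teq3 sH (map_right D t) (map_right D u)"
  proof (rule teq3I[OF vs])
    fix f assume f: "tri ((*) :: 'k \<Rightarrow> _) f"
    note [lin_rules] = tri_rules[OF f]
    show "tsum3 f (map_right D t) = tsum3 f (map_right D u)"
      unfolding tsum3_map_right by (rule teq2_tsum[OF assms, of "(*)"]) (intro lin_rules)
  qed
qed

section \<open>Two-tensors balanced over the base algebra\<close>

text \<open>Collects what \<open>F\<close>, its inverse and Delta(1) have in common: a base element
  may stand left or right of either leg with the same effect, Delta(1) is absorbed on both sides,
  and the counit gives 1 in each leg.\<close>

definition K_balanced :: "('h \<times> 'h) list \<Rightarrow> bool" where
  "K_balanced X \<longleftrightarrow>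
     (\<forall>z\<in>K. teq2 sH (tmul [(z, 1)] X) (tmul [(1, z)] X) \<and> teq2 sH (tmul [(z, 1)] X) (tmul X [(z, 1)]) \<and>
       teq2 sH (tmul [(z, 1)] X) (tmul X [(1, z)])) \<and>
     teq2 sH (tmul (D 1) X) X \<and> teq2 sH (tmul X (D 1)) X \<and>
     (\<Sum>a b\<in>X. sH (cu a) b) = 1 \<and> (\<Sum>a b\<in>X. sH (cu b) a) = 1"

context
  fixes X assumes X: "K_balanced X"
begin

lemma balanced_counit: "(\<Sum>a b\<in>X. sH (cu a) b) = 1" "(\<Sum>a b\<in>X. sH (cu b) a) = 1"
  using X unfolding K_balanced_def by auto

lemma balanced_K:
  assumes f: "bil sc f" and z: "z \<in> K"
  shows "(\<Sum>a b\<in>X. f a (z * b)) = (\<Sum>a b\<in>X. f (z * a) b)"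
    and "(\<Sum>a b\<in>X. f (a * z) b) = (\<Sum>a b\<in>X. f (z * a) b)"
    and "(\<Sum>a b\<in>X. f a (b * z)) = (\<Sum>a b\<in>X. f (z * a) b)"
proof -
  have "teq2 sH (tmul [(z, 1)] X) (tmul [(1, z)] X)" "teq2 sH (tmul [(z, 1)] X) (tmul X [(z, 1)])"
       "teq2 sH (tmul [(z, 1)] X) (tmul X [(1, z)])"
    using X z unfolding K_balanced_def by auto
  from this[THEN teq2_tsum, OF f]
  show "(\<Sum>a b\<in>X. f a (z * b)) = (\<Sum>a b\<in>X. f (z * a) b)"
    "(\<Sum>a b\<in>X. f (a * z) b) = (\<Sum>a b\<in>X. f (z * a) b)"
    "(\<Sum>a b\<in>X. f a (b * z)) = (\<Sum>a b\<in>X. f (z * a) b)"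
    by (simp_all add: tsum_tmul)
qed

lemma balanced_E:
  assumes f: "bil sc f"
  shows "(\<Sum>x y\<in>D 1. \<Sum>a b\<in>X. f (x * a) (y * b)) = tsum f X"
    and "(\<Sum>a b\<in>X. \<Sum>x y\<in>D 1. f (a * x) (b * y)) = tsum f X"
proof -
  have "teq2 sH (tmul (D 1) X) X" "teq2 sH (tmul X (D 1)) X"
    using X unfolding K_balanced_def by auto
  from this[THEN teq2_tsum, OF f]
  show "(\<Sum>x y\<in>D 1. \<Sum>a b\<in>X. f (x * a) (y * b)) = tsum f X"
    "(\<Sum>a b\<in>X. \<Sum>x y\<in>D 1. f (a * x) (b * y)) = tsum f X"
    by (simp_all add: tsum_tmul)
qed

text \<open>In eps_t(b) = eps(1_1 b) 1_2 the factor 1_1 lies in \<open>K\<close> and moves over to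
  the other leg of \<open>X\<close>; the counit of \<open>b\<close> then removes \<open>X\<close>
  and leaves 1_1 \<otimes> 1_2. This collapse to Delta(1) rests on the unit normalisation and recurs
  throughout.\<close>

lemma balanced_et:
  assumes f: "bil sc f"
  shows "(\<Sum>a b\<in>X. f a (et b)) = tsum f (D 1)"
    and "(\<Sum>a b\<in>X. f (et a) b) = tsum f (D 1)"
    and "(\<Sum>a b\<in>X. f a (es b)) = tsum f (D 1)"
    and "(\<Sum>a b\<in>X. f (es a) b) = tsum f (D 1)"
proof -
  note [lin_rules] = bil_rules[OF f]
  have e: "f a (et b) = (\<Sum>x y\<in>D 1. f a (sH (cu (x * b)) y))"
    "f a (es b) = (\<Sum>x y\<in>D 1. f a (sH (cu (b * x)) y))" for a b
    unfolding epst_def es_alt by (rule lin_tsum_apply[of sH sc "f a"], intro lin_rules)+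
  have e': "f (et b) a = (\<Sum>x y\<in>D 1. f (sH (cu (x * b)) y) a)"
    "f (es b) a = (\<Sum>x y\<in>D 1. f (sH (cu (b * x)) y) a)" for a b
    unfolding epst_def es_alt by (rule lin_tsum_apply[of sH sc "\<lambda>x. f x a"], intro lin_rules)+
  have g: "bil sc (\<lambda>a b. f a (sH (cu b) y))" "bil sc (\<lambda>a b. f (sH (cu a) y) b)" for y
    by (intro lin_rules)+
  have n: "(\<Sum>a b\<in>X. f (x * a) (sH (cu b) y)) = f x y" for x y
  proof -
    have "(\<Sum>a b\<in>X. f (x * a) (sH (cu b) y)) = (\<Sum>a b\<in>X. f (x * sH (cu b) a) y)"
      by (simp add: scale_shift[OF f] mult_scale)
    also have "\<dots> = f (\<Sum>a b\<in>X. x * sH (cu b) a) y"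
      by (rule lin_tsum_apply[of sH sc "\<lambda>x. f x y", symmetric]) (intro lin_rules)
    finally show ?thesis by (simp add: tsum_times_left[symmetric] balanced_counit)
  qed
  have n': "(\<Sum>a b\<in>X. f (sH (cu a) y) (x * b)) = f y x" for x y
  proof -
    have "(\<Sum>a b\<in>X. f (sH (cu a) y) (x * b)) = (\<Sum>a b\<in>X. f y (x * sH (cu a) b))"
      by (simp add: scale_shift[OF f, symmetric] mult_scale)
    also have "\<dots> = f y (\<Sum>a b\<in>X. x * sH (cu a) b)"
      by (rule lin_tsum_apply[of sH sc "f y", symmetric]) (intro lin_rules)
    finally show ?thesis by (simp add: tsum_times_left[symmetric] balanced_counit)
  qed
  have "(\<Sum>x y\<in>D 1. \<Sum>a b\<in>X. f a (sH (cu (x * b)) y)) = tsum f (D 1)"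
    by (rule E_K[OF _ _ f]) ((intro lin_rules)+, simp add: balanced_K(1)[OF g(1)] n)
  then show "(\<Sum>a b\<in>X. f a (et b)) = tsum f (D 1)"
    unfolding e by (subst tsum_commute)
  have "(\<Sum>x y\<in>D 1. \<Sum>a b\<in>X. f a (sH (cu (b * x)) y)) = tsum f (D 1)"
    by (rule E_K[OF _ _ f]) ((intro lin_rules)+, simp add: balanced_K(3)[OF g(1)] n)
  then show "(\<Sum>a b\<in>X. f a (es b)) = tsum f (D 1)"
    unfolding e by (subst tsum_commute)
  have "(\<Sum>x y\<in>D 1. \<Sum>a b\<in>X. f (sH (cu (x * a)) y) b) = (\<Sum>x y\<in>D 1. f y x)"
    by (rule E_K[of sc]) ((intro lin_rules)+, simp add: balanced_K(1)[OF g(2), symmetric] n', intro lin_rules)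
  also have "\<dots> = tsum f (D 1)" by (rule cocomm[OF f, symmetric])
  finally show "(\<Sum>a b\<in>X. f (et a) b) = tsum f (D 1)"
    unfolding e' by (subst tsum_commute)
  have "(\<Sum>x y\<in>D 1. \<Sum>a b\<in>X. f (sH (cu (a * x)) y) b) = (\<Sum>x y\<in>D 1. f y x)"
    by (rule E_K[of sc]) ((intro lin_rules)+, simp add: balanced_K(2)[OF g(2)] balanced_K(1)[OF g(2), symmetric] n', intro lin_rules)
  also have "\<dots> = tsum f (D 1)" by (rule cocomm[OF f, symmetric])
  finally show "(\<Sum>a b\<in>X. f (es a) b) = tsum f (D 1)"
    unfolding e' by (subst tsum_commute)
qed

end

end

section \<open>Consequences of the cocycle identity for elements invertible up to
  idempotents\<close>

text \<open>In the intended instance \<open>f12\<close>, \<open>f23\<close> are the cocycle placed in two legs, \<open>x\<close> and \<open>y\<close> its images under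
  \<open>\<Delta> \<otimes> id\<close> and \<open>id \<otimes> \<Delta>\<close>, the elements \<open>g\<close> and \<open>xi\<close>, \<open>yi\<close> come from the inverse, and \<open>e12\<close>, \<open>e23\<close> from \<open>\<Delta>(1)\<close>.\<close>
locale cocycle_semigroup = leg_semigroup +
  fixes f12 g12 e12 f23 g23 e23 x xi y yi :: 'a
  assumes coc: "x \<^bold>* f12 = y \<^bold>* f23"
    and fg: "f12 \<^bold>* g12 = e12" "f23 \<^bold>* g23 = e23" "g23 \<^bold>* f23 = e23"
    and xe: "x \<^bold>* e12 = x" "y \<^bold>* e23 = y"
    and xx: "xi \<^bold>* x = e12 \<^bold>* e23" "x \<^bold>* xi = e12 \<^bold>* e23" "yi \<^bold>* y = e12 \<^bold>* e23"
    and u: "yi \<^bold>* (e12 \<^bold>* e23) = yi" "e12 \<^bold>* e23 \<^bold>* xi = xi"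
    and e: "e12 \<^bold>* f12 = f12" "e12 \<^bold>* g12 = g12" "e23 \<^bold>* g23 = g23" "e23 \<^bold>* f23 = f23" "e23 \<^bold>* e23 = e23" "e12 \<^bold>* e12 = e12"
    and c: "e23 \<^bold>* f12 = f12 \<^bold>* e23" "e23 \<^bold>* g12 = g12 \<^bold>* e23" "e12 \<^bold>* f23 = f23 \<^bold>* e12" "e12 \<^bold>* g23 = g23 \<^bold>* e12"
      "e12 \<^bold>* e23 = e23 \<^bold>* e12"
begin

text \<open>Inserting \<open>f23\<close> and \<open>g23\<close> behind \<open>y\<close>, which
  absorbs their product, makes the cocycle identity applicable; the idempotents left over are
  absorbed by the outer factors.\<close>

lemma f12_g23: "f12 \<^bold>* g23 = xi \<^bold>* y"
proof -
  have "xi \<^bold>* y = xi \<^bold>* (y \<^bold>* (f23 \<^bold>* g23))" by (simp add: fg xe)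
  also have "\<dots> = xi \<^bold>* (x \<^bold>* f12) \<^bold>* g23" by (simp add: assoc coc)
  also have "\<dots> = e12 \<^bold>* e23 \<^bold>* f12 \<^bold>* g23" by (simp add: xx(1)[symmetric] assoc)
  also have "\<dots> = (e12 \<^bold>* f12) \<^bold>* (e23 \<^bold>* g23)" by (metis assoc c(1))
  finally show ?thesis by (simp add: e)
qed

lemma f23_g12: "f23 \<^bold>* g12 = yi \<^bold>* x"
proof -
  have "yi \<^bold>* x = yi \<^bold>* (x \<^bold>* (f12 \<^bold>* g12))" by (simp add: fg xe)
  also have "\<dots> = yi \<^bold>* (x \<^bold>* f12) \<^bold>* g12" by (simp add: assoc)
  also have "\<dots> = yi \<^bold>* y \<^bold>* f23 \<^bold>* g12" by (simp add: assoc coc)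
  also have "\<dots> = (e12 \<^bold>* (e23 \<^bold>* f23)) \<^bold>* g12" by (simp add: xx assoc)
  also have "\<dots> = f23 \<^bold>* (e12 \<^bold>* g12)" unfolding e(4) by (simp only: c(3) assoc)
  finally show ?thesis by (simp add: e)
qed

lemma x_eq: "x = y \<^bold>* f23 \<^bold>* g12"
  by (metis assoc coc fg(1) xe(1))

text \<open>Inverses exist only up to \<open>e12\<close> and \<open>e23\<close>, so inverting both
  sides of the cocycle identity is not a formal step: \<open>x\<close> times its inverse is
  inserted, and every idempotent that arises is commuted to a factor absorbing it.\<close>

lemma inverse_cocycle: "g12 \<^bold>* xi = g23 \<^bold>* yi"
proof -
  have "g23 \<^bold>* yi = g23 \<^bold>* (yi \<^bold>* (x \<^bold>* xi))" by (simp add: xx u)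
  also have "\<dots> = g23 \<^bold>* (yi \<^bold>* (x \<^bold>* f12 \<^bold>* g12) \<^bold>* xi)" by (simp add: assoc fg) (simp add: assoc[symmetric] xe)
  also have "\<dots> = g23 \<^bold>* (yi \<^bold>* y) \<^bold>* f23 \<^bold>* g12 \<^bold>* xi" by (metis assoc coc)
  also have "\<dots> = g23 \<^bold>* (e12 \<^bold>* (e23 \<^bold>* f23)) \<^bold>* g12 \<^bold>* xi" by (simp add: xx assoc)
  also have "\<dots> = (e12 \<^bold>* (g23 \<^bold>* f23)) \<^bold>* g12 \<^bold>* xi" by (metis assoc c(4) e(4))
  also have "\<dots> = e12 \<^bold>* g12 \<^bold>* (e23 \<^bold>* xi)" by (simp add: fg) (metis assoc c(2))
  also have "e23 \<^bold>* xi = xi" by (metis assoc c(5) e(5) u(2))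
  finally show ?thesis by (simp add: e)
qed

end

text \<open>The elements \<open>q\<close> and \<open>q'\<close> are \<open>(\<Delta> \<otimes> \<Delta>)(F)\<close> with the four legs grouped as \<open>AB, CD\<close> and \<open>AC, BD\<close>.
  By cocommutativity the leg order of \<open>B\<close> and \<open>C\<close> is invisible in \<open>m\<close> and \<open>n\<close>, so both iterated cocycles are the
  same element times \<open>fBC\<close> and \<open>fCB\<close>, respectively.\<close>
lemma (in leg_semigroup) cocycle_exchange:
  assumes r1: "n1 \<^bold>* fAB = n \<^bold>* fBC" and r2: "n2 \<^bold>* fAC = n \<^bold>* fCB"
    and r3: "m \<^bold>* n1 = q \<^bold>* fCD \<^bold>* eAB" and r4: "m \<^bold>* n2 = q' \<^bold>* fBD \<^bold>* eAC"
    and n: "n \<^bold>* eBC = n" "fBC \<^bold>* gBC = eBC" and e: "eAB \<^bold>* fAB = fAB" "eAC \<^bold>* fAC = fAC"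
  shows "q' \<^bold>* fBD \<^bold>* fAC = q \<^bold>* fCD \<^bold>* fAB \<^bold>* gBC \<^bold>* fCB"
proof -
  have "q' \<^bold>* fBD \<^bold>* fAC = m \<^bold>* (n2 \<^bold>* fAC)"
    by (metis assoc r4 e(2))
  also have "\<dots> = m \<^bold>* (n1 \<^bold>* fAB) \<^bold>* gBC \<^bold>* fCB"
    by (metis assoc r1 r2 n)
  also have "m \<^bold>* (n1 \<^bold>* fAB) = q \<^bold>* fCD \<^bold>* fAB"
    by (metis assoc r3 e(1))
  finally show ?thesis .
qed

text \<open>The first hypothesis is the conclusion of \<open>cocycle_exchange\<close> with B and C
  interchanged. Multiplication by \<open>qi\<close> removes \<open>q'\<close> up to three
  idempotents, each absorbed by a factor with the same legs.\<close>

lemma (in leg_semigroup) cocycle_exchange_inverse: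
  assumes "q \<^bold>* fCD \<^bold>* fAB = q' \<^bold>* fBD \<^bold>* fAC \<^bold>* gCB \<^bold>* fBC"
    and "qi \<^bold>* q' = eAC \<^bold>* eCB \<^bold>* eBD"
    and "eBD \<^bold>* fBD = fBD" "eCB \<^bold>* gCB = gCB" "eAC \<^bold>* fAC = fAC"
    and "eCB \<^bold>* fBD = fBD \<^bold>* eCB" "eCB \<^bold>* fAC = fAC \<^bold>* eCB" "eAC \<^bold>* fBD = fBD \<^bold>* eAC"
  shows "qi \<^bold>* q \<^bold>* fCD \<^bold>* fAB = fBD \<^bold>* fAC \<^bold>* gCB \<^bold>* fBC"
proof -
  have "qi \<^bold>* q \<^bold>* fCD \<^bold>* fAB = qi \<^bold>* q' \<^bold>* fBD \<^bold>* fAC \<^bold>* gCB \<^bold>* fBC"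
    by (metis assoc assms(1))
  also have "\<dots> = eAC \<^bold>* eCB \<^bold>* fBD \<^bold>* fAC \<^bold>* gCB \<^bold>* fBC"
    by (metis assoc assms(2,3))
  also have "\<dots> = eAC \<^bold>* fBD \<^bold>* fAC \<^bold>* (eCB \<^bold>* gCB) \<^bold>* fBC"
    by (metis assoc assms(6,7))
  also have "\<dots> = fBD \<^bold>* fAC \<^bold>* gCB \<^bold>* fBC"
    by (metis assoc assms(4,5,8))
  finally show ?thesis .
qed

definition legs4 :: "nat \<Rightarrow> nat \<Rightarrow> nat \<Rightarrow> nat \<Rightarrow> ('h \<Rightarrow> ('h \<times> 'h) list) \<Rightarrow> ('h::one \<times> 'h) list \<Rightarrow> (nat \<Rightarrow> 'h) list" where
  "legs4 i j k l D t = [(\<lambda>_. 1)(i := a, j := b, k := c, l := d). (x, y) \<leftarrow> t, (a, b) \<leftarrow> D x, (c, d) \<leftarrow> D y]"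

text \<open>Delta iterated on the first factor, the second one kept as last leg: this is the element
  \<open>m\<close> of \<open>cocycle_exchange\<close>.\<close>

definition legs31 :: "nat \<Rightarrow> nat \<Rightarrow> nat \<Rightarrow> nat \<Rightarrow> ('h \<Rightarrow> ('h \<times> 'h) list) \<Rightarrow> ('h::one \<times> 'h) list \<Rightarrow> (nat \<Rightarrow> 'h) list" where
  "legs31 i j k l D t = [(\<lambda>_. 1)(i := a, j := b, k := c, l := y). (x, y) \<leftarrow> t, (p, c) \<leftarrow> D x, (a, b) \<leftarrow> D p]"

lemma ev_concat_map: "ev G (concat (map g t)) = (\<Sum>x y\<in>t. ev G (g (x, y)))"
  by (induction t) auto

lemma ev_map_pairs: "ev G (map g t) = (\<Sum>x y\<in>t. G (g (x, y)))"
  by (induction t) auto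

lemma ev_legs4: "ev G (legs4 i j k l D t) =
    (\<Sum>x y\<in>t. \<Sum>a b\<in>D x. \<Sum>c d\<in>D y. G ((\<lambda>_. 1)(i := a, j := b, k := c, l := d)))"
  unfolding legs4_def by (simp add: ev_concat_map ev_map_pairs case_prod_beta del: fun_upd_apply)

lemma ev_legs31: "ev G (legs31 i j k l D t) =
    (\<Sum>x y\<in>t. \<Sum>p c\<in>D x. \<Sum>a b\<in>D p. G ((\<lambda>_. 1)(i := a, j := b, k := c, l := y)))"
  unfolding legs31_def by (simp add: ev_concat_map ev_map_pairs case_prod_beta del: fun_upd_apply)

section \<open>Leg placement of balanced tensors and of their comultiplications\<close>

context cocomm_groupoid begin

lemma mlin_ev:
  assumes "mlin sH ((*) :: 'k \<Rightarrow> _) I G"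
  shows "mlin sH (*) I (\<lambda>w. ev (\<lambda>w'. G (\<lambda>i. w i * w' i)) u)" "mlin sH (*) I (\<lambda>w. ev (\<lambda>w'. G (\<lambda>i. w' i * w i)) u)"
  unfolding mlin_def using mlin_times[OF assms] by (auto simp: mlin_def intro!: ev_lin)

lemma teq2_tmul:
  assumes "teq2 sH t t'" "teq2 sH u u'" shows "teq2 sH (tmul t u) (tmul t' u')"
proof (rule teq2I[OF vs])
  fix f assume f: "bil ((*) :: 'k \<Rightarrow> _) f"
  note [lin_rules] = bil_rules[OF f]
  have "(\<Sum>c d\<in>u. f (a * c) (b * d)) = (\<Sum>c d\<in>u'. f (a * c) (b * d))" for a b
    by (rule teq2_tsum[OF assms(2), of "(*)"]) (intro lin_rules)
  moreover have "(\<Sum>a b\<in>t. \<Sum>c d\<in>u'. f (a * c) (b * d)) = (\<Sum>a b\<in>t'. \<Sum>c d\<in>u'. f (a * c) (b * d))"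
    by (rule teq2_tsum[OF assms(1), of "(*)"]) (intro lin_rules)
  ultimately show "tsum f (tmul t u) = tsum f (tmul t' u')"
    by (simp add: tsum_tmul)
qed

lemma E_swap: "teq2 sH (tswap (D 1)) (D 1)"
  using cc teq2_sym unfolding cocommutative_def by blast

lemma E_E: "teq2 sH (tmul (D 1) (D 1)) (D 1)"
proof (rule teq2I[OF vs])
  fix f assume f: "bil ((*) :: 'k \<Rightarrow> _) f"
  show "tsum f (tmul (D 1) (D 1)) = tsum f (D 1)"
    unfolding tsum_tmul by (rule D_E_left[OF f, symmetric])
qed

lemma D_E_teq: "teq2 sH (tmul (D 1) (D h)) (D h)" "teq2 sH (tmul (D h) (D 1)) (D h)"
  by (rule teq2I[OF vs], unfold tsum_tmul, rule D_E_left[symmetric] D_E_right[symmetric], assumption)+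

lemma E_balanced: "K_balanced (D 1)"
proof -
  have "(\<Sum>a b\<in>D 1. f (z * a) b) = tsum f (D z)" "(\<Sum>a b\<in>D 1. f (a * z) b) = tsum f (D z)"
    "(\<Sum>a b\<in>D 1. f a (z * b)) = tsum f (D z)" "(\<Sum>a b\<in>D 1. f a (b * z)) = tsum f (D z)"
    if "bil ((*) :: 'k \<Rightarrow> _) f" "z \<in> K" for f z
    using D_K[OF that] by auto
  then show ?thesis
    unfolding K_balanced_def using E_E counit_left[of 1] counit_right[of 1]
    by (auto intro!: teq2I[OF vs] simp: tsum_tmul)
qed

lemma cls_legs2_mult:
  assumes "teq2 sH (tmul t u) v" "i \<in> I" "j \<in> I" "i \<noteq> j"
  shows "cmul I (cls I (legs2 i j t)) (cls I (legs2 i j u)) = cls I (legs2 i j v)"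
  unfolding cmul_cls cls_eq wmul_legs2[OF assms(4)] by (rule weq_legs2[OF assms])

lemma cls_legs3_mult:
  assumes "teq3 sH (tmul3 t u) v" "i \<in> I" "j \<in> I" "k \<in> I" "i \<noteq> j" "j \<noteq> k" "i \<noteq> k"
  shows "cmul I (cls I (legs3 i j k t)) (cls I (legs3 i j k u)) = cls I (legs3 i j k v)"
  unfolding cmul_cls cls_eq wmul_legs3[OF assms(5-7)] by (rule weq_legs3[OF assms])

text \<open>If leg \<open>i\<close> is one of \<open>k\<close>, \<open>l\<close>, this is
  balancedness; otherwise the factors occupy different legs.\<close>

lemma K_leg_commute:
  assumes X: "K_balanced X" and z: "z \<in> K" and I: "k \<in> I" "l \<in> I" "k \<noteq> l"
  shows "weq I (wmul [(\<lambda>_. 1)(i := z)] (legs2 k l X)) (wmul (legs2 k l X) [(\<lambda>_. 1)(i := z)])"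
proof (rule weqI)
  fix G :: "(nat \<Rightarrow> 'h) \<Rightarrow> 'k" assume G: "mlin sH (*) I G"
  note b = mlin_legs2[OF G I]
  have e: "(\<lambda>n. ((\<lambda>_. 1)(k := z)) n * ((\<lambda>_. 1)(k := a, l := b)) n) = (\<lambda>_. 1)(k := z * a, l := b)"
    "(\<lambda>n. ((\<lambda>_. 1)(k := a, l := b)) n * ((\<lambda>_. 1)(k := z)) n) = (\<lambda>_. 1)(k := a * z, l := b)"
    "(\<lambda>n. ((\<lambda>_. 1)(l := z)) n * ((\<lambda>_. 1)(k := a, l := b)) n) = (\<lambda>_. 1)(k := a, l := z * b)"
    "(\<lambda>n. ((\<lambda>_. 1)(k := a, l := b)) n * ((\<lambda>_. 1)(l := z)) n) = (\<lambda>_. 1)(k := a, l := b * z)" for a b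
    using I(3) by auto
  have e': "(\<lambda>n. ((\<lambda>_. 1)(i := z)) n * ((\<lambda>_. 1)(k := a, l := b)) n) = (\<lambda>n. ((\<lambda>_. 1)(k := a, l := b)) n * ((\<lambda>_. 1)(i := z)) n)"
    if "i \<noteq> k" "i \<noteq> l" for a b
    using that by (auto simp: fun_eq_iff)
  note bb = balanced_K[OF X b[of "\<lambda>_. 1"] z]
  show "ev G (wmul [(\<lambda>_. 1)(i := z)] (legs2 k l X)) = ev G (wmul (legs2 k l X) [(\<lambda>_. 1)(i := z)])"
  proof (cases "i = k \<or> i = l")
    case True
    then show ?thesis
    proof
      assume i: "i = k"
      show ?thesis using bb(2) unfolding ev_wmul ev_legs2 i by (simp add: e del: fun_upd_apply)
    next
      assume i: "i = l"
      show ?thesis using bb(1,3) unfolding ev_wmul ev_legs2 i by (simp add: e del: fun_upd_apply)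
    qed
  next
    case False
    then show ?thesis unfolding ev_wmul ev_legs2 by (simp add: e' del: fun_upd_apply)
  qed
qed

text \<open>\<open>E_K\<close> reduces the claim to single base elements in the legs
  \<open>i\<close> and \<open>j\<close>, whether or not these overlap with \<open>k\<close> and
  \<open>l\<close>.\<close>

lemma E_legs_commute:
  assumes X: "K_balanced X" and I: "i \<in> I" "j \<in> I" "i \<noteq> j" "k \<in> I" "l \<in> I" "k \<noteq> l"
  shows "cmul I (cls I (legs2 i j (D 1))) (cls I (legs2 k l X)) = cmul I (cls I (legs2 k l X)) (cls I (legs2 i j (D 1)))"
  unfolding cmul_cls cls_eq
proof (rule weqI)
  fix G :: "(nat \<Rightarrow> 'h) \<Rightarrow> 'k" assume G: "mlin sH (*) I G"
  have z: "weq I (wmul [(\<lambda>_. 1)(i := x, j := y)] (legs2 k l X)) (wmul (legs2 k l X) [(\<lambda>_. 1)(i := x, j := y)])"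
    if "x \<in> K" "y \<in> K" for x y
  proof -
    have w: "[(\<lambda>_. 1)(i := x, j := y)] = wmul [(\<lambda>_. 1)(i := x)] [(\<lambda>_. 1)(j := y)]"
      using I by (auto simp: wmul_def)
    have "weq I (wmul [(\<lambda>_. 1)(i := x)] (wmul [(\<lambda>_. 1)(j := y)] (legs2 k l X)))
        (wmul [(\<lambda>_. 1)(i := x)] (wmul (legs2 k l X) [(\<lambda>_. 1)(j := y)]))"
      by (rule weq_wmul, simp add: weq_def, rule K_leg_commute) (use X that I in auto)
    moreover have "weq I (wmul (wmul [(\<lambda>_. 1)(i := x)] (legs2 k l X)) [(\<lambda>_. 1)(j := y)])
        (wmul (wmul (legs2 k l X) [(\<lambda>_. 1)(i := x)]) [(\<lambda>_. 1)(j := y)])"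
      by (rule weq_wmul, rule K_leg_commute) (use X that I in \<open>auto simp: weq_def\<close>)
    ultimately show ?thesis unfolding w wmul_assoc weq_def by simp
  qed
  have "(\<Sum>x y\<in>D 1. ev G (wmul [(\<lambda>_. 1)(i := x, j := y)] (legs2 k l X))) =
      (\<Sum>x y\<in>D 1. ev G (wmul (legs2 k l X) [(\<lambda>_. 1)(i := x, j := y)]))"
  proof (rule E_K[of "(*)"])
    show "bil (*) (\<lambda>x y. ev G (wmul [(\<lambda>_. 1)(i := x, j := y)] (legs2 k l X)))"
      unfolding ev_wmul using mlin_legs2[OF mlin_ev(1)[OF G] I(1-3)] by simp
    show "bil (*) (\<lambda>x y. ev G (wmul (legs2 k l X) [(\<lambda>_. 1)(i := x, j := y)]))"
      unfolding ev_wmul using mlin_legs2[OF mlin_ev(2)[OF G] I(1-3)] by simp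
  qed (use z G in \<open>simp add: weq_def\<close>)
  then show "ev G (wmul (legs2 i j (D 1)) (legs2 k l X)) = ev G (wmul (legs2 k l X) (legs2 i j (D 1)))"
    unfolding ev_wmul[of _ "legs2 k l X"] ev_wmul[of _ "legs2 i j _"] ev_legs2[where t = "D 1"]
    by (simp add: ev_wmul ev_legs2 tsum_commute[where t = "D 1"] del: fun_upd_apply)
qed

lemma map_mult_cong:
  assumes "teq2 sH (tmul t u) v"
  shows "teq3 sH (tmul3 (map_left D t) (map_left D u)) (map_left D v)"
    and "teq3 sH (tmul3 (map_right D t) (map_right D u)) (map_right D v)"
  using teq3_trans[OF teq3_sym[OF teq3_map_left_tmul] teq3_map_cong(1)[OF assms]]
    teq3_trans[OF teq3_sym[OF teq3_map_right_tmul] teq3_map_cong(2)[OF assms]] by auto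

text \<open>The axiom for Delta^2(1) in leg notation; it evaluates the idempotent produced whenever
  a comultiplied \<open>F\<close> meets its comultiplied inverse.\<close>

lemma E_legs3:
  assumes "i \<in> I" "j \<in> I" "k \<in> I" "i \<noteq> j" "j \<noteq> k" "i \<noteq> k"
  shows "cls I (legs3 i j k (map_left D (D 1))) = cmul I (cls I (legs2 i j (D 1))) (cls I (legs2 j k (D 1)))"
    and "cls I (legs3 i j k (map_right D (D 1))) = cmul I (cls I (legs2 i j (D 1))) (cls I (legs2 j k (D 1)))"
proof -
  have e: "(\<lambda>n. ((\<lambda>_. 1)(i := a, j := b)) n * ((\<lambda>_. 1)(j := c, k := d)) n) = (\<lambda>_. 1)(i := a, j := b * c, k := d)" for a b c d :: 'h
    using assms by (auto simp: fun_eq_iff)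
  have *: "weq I (legs3 i j k (map_left D (D 1))) (wmul (legs2 i j (D 1)) (legs2 j k (D 1)))"
  proof (rule weqI)
    fix G :: "(nat \<Rightarrow> 'h) \<Rightarrow> 'k" assume G: "mlin sH (*) I G"
    show "ev G (legs3 i j k (map_left D (D 1))) = ev G (wmul (legs2 i j (D 1)) (legs2 j k (D 1)))"
      unfolding ev_legs3 tsum3_map_left ev_wmul ev_legs2 e
      by (rule E_assoc1[OF mlin_legs3[OF G assms]])
  qed
  then show "cls I (legs3 i j k (map_left D (D 1))) = cmul I (cls I (legs2 i j (D 1))) (cls I (legs2 j k (D 1)))"
    unfolding cmul_cls cls_eq .
  have "weq I (legs3 i j k (map_left D (D 1))) (legs3 i j k (map_right D (D 1)))"
    by (rule weq_legs3) (use assms wb in \<open>auto simp: weak_bialgebra_def\<close>)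
  with * show "cls I (legs3 i j k (map_right D (D 1))) = cmul I (cls I (legs2 i j (D 1))) (cls I (legs2 j k (D 1)))"
    unfolding cmul_cls cls_eq weq_def by simp
qed

lemma map_E_absorb:
  assumes I: "i \<in> I" "j \<in> I" "k \<in> I" "i \<noteq> j" "j \<noteq> k" "i \<noteq> k"
  shows "cmul I (cls I (legs3 i j k (map_left D t))) (cls I (legs2 i j (D 1))) = cls I (legs3 i j k (map_left D t))"
    and "cmul I (cls I (legs3 i j k (map_right D t))) (cls I (legs2 j k (D 1))) = cls I (legs3 i j k (map_right D t))"
  unfolding cmul_cls cls_eq
proof (safe intro!: weqI)
  fix G :: "(nat \<Rightarrow> 'h) \<Rightarrow> 'k" assume G: "mlin sH (*) I G"
  note b = mlin_legs3[OF G I]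
  note [lin_rules] = tri_rules[OF b]
  have e: "(\<lambda>n. ((\<lambda>_. 1)(i := a, j := b, k := x)) n * ((\<lambda>_. 1)(i := c, j := d)) n) = (\<lambda>_. 1)(i := a * c, j := b * d, k := x)"
    "(\<lambda>n. ((\<lambda>_. 1)(i := x, j := a, k := b)) n * ((\<lambda>_. 1)(j := c, k := d)) n) = (\<lambda>_. 1)(i := x, j := a * c, k := b * d)" for a b c d x :: 'h
    using I by (auto simp: fun_eq_iff)
  show "ev G (wmul (legs3 i j k (map_left D t)) (legs2 i j (D 1))) = ev G (legs3 i j k (map_left D t))"
    unfolding ev_wmul ev_legs3 ev_legs2 e tsum3_map_left
    by (rule tsum_cong, rule D_E_right[of "(*)" "\<lambda>a b. G ((\<lambda>_. 1)(i := a, j := b, k := _))", symmetric]) (intro lin_rules)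
  show "ev G (wmul (legs3 i j k (map_right D t)) (legs2 j k (D 1))) = ev G (legs3 i j k (map_right D t))"
    unfolding ev_wmul ev_legs3 ev_legs2 e tsum3_map_right
    by (rule tsum_cong, rule D_E_right[of "(*)" "\<lambda>a b. G ((\<lambda>_. 1)(i := _, j := a, k := b))", symmetric]) (intro lin_rules)
qed

lemma map_swap:
  assumes I: "i \<in> I" "j \<in> I" "k \<in> I" "i \<noteq> j" "j \<noteq> k" "i \<noteq> k"
  shows "cls I (legs3 i j k (map_left D t)) = cls I (legs3 j i k (map_left D t))"
    and "cls I (legs3 i j k (map_right D t)) = cls I (legs3 i k j (map_right D t))"
  unfolding cls_eq
proof (safe intro!: weqI)
  fix G :: "(nat \<Rightarrow> 'h) \<Rightarrow> 'k" assume G: "mlin sH (*) I G"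
  note b = mlin_legs3[OF G I]
  note [lin_rules] = tri_rules[OF b]
  have e: "((\<lambda>_. 1)(j := a, i := b, k := x)) = (\<lambda>_. 1)(i := b, j := a, k := x)"
    "((\<lambda>_. 1)(i := x, k := a, j := b)) = (\<lambda>_. 1)(i := x, j := b, k := a)" for a b x :: 'h
    using I by (auto simp: fun_eq_iff)
  show "ev G (legs3 i j k (map_left D t)) = ev G (legs3 j i k (map_left D t))"
    unfolding ev_legs3 e tsum3_map_left
    by (rule tsum_cong, rule cocomm[of "(*)"]) (intro lin_rules)
  show "ev G (legs3 i j k (map_right D t)) = ev G (legs3 i k j (map_right D t))"
    unfolding ev_legs3 e tsum3_map_right
    by (rule tsum_cong, rule cocomm[of "(*)"]) (intro lin_rules)
qed

end

section \<open>The cocycle in several legs\<close>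

locale cocycle_twist = cocomm_groupoid H for H :: "('k::field, 'h::{ring, monoid_mult}) qgroupoid" +
  fixes F Fi :: "('h \<times> 'h) list"
  assumes cocycle: "weak_inv_unit_2cocycle H F Fi"
begin

lemma inv_S_K: "z \<in> K \<Longrightarrow> inv S z = z"
  using qg inv_f_f[of S z] unfolding quantum_groupoid_def by (simp add: S_K bij_is_inj)

lemma F_Fi: "teq2 sH (tmul F Fi) (D 1)" and Fi_F: "teq2 sH (tmul Fi F) (D 1)"
  using cocycle E_swap teq2_trans unfolding weak_inv_unit_2cocycle_def Let_def by blast+

lemma F_E: "teq2 sH (tmul (D 1) F) F" "teq2 sH (tmul F (D 1)) F"
  and Fi_E: "teq2 sH (tmul (D 1) Fi) Fi" "teq2 sH (tmul Fi (D 1)) Fi"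
proof -
  have *: "teq2 sH (tmul (D 1) X) X \<and> teq2 sH (tmul X (D 1)) X" if X: "teq2 sH X (tmul (tmul a t) b)"
    and ab: "teq2 sH a (D 1)" "teq2 sH b (D 1)" for X a b t
  proof -
    have X': "teq2 sH X (tmul (tmul (D 1) t) (D 1))"
      by (rule teq2_trans[OF X]) (intro teq2_tmul ab teq2_refl)
    have "teq2 sH (tmul (D 1) X) (tmul (tmul (tmul (D 1) (D 1)) t) (D 1))"
      using teq2_tmul[OF teq2_refl X'] by (simp add: tmul_assoc)
    also have "teq2 sH \<dots> (tmul (tmul (D 1) t) (D 1))"
      by (intro teq2_tmul E_E teq2_refl)
    also note teq2_sym[OF X']
    finally have 1: "teq2 sH (tmul (D 1) X) X" .
    have "teq2 sH (tmul X (D 1)) (tmul (tmul (D 1) t) (tmul (D 1) (D 1)))"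
      using teq2_tmul[OF X' teq2_refl] by (simp add: tmul_assoc)
    also have "teq2 sH \<dots> (tmul (tmul (D 1) t) (D 1))"
      by (intro teq2_tmul E_E teq2_refl)
    also note teq2_sym[OF X']
    finally show ?thesis using 1 by blast
  qed
  show "teq2 sH (tmul (D 1) F) F" "teq2 sH (tmul F (D 1)) F" "teq2 sH (tmul (D 1) Fi) Fi" "teq2 sH (tmul Fi (D 1)) Fi"
    using cocycle *[OF _ teq2_refl E_swap] *[OF _ E_swap teq2_refl]
    unfolding weak_inv_unit_2cocycle_def Let_def by blast+
qed

text \<open>On \<open>K\<close> the inverse antipode is the identity, so three of the cocycle
  conditions chain all four positions of a base element together.\<close>

lemma F_balanced: "K_balanced F"
proof -
  have "teq2 sH (tmul [(1, z)] F) (tmul F [(z, 1)])" "teq2 sH (tmul [(z, 1)] F) (tmul F [(1, z)])"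
    "teq2 sH (tmul F [(z, 1)]) (tmul F [(1, z)])" if "z \<in> K" for z
    using cocycle that unfolding weak_inv_unit_2cocycle_def Let_def source_K
    by (auto simp: inv_S_K)
  then show ?thesis
    using cocycle F_E unfolding K_balanced_def weak_inv_unit_2cocycle_def Let_def
    by (meson teq2_sym teq2_trans)
qed

lemma Fi_K:
  assumes "z \<in> K"
  shows "teq2 sH (tmul [(z, 1)] Fi) (tmul [(1, z)] Fi)" "teq2 sH (tmul [(z, 1)] Fi) (tmul Fi [(z, 1)])"
    "teq2 sH (tmul [(z, 1)] Fi) (tmul Fi [(1, z)])"
proof -
  have "teq2 sH (tmul Fi [(1, z)]) (tmul [(z, 1)] Fi)" "teq2 sH (tmul Fi [(z, 1)]) (tmul [(1, z)] Fi)"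
    "teq2 sH (tmul [(1, z)] Fi) (tmul [(z, 1)] Fi)"
    using cocycle assms unfolding weak_inv_unit_2cocycle_def Let_def source_K
    by (auto simp: inv_S_K)
  then show "teq2 sH (tmul [(z, 1)] Fi) (tmul [(1, z)] Fi)" "teq2 sH (tmul [(z, 1)] Fi) (tmul Fi [(z, 1)])"
    "teq2 sH (tmul [(z, 1)] Fi) (tmul Fi [(1, z)])"
    by (meson teq2_sym teq2_trans)+
qed

text \<open>The normalisation is postulated for \<open>F\<close> only. Delta(1) in front of F^-1
  turns eps(c) d into eps_t(c) d; inserting (eps \<otimes> id)(F) = 1 and dropping eps_t under the
  counit gives (eps \<otimes> id)(F F^-1) = 1.\<close>

lemma Fi_counit: "(\<Sum>a b\<in>Fi. sH (cu a) b) = 1" "(\<Sum>a b\<in>Fi. sH (cu b) a) = 1"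
proof -
  have b: "bil sH (\<lambda>a b. sH (cu a) b)" "bil sH (\<lambda>a b. sH (cu b) a)"
    by (intro lin_rules)+
  have l: "bil sH (\<lambda>a b. sH (cu a) (b * x))" "bil sH (\<lambda>a b. sH (cu b) (a * x))" for x
    by (intro lin_rules)+
  have "(\<Sum>a b\<in>Fi. sH (cu a) b) = (\<Sum>x y\<in>D 1. \<Sum>a b\<in>Fi. sH (cu (x * a)) (y * b))"
    using teq2_tsum[OF Fi_E(1) b(1)] by (simp add: tsum_tmul)
  also have "\<dots> = (\<Sum>c d\<in>Fi. et c * d)"
    unfolding epst_def by (simp add: tsum_times_right mult_scale tsum_commute[where t = "D 1"])
  also have "\<dots> = (\<Sum>c d\<in>Fi. \<Sum>a b\<in>F. sH (cu (a * et c)) (b * d))"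
  proof (rule tsum_cong)
    fix c d
    have "(\<Sum>a b\<in>F. sH (cu (a * et c)) (b * d)) = (\<Sum>a b\<in>F. sH (cu a) (et c * b * d))"
      using balanced_K(1,2)[OF F_balanced l(1)[of d] et_in_K[of c]] by (simp add: mult.assoc)
    also have "\<dots> = et c * (\<Sum>a b\<in>F. sH (cu a) b) * d"
      by (simp add: tsum_times_left tsum_times_right mult_scale mult.assoc)
    finally show "et c * d = (\<Sum>a b\<in>F. sH (cu (a * et c)) (b * d))"
      by (simp add: balanced_counit[OF F_balanced])
  qed
  also have "\<dots> = (\<Sum>a b\<in>tmul F Fi. sH (cu a) b)"
    unfolding tsum_tmul cu_et by (rule tsum_commute)
  also have "\<dots> = 1"
    using teq2_tsum[OF F_Fi b(1)] by (simp add: counit_left)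
  finally show "(\<Sum>a b\<in>Fi. sH (cu a) b) = 1" .
  have "(\<Sum>a b\<in>Fi. sH (cu b) a) = (\<Sum>x y\<in>D 1. \<Sum>a b\<in>Fi. sH (cu (y * b)) (x * a))"
    using teq2_tsum[OF Fi_E(1) b(2)] by (simp add: tsum_tmul)
  also have "\<dots> = (\<Sum>x y\<in>D 1. \<Sum>a b\<in>Fi. sH (cu (x * b)) (y * a))"
    by (rule cocomm[of sH]) (intro lin_rules)
  also have "\<dots> = (\<Sum>c d\<in>Fi. et d * c)"
    unfolding epst_def by (simp add: tsum_times_right mult_scale tsum_commute[where t = "D 1"])
  also have "\<dots> = (\<Sum>c d\<in>Fi. \<Sum>a b\<in>F. sH (cu (b * et d)) (a * c))"
  proof (rule tsum_cong)
    fix c d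
    have "(\<Sum>a b\<in>F. sH (cu (b * et d)) (a * c)) = (\<Sum>a b\<in>F. sH (cu b) (et d * a * c))"
      using balanced_K(3)[OF F_balanced l(2)[of c] et_in_K[of d]] by (simp add: mult.assoc)
    also have "\<dots> = et d * (\<Sum>a b\<in>F. sH (cu b) a) * c"
      by (simp add: tsum_times_left tsum_times_right mult_scale mult.assoc)
    finally show "et d * c = (\<Sum>a b\<in>F. sH (cu (b * et d)) (a * c))"
      by (simp add: balanced_counit[OF F_balanced])
  qed
  also have "\<dots> = (\<Sum>a b\<in>tmul F Fi. sH (cu b) a)"
    unfolding tsum_tmul cu_et by (rule tsum_commute)
  also have "\<dots> = 1"
    using teq2_tsum[OF F_Fi b(2)] by (simp add: counit_right)
  finally show "(\<Sum>a b\<in>Fi. sH (cu b) a) = 1" .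
qed

lemma Fi_balanced: "K_balanced Fi"
  unfolding K_balanced_def using Fi_K Fi_E Fi_counit by blast

lemma cocycle_legs:
  assumes I: "i \<in> I" "j \<in> I" "k \<in> I" "i \<noteq> j" "j \<noteq> k" "i \<noteq> k"
  shows "cmul I (cls I (legs3 i j k (map_left D F))) (cls I (legs2 i j F)) =
    cmul I (cls I (legs3 i j k (map_right D F))) (cls I (legs2 j k F))"
proof -
  have "legs2 i j F = legs3 i j k (map (\<lambda>(a, b). (a, b, 1)) F)" "legs2 j k F = legs3 i j k (map (\<lambda>(a, b). (1, a, b)) F)"
    unfolding legs2_def legs3_def using I by (auto simp: fun_eq_iff)
  moreover have "teq3 sH (tmul3 (map_left D F) (map (\<lambda>(a, b). (a, b, 1)) F))
       (tmul3 (map_right D F) (map (\<lambda>(a, b). (1, a, b)) F))"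
    using cocycle unfolding weak_inv_unit_2cocycle_def Let_def by blast
  ultimately show ?thesis
    unfolding cmul_cls cls_eq using weq_legs3[of _ _ i I j k] I by (simp add: wmul_legs3)
qed

text \<open>Stated for any three distinct legs in any order, since the identities are also needed
  with the first two legs exchanged.\<close>

lemma cocycle_semigroup_legs:
  assumes I: "i \<in> I" "j \<in> I" "k \<in> I" "i \<noteq> j" "j \<noteq> k" "i \<noteq> k"
  shows "cocycle_semigroup (cmul I) (cls I (legs2 i j F)) (cls I (legs2 i j Fi)) (cls I (legs2 i j (D 1)))
    (cls I (legs2 j k F)) (cls I (legs2 j k Fi)) (cls I (legs2 j k (D 1)))
    (cls I (legs3 i j k (map_left D F))) (cls I (legs3 i j k (map_left D Fi)))
    (cls I (legs3 i j k (map_right D F))) (cls I (legs3 i j k (map_right D Fi)))"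
proof -
  note m = cls_legs2_mult[OF _ I(1,2,4)] cls_legs2_mult[OF _ I(2,3,5)]
  note l = cls_legs3_mult[OF _ I]
  interpret semigroup "cmul I" by (rule cmul_semigroup)
  show ?thesis
  proof (unfold_locales, goal_cases)
    case 1 show ?case by (rule cocycle_legs[OF I])
  next
    case 2 show ?case by (rule m(1)[OF F_Fi])
  next
    case 3 show ?case by (rule m(2)[OF F_Fi])
  next
    case 4 show ?case by (rule m(2)[OF Fi_F])
  next
    case 5 show ?case by (rule map_E_absorb(1)[OF I])
  next
    case 6 show ?case by (rule map_E_absorb(2)[OF I])
  next
    case 7 show ?case by (simp only: l[OF map_mult_cong(1)[OF Fi_F]] E_legs3[OF I])
  next
    case 8 show ?case by (simp only: l[OF map_mult_cong(1)[OF F_Fi]] E_legs3[OF I])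
  next
    case 9 show ?case by (simp only: l[OF map_mult_cong(2)[OF Fi_F]] E_legs3[OF I])
  next
    case 10 show ?case by (simp only: E_legs3(2)[OF I, symmetric] l[OF map_mult_cong(2)[OF Fi_E(2)]])
  next
    case 11 show ?case by (simp only: E_legs3(1)[OF I, symmetric] l[OF map_mult_cong(1)[OF Fi_E(1)]])
  next
    case 12 show ?case by (rule m(1)[OF F_E(1)])
  next
    case 13 show ?case by (rule m(1)[OF Fi_E(1)])
  next
    case 14 show ?case by (rule m(2)[OF Fi_E(1)])
  next
    case 15 show ?case by (rule m(2)[OF F_E(1)])
  next
    case 16 show ?case by (rule m(2)[OF E_E])
  next
    case 17 show ?case by (rule m(1)[OF E_E])
  next
    case 18 show ?case by (rule E_legs_commute[OF F_balanced I(2,3,5) I(1,2,4)])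
  next
    case 19 show ?case by (rule E_legs_commute[OF Fi_balanced I(2,3,5) I(1,2,4)])
  next
    case 20 show ?case by (rule E_legs_commute[OF F_balanced I(1,2,4) I(2,3,5)])
  next
    case 21 show ?case by (rule E_legs_commute[OF Fi_balanced I(1,2,4) I(2,3,5)])
  next
    case 22 show ?case by (rule E_legs_commute[OF E_balanced I(1,2,4) I(2,3,5)])
  qed
qed

lemmas legs012 = cocycle_semigroup_legs[of 0 "{0, 1, 2}" 1 2]

context
  fixes sc and g
  assumes g: "tri sc g"
begin

lemma inverse_cocycle:
  "(\<Sum>x y\<in>Fi. \<Sum>p q\<in>Fi. \<Sum>a b\<in>D p. g (x * a) (y * b) q) =
   (\<Sum>x y\<in>Fi. \<Sum>p q\<in>Fi. \<Sum>a b\<in>D q. g p (x * a) (y * b))"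
proof -
  have "weq {0, 1, 2} (wmul (legs2 0 1 Fi) (legs3 0 1 2 (map_left D Fi))) (wmul (legs2 1 2 Fi) (legs3 0 1 2 (map_right D Fi)))"
    using cocycle_semigroup.inverse_cocycle[OF legs012] unfolding cmul_cls cls_eq by simp
  from weq_ev[OF this mlin3[OF g] tri_vs[OF g]] show ?thesis by (simp add: ev_simps)
qed

lemma F12_Fi23:
  "(\<Sum>x y\<in>F. \<Sum>p q\<in>Fi. g x (y * p) q) =
   (\<Sum>p q\<in>Fi. \<Sum>a b\<in>D p. \<Sum>x y\<in>F. \<Sum>c d\<in>D y. g (a * x) (b * c) (q * d))"
proof -
  have "weq {0, 1, 2} (wmul (legs2 0 1 F) (legs2 1 2 Fi)) (wmul (legs3 0 1 2 (map_left D Fi)) (legs3 0 1 2 (map_right D F)))"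
    using cocycle_semigroup.f12_g23[OF legs012] unfolding cmul_cls cls_eq by simp
  from weq_ev[OF this mlin3[OF g] tri_vs[OF g]] show ?thesis by (simp add: ev_simps)
qed

lemma F23_Fi12:
  "(\<Sum>x y\<in>F. \<Sum>p q\<in>Fi. g p (x * q) y) =
   (\<Sum>p q\<in>Fi. \<Sum>a b\<in>D q. \<Sum>x y\<in>F. \<Sum>c d\<in>D x. g (p * c) (a * d) (b * y))"
proof -
  have "weq {0, 1, 2} (wmul (legs2 1 2 F) (legs2 0 1 Fi)) (wmul (legs3 0 1 2 (map_right D Fi)) (legs3 0 1 2 (map_left D F)))"
    using cocycle_semigroup.f23_g12[OF legs012] unfolding cmul_cls cls_eq by simp
  from weq_ev[OF this mlin3[OF g] tri_vs[OF g]] show ?thesis by (simp add: ev_simps)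
qed

lemma comult_left_F:
  "(\<Sum>x y\<in>F. \<Sum>a b\<in>D x. g a b y) =
   (\<Sum>x y\<in>F. \<Sum>c d\<in>D y. \<Sum>u w\<in>F. \<Sum>p q\<in>Fi. g (x * p) (c * u * q) (d * w))"
proof -
  have "weq {0, 1, 2} (legs3 0 1 2 (map_left D F)) (wmul (wmul (legs3 0 1 2 (map_right D F)) (legs2 1 2 F)) (legs2 0 1 Fi))"
    using cocycle_semigroup.x_eq[OF legs012] unfolding cmul_cls cls_eq by simp
  from weq_ev[OF this mlin3[OF g] tri_vs[OF g]] show ?thesis by (simp add: ev_simps)
qed

lemma cocycle_ev:
  "(\<Sum>x y\<in>F. \<Sum>a b\<in>D x. \<Sum>u w\<in>F. g (a * u) (b * w) y) =
   (\<Sum>x y\<in>F. \<Sum>c d\<in>D y. \<Sum>u w\<in>F. g x (c * u) (d * w))"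
proof -
  have "weq {0, 1, 2} (wmul (legs3 0 1 2 (map_left D F)) (legs2 0 1 F)) (wmul (legs3 0 1 2 (map_right D F)) (legs2 1 2 F))"
    using cocycle_legs[of 0 "{0, 1, 2}" 1 2] unfolding cmul_cls cls_eq by simp
  from weq_ev[OF this mlin3[OF g] tri_vs[OF g]] show ?thesis by (simp add: ev_simps)
qed

text \<open>With legs counted from 1, \<open>f23_g12\<close> in the order 2, 1, 3 rewrites F_13
  F_21^-1 as a product ending in (Delta \<otimes> id)(F). Cocommutativity puts its first two legs
  back in order, and the cocycle identity applies to it and the remaining F_12.\<close>

lemma F13_Fi21_F12:
  "(\<Sum>x y\<in>F. \<Sum>p q\<in>Fi. \<Sum>u w\<in>F. g (x * q * u) (p * w) y) =
   (\<Sum>p q\<in>Fi. \<Sum>a b\<in>D q. \<Sum>x y\<in>F. \<Sum>c d\<in>D y. \<Sum>u w\<in>F. g (a * x) (p * c * u) (b * d * w))"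
proof -
  let ?I = "{0, 1, 2} :: nat set"
  have "cmul ?I (cmul ?I (cls ?I (legs2 0 2 F)) (cls ?I (legs2 1 0 Fi))) (cls ?I (legs2 0 1 F)) =
      cmul ?I (cls ?I (legs3 1 0 2 (map_right D Fi))) (cmul ?I (cls ?I (legs3 0 1 2 (map_left D F))) (cls ?I (legs2 0 1 F)))"
    using cocycle_semigroup.f23_g12[OF cocycle_semigroup_legs[of 1 ?I 0 2]] map_swap(1)[of 1 ?I 0 2 F]
    by (simp add: semigroup.assoc[OF cmul_semigroup])
  also have "\<dots> = cmul ?I (cls ?I (legs3 1 0 2 (map_right D Fi))) (cmul ?I (cls ?I (legs3 0 1 2 (map_right D F))) (cls ?I (legs2 1 2 F)))"
    by (subst cocycle_legs) simp_all
  finally have "weq ?I (wmul (wmul (legs2 0 2 F) (legs2 1 0 Fi)) (legs2 0 1 F))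
      (wmul (legs3 1 0 2 (map_right D Fi)) (wmul (legs3 0 1 2 (map_right D F)) (legs2 1 2 F)))"
    unfolding cmul_cls cls_eq .
  from weq_ev[OF this mlin3[OF g] tri_vs[OF g]] show ?thesis by (simp add: ev_simps mult.assoc)
qed

end

end

section \<open>The exchange identity in four legs\<close>

lemma (in leg_semigroup) cocycle_exchange_solved:
  assumes "qq \<^bold>* fCD \<^bold>* fAB = r" "fAB \<^bold>* gAB = eAB" "fCD \<^bold>* gCD = eCD" "eAB \<^bold>* gCD = gCD \<^bold>* eAB"
    "qq \<^bold>* eAB = qq" "qq \<^bold>* eCD = qq"
  shows "qq = r \<^bold>* gAB \<^bold>* gCD"
proof -
  have "r \<^bold>* gAB \<^bold>* gCD = qq \<^bold>* fCD \<^bold>* (eAB \<^bold>* gCD)"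
    unfolding assms(1,2)[symmetric] by (simp only: assoc)
  also have "\<dots> = qq \<^bold>* eCD \<^bold>* eAB"
    unfolding assms(3)[symmetric] assms(4) by (simp only: assoc)
  finally show ?thesis by (simp only: assms(5,6))
qed

context cocomm_groupoid begin

context
  fixes i j k l :: nat and I
  assumes I: "i \<in> I" "j \<in> I" "k \<in> I" "l \<in> I" and d: "distinct [i, j, k, l]"
begin

lemma legs4_word_mult:
  "(\<lambda>n. ((\<lambda>_. 1)(i := a, j := b, k := c, l := d)) n * ((\<lambda>_. 1)(i := a', j := b', k := c', l := d')) n) =
    (\<lambda>_. 1)(i := a * a', j := b * b', k := c * c', l := d * (d' :: 'h))"
  using d by (auto simp: fun_eq_iff)

lemma legs4_tmul:
  assumes "teq2 sH (tmul t u) v"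
  shows "cmul I (cls I (legs4 i j k l D t)) (cls I (legs4 i j k l D u)) = cls I (legs4 i j k l D v)"
  unfolding cmul_cls cls_eq
proof (rule weqI)
  fix G :: "(nat \<Rightarrow> 'h) \<Rightarrow> 'k" assume G: "mlin sH (*) I G"
  note q = mlin_legs4[OF G I d]
  note [lin_rules] = quad_lin[OF q]
  let ?g = "\<lambda>a b c d. G ((\<lambda>_. 1)(i := a, j := b, k := c, l := d))"
  have "ev G (wmul (legs4 i j k l D t) (legs4 i j k l D u)) =
    (\<Sum>x y\<in>t. \<Sum>a b\<in>D x. \<Sum>c d\<in>D y. \<Sum>x' y'\<in>u. \<Sum>a' b'\<in>D x'. \<Sum>c' d'\<in>D y'. ?g (a * a') (b * b') (c * c') (d * d'))"
    unfolding ev_wmul ev_legs4 legs4_word_mult ..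
  also have "\<dots> = (\<Sum>x y\<in>t. \<Sum>x' y'\<in>u. \<Sum>a b\<in>D x. \<Sum>a' b'\<in>D x'. \<Sum>c d\<in>D y. \<Sum>c' d'\<in>D y'.
        ?g (a * a') (b * b') (c * c') (d * d'))"
    unfolding tsum_commute[where u = u] by (subst (3) tsum_commute) (rule HOL.refl)
  also have "\<dots> = (\<Sum>x y\<in>t. \<Sum>x' y'\<in>u. \<Sum>a b\<in>D x. \<Sum>a' b'\<in>D x'. \<Sum>c d\<in>D (y * y'). ?g (a * a') (b * b') c d)"
    by (rule tsum_cong, rule tsum_cong, rule tsum_cong, rule tsum_cong,
        rule D_mult[of "(*)" "\<lambda>c d. ?g (_ * _) (_ * _) c d", symmetric]) (intro lin_rules)
  also have "\<dots> = (\<Sum>x y\<in>t. \<Sum>x' y'\<in>u. \<Sum>a b\<in>D (x * x'). \<Sum>c d\<in>D (y * y'). ?g a b c d)"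
    by (rule tsum_cong, rule tsum_cong,
        rule D_mult[of "(*)" "\<lambda>a b. \<Sum>c d\<in>D (_ * _). ?g a b c d", symmetric]) (intro lin_rules)
  also have "\<dots> = (\<Sum>x y\<in>tmul t u. \<Sum>a b\<in>D x. \<Sum>c d\<in>D y. ?g a b c d)"
    unfolding tsum_tmul ..
  also have "\<dots> = (\<Sum>x y\<in>v. \<Sum>a b\<in>D x. \<Sum>c d\<in>D y. ?g a b c d)"
    by (rule teq2_tsum[OF assms, of "(*)"]) (intro lin_rules)
  also have "\<dots> = ev G (legs4 i j k l D v)"
    unfolding ev_legs4 ..
  finally show "ev G (wmul (legs4 i j k l D t) (legs4 i j k l D u)) = ev G (legs4 i j k l D v)" .
qed

text \<open>The axiom for Delta^2(1) is used twice, the second time on the legs that coassociativity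
  exposes.\<close>

lemma legs4_E: "cls I (legs4 i j k l D (D 1)) =
    cmul I (cmul I (cls I (legs2 i j (D 1))) (cls I (legs2 j k (D 1)))) (cls I (legs2 k l (D 1)))"
  unfolding cmul_cls cls_eq
proof (rule weqI)
  fix G :: "(nat \<Rightarrow> 'h) \<Rightarrow> 'k" assume G: "mlin sH (*) I G"
  note q = mlin_legs4[OF G I d]
  note [lin_rules] = quad_lin[OF q]
  let ?g = "\<lambda>a b c d. G ((\<lambda>_. 1)(i := a, j := b, k := c, l := d))"
  have w: "(\<lambda>n. ((\<lambda>_. 1)(i := a, j := b)) n * ((\<lambda>_. 1)(j := a', k := b')) n * ((\<lambda>_. 1)(k := a'', l := b'')) n) =
    (\<lambda>_. 1)(i := a, j := b * a', k := b' * a'', l := (b'' :: 'h))" for a b a' b' a'' b''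
    using d by (auto simp: fun_eq_iff)
  have "ev G (legs4 i j k l D (D 1)) = (\<Sum>x y\<in>D 1. \<Sum>a b\<in>D x. \<Sum>c d\<in>D y. ?g a b c d)"
    unfolding ev_legs4 ..
  also have "\<dots> = (\<Sum>a b\<in>D 1. \<Sum>x y\<in>D 1. \<Sum>c d\<in>D y. ?g a (b * x) c d)"
    by (rule E_assoc1[of "(*)" "\<lambda>a b y. \<Sum>c d\<in>D y. ?g a b c d"]) (intro lin_rules)
  also have "\<dots> = (\<Sum>a b\<in>D 1. \<Sum>x y\<in>D 1. \<Sum>c d\<in>D x. ?g a (b * c) d y)"
    by (rule tsum_cong, rule coassoc[of "(*)" "\<lambda>x c d. ?g _ (_ * x) c d", symmetric]) (intro lin_rules)
  also have "\<dots> = (\<Sum>a b\<in>D 1. \<Sum>a' b'\<in>D 1. \<Sum>a'' b''\<in>D 1. ?g a (b * a') (b' * a'') b'')"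
    by (rule tsum_cong, rule E_assoc1[of "(*)" "\<lambda>c d y. ?g _ (_ * c) d y"]) (intro lin_rules)
  also have "\<dots> = ev G (wmul (wmul (legs2 i j (D 1)) (legs2 j k (D 1))) (legs2 k l (D 1)))"
    unfolding ev_wmul ev_legs2 w ..
  finally show "ev G (legs4 i j k l D (D 1)) = ev G (wmul (wmul (legs2 i j (D 1)) (legs2 j k (D 1))) (legs2 k l (D 1)))" .
qed

lemma legs4_E_absorb:
  "cmul I (cls I (legs4 i j k l D t)) (cls I (legs2 i j (D 1))) = cls I (legs4 i j k l D t)"
  "cmul I (cls I (legs4 i j k l D t)) (cls I (legs2 k l (D 1))) = cls I (legs4 i j k l D t)"
  unfolding cmul_cls cls_eq
proof (safe intro!: weqI)
  fix G :: "(nat \<Rightarrow> 'h) \<Rightarrow> 'k" assume G: "mlin sH (*) I G"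
  note q = mlin_legs4[OF G I d]
  note [lin_rules] = quad_lin[OF q]
  let ?g = "\<lambda>a b c d. G ((\<lambda>_. 1)(i := a, j := b, k := c, l := d))"
  have w: "(\<lambda>n. ((\<lambda>_. 1)(i := a, j := b, k := c, l := e)) n * ((\<lambda>_. 1)(i := a', j := b')) n) =
      (\<lambda>_. 1)(i := a * a', j := b * b', k := c, l := (e :: 'h))"
    "(\<lambda>n. ((\<lambda>_. 1)(i := a, j := b, k := c, l := e)) n * ((\<lambda>_. 1)(k := a', l := b')) n) =
      (\<lambda>_. 1)(i := a, j := b, k := c * a', l := e * (b' :: 'h))" for a b c e a' b'
    using d by (auto simp: fun_eq_iff)
  have "(\<Sum>x y\<in>t. \<Sum>a b\<in>D x. \<Sum>c d\<in>D y. \<Sum>a' b'\<in>D 1. ?g (a * a') (b * b') c d) =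
     (\<Sum>x y\<in>t. \<Sum>a b\<in>D x. \<Sum>a' b'\<in>D 1. \<Sum>c d\<in>D y. ?g (a * a') (b * b') c d)"
    by (rule tsum_cong, rule tsum_cong, rule tsum_commute)
  also have "\<dots> = (\<Sum>x y\<in>t. \<Sum>a b\<in>D x. \<Sum>c d\<in>D y. ?g a b c d)"
    by (rule tsum_cong, rule D_E_right[of "(*)" "\<lambda>a b. \<Sum>c d\<in>D _. ?g a b c d", symmetric]) (intro lin_rules)
  finally show "ev G (wmul (legs4 i j k l D t) (legs2 i j (D 1))) = ev G (legs4 i j k l D t)"
    unfolding ev_wmul ev_legs4 ev_legs2 w .
  show "ev G (wmul (legs4 i j k l D t) (legs2 k l (D 1))) = ev G (legs4 i j k l D t)"
    unfolding ev_wmul ev_legs4 ev_legs2 w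
    by (rule tsum_cong, rule tsum_cong, rule D_E_right[of "(*)" "\<lambda>c d. ?g _ _ c d", symmetric]) (intro lin_rules)
qed

lemma legs31_swap: "cls I (legs31 i j k l D t) = cls I (legs31 i k j l D t)"
  unfolding cls_eq
proof (rule weqI)
  fix G :: "(nat \<Rightarrow> 'h) \<Rightarrow> 'k" assume G: "mlin sH (*) I G"
  note q = mlin_legs4[OF G I d]
  note [lin_rules] = quad_lin[OF q]
  let ?g = "\<lambda>a b c d. G ((\<lambda>_. 1)(i := a, j := b, k := c, l := d))"
  have w: "(\<lambda>_. 1)(i := a, k := b, j := c, l := e) = (\<lambda>_. 1)(i := a, j := c, k := b, l := (e :: 'h))" for a b c e
    using d by (auto simp: fun_eq_iff)
  have "ev G (legs31 i j k l D t) = (\<Sum>x y\<in>t. \<Sum>p c\<in>D x. \<Sum>a b\<in>D p. ?g a b c y)"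
    unfolding ev_legs31 ..
  also have "\<dots> = (\<Sum>x y\<in>t. \<Sum>a p\<in>D x. \<Sum>b c\<in>D p. ?g a b c y)"
    by (rule tsum_cong, rule coassoc[of "(*)" "\<lambda>a b c. ?g a b c _"]) (intro lin_rules)
  also have "\<dots> = (\<Sum>x y\<in>t. \<Sum>a p\<in>D x. \<Sum>b c\<in>D p. ?g a c b y)"
    by (rule tsum_cong, rule tsum_cong, rule cocomm[of "(*)"]) (intro lin_rules)
  also have "\<dots> = (\<Sum>x y\<in>t. \<Sum>p c\<in>D x. \<Sum>a b\<in>D p. ?g a c b y)"
    by (rule tsum_cong, rule coassoc[of "(*)" "\<lambda>a b c. ?g a c b _", symmetric]) (intro lin_rules)
  also have "\<dots> = ev G (legs31 i k j l D t)"
    unfolding ev_legs31 w ..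
  finally show "ev G (legs31 i j k l D t) = ev G (legs31 i k j l D t)" .
qed

end

end

context cocycle_twist begin

text \<open>Delta is applied to the first leg of the cocycle identity. As Delta is not unital, the
  factor with 1 in this leg contributes Delta(1) in the legs \<open>i\<close> and \<open>j\<close>,
  which is the last factor on the right.\<close>

lemma cocycle_comult_left:
  fixes i j k l :: nat
  assumes I: "i \<in> I" "j \<in> I" "k \<in> I" "l \<in> I" and d: "distinct [i, j, k, l]"
  shows "cmul I (cls I (legs31 i j k l D F)) (cls I (legs3 i j k (map_left D F))) =
    cmul I (cmul I (cls I (legs4 i j k l D F)) (cls I (legs2 k l F))) (cls I (legs2 i j (D 1)))"
  unfolding cmul_cls cls_eq
proof (rule weqI)
  fix G :: "(nat \<Rightarrow> 'h) \<Rightarrow> 'k" assume G: "mlin sH (*) I G"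
  note q = mlin_legs4[OF G I d]
  note [lin_rules] = quad_lin[OF q]
  let ?g = "\<lambda>a b c d. G ((\<lambda>_. 1)(i := a, j := b, k := c, l := d))"
  have w: "(\<lambda>n. ((\<lambda>_. 1)(i := a, j := b, k := c, l := e)) n * ((\<lambda>_. 1)(i := a', j := b', k := c')) n) =
      (\<lambda>_. 1)(i := a * a', j := b * b', k := c * c', l := (e :: 'h))"
    "(\<lambda>n. ((\<lambda>_. 1)(i := a, j := b, k := c, l := e)) n * ((\<lambda>_. 1)(k := a', l := b')) n * ((\<lambda>_. 1)(i := a'', j := b'')) n) =
      (\<lambda>_. 1)(i := a * a'', j := b * b'', k := c * a', l := e * (b' :: 'h))" for a b c e a' b' c' a'' b''
    using d by (auto simp: fun_eq_iff)
  have "ev G (wmul (legs31 i j k l D F) (legs3 i j k (map_left D F))) =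
     (\<Sum>x y\<in>F. \<Sum>p c\<in>D x. \<Sum>a b\<in>D p. \<Sum>u w\<in>F. \<Sum>a' b'\<in>D u. ?g (a * a') (b * b') (c * w) y)"
    unfolding ev_wmul ev_legs31 ev_legs3 tsum3_map_left w ..
  also have "\<dots> = (\<Sum>x y\<in>F. \<Sum>p c\<in>D x. \<Sum>u w\<in>F. \<Sum>a b\<in>D p. \<Sum>a' b'\<in>D u. ?g (a * a') (b * b') (c * w) y)"
    by (rule tsum_cong, rule tsum_cong, rule tsum_commute)
  also have "\<dots> = (\<Sum>x y\<in>F. \<Sum>p c\<in>D x. \<Sum>u w\<in>F. \<Sum>a b\<in>D (p * u). ?g a b (c * w) y)"
    by (rule tsum_cong, rule tsum_cong, rule tsum_cong, rule D_mult[of "(*)" "\<lambda>a b. ?g a b (_ * _) _", symmetric]) (intro lin_rules)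
  also have "\<dots> = (\<Sum>x y\<in>F. \<Sum>c d\<in>D y. \<Sum>u w\<in>F. \<Sum>a b\<in>D x. ?g a b (c * u) (d * w))"
    by (rule cocycle_ev[of "(*)" "\<lambda>x y z. \<Sum>a b\<in>D x. ?g a b y z"]) (intro lin_rules)
  also have "\<dots> = (\<Sum>x y\<in>F. \<Sum>c d\<in>D y. \<Sum>u w\<in>F. \<Sum>a b\<in>D x. \<Sum>a'' b''\<in>D 1. ?g (a * a'') (b * b'') (c * u) (d * w))"
    by (rule tsum_cong, rule tsum_cong, rule tsum_cong, rule D_E_right[of "(*)"]) (intro lin_rules)
  also have "\<dots> = (\<Sum>x y\<in>F. \<Sum>c d\<in>D y. \<Sum>a b\<in>D x. \<Sum>u w\<in>F. \<Sum>a'' b''\<in>D 1. ?g (a * a'') (b * b'') (c * u) (d * w))"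
    by (rule tsum_cong, rule tsum_cong, rule tsum_commute)
  also have "\<dots> = (\<Sum>x y\<in>F. \<Sum>a b\<in>D x. \<Sum>c d\<in>D y. \<Sum>u w\<in>F. \<Sum>a'' b''\<in>D 1. ?g (a * a'') (b * b'') (c * u) (d * w))"
    by (rule tsum_cong, rule tsum_commute)
  also have "\<dots> = ev G (wmul (wmul (legs4 i j k l D F) (legs2 k l F)) (legs2 i j (D 1)))"
    unfolding ev_wmul ev_legs4 ev_legs2 w ..
  finally show "ev G (wmul (legs31 i j k l D F) (legs3 i j k (map_left D F))) =
    ev G (wmul (wmul (legs4 i j k l D F) (legs2 k l F)) (legs2 i j (D 1)))" .
qed

lemma cocycle_exchange_legs:
  fixes i j k l :: nat
  assumes I: "i \<in> I" "j \<in> I" "k \<in> I" "l \<in> I" and d: "distinct [i, j, k, l]"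
  shows "cmul I (cmul I (cls I (legs4 i k j l D F)) (cls I (legs2 j l F))) (cls I (legs2 i k F)) =
    cmul I (cmul I (cmul I (cmul I (cls I (legs4 i j k l D F)) (cls I (legs2 k l F))) (cls I (legs2 i j F)))
      (cls I (legs2 j k Fi))) (cls I (legs2 k j F))"
proof (rule leg_semigroup.cocycle_exchange[OF cmul_leg_semigroup])
  have n: "i \<noteq> j" "j \<noteq> k" "i \<noteq> k" "k \<noteq> j" "distinct [i, k, j, l]" using d by auto
  show "cmul I (cls I (legs3 i j k (map_left D F))) (cls I (legs2 i j F)) =
     cmul I (cls I (legs3 i j k (map_right D F))) (cls I (legs2 j k F))"
    by (rule cocycle_legs[OF I(1-3) n(1-3)])
  show "cmul I (cls I (legs3 i k j (map_left D F))) (cls I (legs2 i k F)) =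
     cmul I (cls I (legs3 i j k (map_right D F))) (cls I (legs2 k j F))"
    unfolding map_swap(2)[OF I(1-3) n(1-3)] by (rule cocycle_legs[OF I(1,3,2) n(3,4,1)])
  show "cmul I (cls I (legs31 i j k l D F)) (cls I (legs3 i j k (map_left D F))) =
    cmul I (cmul I (cls I (legs4 i j k l D F)) (cls I (legs2 k l F))) (cls I (legs2 i j (D 1)))"
    by (rule cocycle_comult_left[OF I d])
  show "cmul I (cls I (legs31 i j k l D F)) (cls I (legs3 i k j (map_left D F))) =
    cmul I (cmul I (cls I (legs4 i k j l D F)) (cls I (legs2 j l F))) (cls I (legs2 i k (D 1)))"
    unfolding legs31_swap[OF I d] by (rule cocycle_comult_left[OF I(1,3,2,4) n(5)])
  show "cmul I (cls I (legs3 i j k (map_right D F))) (cls I (legs2 j k (D 1))) = cls I (legs3 i j k (map_right D F))"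
    by (rule map_E_absorb(2)[OF I(1-3) n(1-3)])
  show "cmul I (cls I (legs2 j k F)) (cls I (legs2 j k Fi)) = cls I (legs2 j k (D 1))"
    by (rule cls_legs2_mult[OF F_Fi I(2,3) n(2)])
  show "cmul I (cls I (legs2 i j (D 1))) (cls I (legs2 i j F)) = cls I (legs2 i j F)"
    by (rule cls_legs2_mult[OF F_E(1) I(1,2) n(1)])
  show "cmul I (cls I (legs2 i k (D 1))) (cls I (legs2 i k F)) = cls I (legs2 i k F)"
    by (rule cls_legs2_mult[OF F_E(1) I(1,3) n(3)])
qed

lemma cocycle_exchange_inverse_legs:
  fixes i j k l :: nat
  assumes I: "i \<in> I" "j \<in> I" "k \<in> I" "l \<in> I" and d: "distinct [i, j, k, l]"
  shows "cmul I (cmul I (cmul I (cls I (legs4 i k j l D Fi)) (cls I (legs4 i j k l D F))) (cls I (legs2 k l F))) (cls I (legs2 i j F)) =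
    cmul I (cmul I (cmul I (cls I (legs2 j l F)) (cls I (legs2 i k F))) (cls I (legs2 k j Fi))) (cls I (legs2 j k F))"
    (is ?t1)
    and "cmul I (cls I (legs4 i k j l D Fi)) (cls I (legs4 i j k l D F)) =
    cmul I (cmul I (cmul I (cmul I (cmul I (cls I (legs2 j l F)) (cls I (legs2 i k F))) (cls I (legs2 k j Fi))) (cls I (legs2 j k F)))
      (cls I (legs2 i j Fi))) (cls I (legs2 k l Fi))"
proof -
  have n: "i \<noteq> j" "j \<noteq> k" "i \<noteq> k" "k \<noteq> j" "distinct [i, k, j, l]" "k \<noteq> l" "j \<noteq> l" using d by auto
  show ?t1
  proof (rule leg_semigroup.cocycle_exchange_inverse[OF cmul_leg_semigroup])
    show "cmul I (cmul I (cls I (legs4 i j k l D F)) (cls I (legs2 k l F))) (cls I (legs2 i j F)) =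
        cmul I (cmul I (cmul I (cmul I (cls I (legs4 i k j l D F)) (cls I (legs2 j l F))) (cls I (legs2 i k F)))
      (cls I (legs2 k j Fi))) (cls I (legs2 j k F))"
      by (rule cocycle_exchange_legs[OF I(1,3,2,4) n(5)])
    show "cmul I (cls I (legs4 i k j l D Fi)) (cls I (legs4 i k j l D F)) =
      cmul I (cmul I (cls I (legs2 i k (D 1))) (cls I (legs2 k j (D 1)))) (cls I (legs2 j l (D 1)))"
      unfolding legs4_tmul[OF I(1,3,2,4) n(5) Fi_F] by (rule legs4_E[OF I(1,3,2,4) n(5)])
    show "cmul I (cls I (legs2 j l (D 1))) (cls I (legs2 j l F)) = cls I (legs2 j l F)"
      by (rule cls_legs2_mult[OF F_E(1) I(2,4) n(7)])
    show "cmul I (cls I (legs2 k j (D 1))) (cls I (legs2 k j Fi)) = cls I (legs2 k j Fi)"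
      by (rule cls_legs2_mult[OF Fi_E(1) I(3,2) n(4)])
    show "cmul I (cls I (legs2 i k (D 1))) (cls I (legs2 i k F)) = cls I (legs2 i k F)"
      by (rule cls_legs2_mult[OF F_E(1) I(1,3) n(3)])
  qed (rule E_legs_commute[OF F_balanced]; use I n in simp)+
  then show "cmul I (cls I (legs4 i k j l D Fi)) (cls I (legs4 i j k l D F)) =
    cmul I (cmul I (cmul I (cmul I (cmul I (cls I (legs2 j l F)) (cls I (legs2 i k F))) (cls I (legs2 k j Fi))) (cls I (legs2 j k F)))
      (cls I (legs2 i j Fi))) (cls I (legs2 k l Fi))"
  proof (rule leg_semigroup.cocycle_exchange_solved[OF cmul_leg_semigroup])
    show "cmul I (cls I (legs2 i j F)) (cls I (legs2 i j Fi)) = cls I (legs2 i j (D 1))"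
      by (rule cls_legs2_mult[OF F_Fi I(1,2) n(1)])
    show "cmul I (cls I (legs2 k l F)) (cls I (legs2 k l Fi)) = cls I (legs2 k l (D 1))"
      by (rule cls_legs2_mult[OF F_Fi I(3,4) n(6)])
    show "cmul I (cls I (legs2 i j (D 1))) (cls I (legs2 k l Fi)) = cmul I (cls I (legs2 k l Fi)) (cls I (legs2 i j (D 1)))"
      by (rule E_legs_commute[OF Fi_balanced]) (use I n in simp_all)
  qed (simp_all only: semigroup.assoc[OF cmul_semigroup] legs4_E_absorb[OF I d])
qed

context
  fixes sc and g
  assumes g: "quad sc g"
begin

text \<open>The pairs from the inner \<open>Fi\<close> and \<open>F\<close> form the twisted
  R-matrix in the middle legs. This version, with two copies of \<open>F\<close> kept on the left,
  serves the comultiplication of \<open>alpha\<close>; the solved version below serves the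
  comultiplication of a product.\<close>

lemma cocycle_exchange_ev:
  "(\<Sum>p q\<in>Fi. \<Sum>a b\<in>D p. \<Sum>c d\<in>D q. \<Sum>x y\<in>F. \<Sum>x1 x2\<in>D x. \<Sum>y1 y2\<in>D y. \<Sum>r t\<in>F. \<Sum>u w\<in>F.
        g (a * x1 * u) (c * x2 * w) (b * y1 * r) (d * y2 * t)) =
   (\<Sum>r t\<in>F. \<Sum>u w\<in>F. \<Sum>p q\<in>Fi. \<Sum>x y\<in>F. g u (r * q * x) (w * p * y) t)"
proof -
  have "weq {0, 1, 2, 3} (wmul (wmul (wmul (legs4 0 2 1 3 D Fi) (legs4 0 1 2 3 D F)) (legs2 2 3 F)) (legs2 0 1 F))
      (wmul (wmul (wmul (legs2 1 3 F) (legs2 0 2 F)) (legs2 2 1 Fi)) (legs2 1 2 F))"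
    using cocycle_exchange_inverse_legs(1)[of 0 "{0, 1, 2, 3}" 1 2 3] unfolding cmul_cls cls_eq by simp
  from weq_ev[OF this mlin4[OF g] quad_vs[OF g]] show ?thesis by (simp add: ev_simps ev_legs4)
qed

lemma cocycle_exchange_inverse_ev:
  "(\<Sum>p q\<in>Fi. \<Sum>a b\<in>D p. \<Sum>c d\<in>D q. \<Sum>x y\<in>F. \<Sum>x1 x2\<in>D x. \<Sum>y1 y2\<in>D y. g (a * x1) (c * x2) (b * y1) (d * y2)) =
   (\<Sum>r t\<in>F. \<Sum>u w\<in>F. \<Sum>p q\<in>Fi. \<Sum>x y\<in>F. \<Sum>p1 q1\<in>Fi. \<Sum>p2 q2\<in>Fi.
         g (u * p1) (r * q * x * q1) (w * p * y * p2) (t * q2))"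
proof -
  have "weq {0, 1, 2, 3} (wmul (legs4 0 2 1 3 D Fi) (legs4 0 1 2 3 D F))
      (wmul (wmul (wmul (wmul (wmul (legs2 1 3 F) (legs2 0 2 F)) (legs2 2 1 Fi)) (legs2 1 2 F)) (legs2 0 1 Fi)) (legs2 2 3 Fi))"
    using cocycle_exchange_inverse_legs(2)[of 0 "{0, 1, 2, 3}" 1 2 3] unfolding cmul_cls cls_eq by simp
  from weq_ev[OF this mlin4[OF g] quad_vs[OF g]] show ?thesis by (simp add: ev_simps ev_legs4)
qed

end

end

section \<open>The twisted groupoid and the Hopf algebra of the cocycle\<close>

context cocomm_groupoid begin

lemma tlinearI:
  assumes "\<And>f. bil ((*) :: 'k \<Rightarrow> _) f \<Longrightarrow> lin sH (*) (\<lambda>x. tsum f (T x))"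
  shows "tlinear sH T"
  unfolding tlinear_def
proof (intro conjI allI teq2I[OF vs])
  fix f assume f: "bil ((*) :: 'k \<Rightarrow> _) f"
  note l = assms[OF f]
  show "tsum f (T (x + y)) = tsum f (T x @ T y)" for x y
    using lin_add[OF l] by simp
  have "f (sH c a) b = c * f a b" for a b c
    using lin_scale[of sH "(*)" "\<lambda>x. f x b" c a] f unfolding bilinear_map_def by auto
  then have "tsum f (map (\<lambda>(a, b). (sH c a, b)) t) = c * tsum f t" for c t
    by (induction t) (auto simp: distrib_left)
  then show "tsum f (T (sH c x)) = tsum f (map (\<lambda>(a, b). (sH c a, b)) (T x))" for c x
    using lin_scale[OF l] by simp
qed

lemma tsum_C: "(\<And>x y. (x, y) \<in> set t \<Longrightarrow> f x y \<in> C) \<Longrightarrow> tsum f t \<in> C"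
proof (induction t)
  case Nil
  interpret vector_space sH by (rule vs)
  show ?case using subspace_0[OF C_subspace] by simp
next
  case (Cons p t)
  interpret vector_space sH by (rule vs)
  show ?case using subspace_add[OF C_subspace, of "f (fst p) (snd p)" "tsum f t"] Cons by (cases p) auto
qed

text \<open>The base element is pulled out of eps_t, and \<open>X\<close> under eps_t collapses to
  Delta(1), whose legs multiply to 1. For \<open>F\<close> this yields the unit law, for its inverse
  the counit law.\<close>

lemma balanced_unit:
  assumes X: "K_balanced X" and z: "z \<in> K"
  shows "(\<Sum>x y\<in>X. et (x * z) * y) = z" "(\<Sum>x y\<in>X. et (y * z) * x) = z"
proof -
  have b: "bil sH (\<lambda>x y. et x * y)" "bil sH (\<lambda>x y. et y * x)"
     "bil sH (\<lambda>x y. y * x)" by (intro lin_rules)+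
  have "(\<Sum>x y\<in>X. et (x * z) * y) = (\<Sum>x y\<in>X. z * (et x * y))"
    using balanced_K(1,2)[OF X b(1) z] K_comm[OF et_in_K z] by (simp add: mult.assoc[symmetric])
  also have "\<dots> = z"
    by (simp add: tsum_times_left[symmetric] balanced_et(2)[OF X mult_bil] E_mult)
  finally show "(\<Sum>x y\<in>X. et (x * z) * y) = z" .
  have "(\<Sum>x y\<in>X. et (y * z) * x) = (\<Sum>x y\<in>X. z * (et y * x))"
    using balanced_K(3)[OF X b(2) z] K_comm[OF et_in_K z] by (simp add: mult.assoc[symmetric])
  also have "\<dots> = z * (\<Sum>x y\<in>D 1. y * x)"
    by (simp add: tsum_times_left[symmetric] balanced_et(1)[OF X b(3)])
  also have "(\<Sum>x y\<in>D 1. y * x) = 1"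
    using cocomm[OF mult_bil, of 1] E_mult by simp
  finally show "(\<Sum>x y\<in>X. et (y * z) * x) = z" by simp
qed

end

context cocycle_twist begin

abbreviation "Ht \<equiv> twist H F Fi"
abbreviation "Dt \<equiv> comult (twist H F Fi)"
abbreviation "St \<equiv> antipode (twist H F Fi)"
abbreviation "Adt \<equiv> adj (twist H F Fi)"
abbreviation "A \<equiv> centralizer_F H F Fi"

definition "v = (\<Sum>a b\<in>Fi. a * S b)"
definition "vi = (\<Sum>a b\<in>F. S a * b)"

lemma twist_simps [simp]:
  "scal Ht = sH" "counit Ht = cu" "Dt h = tmul (tmul Fi (D h)) F" "St h = v * S h * vi"
  by (simp_all add: twist_def v_def vi_def)

lemma F_Fi_ev: "bil sc f \<Longrightarrow> (\<Sum>x y\<in>F. \<Sum>p q\<in>Fi. f (x * p) (y * q)) = tsum f (D 1)"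
  and Fi_F_ev: "bil sc f \<Longrightarrow> (\<Sum>p q\<in>Fi. \<Sum>x y\<in>F. f (p * x) (q * y)) = tsum f (D 1)"
  using teq2_tsum[OF F_Fi] teq2_tsum[OF Fi_F] by (auto simp: tsum_tmul)

text \<open>The idempotent F F^-1 = Delta(1) disappears into Delta(h), so that \<open>F\<close>
  intertwines the two comultiplications.\<close>

lemma F_Dt: "teq2 sH (tmul F (Dt h)) (tmul (D h) F)"
proof -
  have "teq2 sH (tmul (tmul F Fi) (tmul (D h) F)) (tmul (D 1) (tmul (D h) F))"
    by (intro teq2_tmul F_Fi teq2_refl)
  also have "teq2 sH \<dots> (tmul (D h) F)"
    unfolding tmul_assoc[symmetric] by (intro teq2_tmul D_E_teq teq2_refl)
  finally show ?thesis by (simp add: tmul_assoc)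
qed

lemma Dt_Fi: "teq2 sH (tmul (Dt h) Fi) (tmul Fi (D h))"
proof -
  have "teq2 sH (tmul (tmul Fi (D h)) (tmul F Fi)) (tmul (tmul Fi (D h)) (D 1))"
    by (intro teq2_tmul F_Fi teq2_refl)
  also have "teq2 sH \<dots> (tmul Fi (D h))"
    unfolding tmul_assoc by (intro teq2_tmul D_E_teq teq2_refl)
  finally show ?thesis by (simp add: tmul_assoc)
qed

text \<open>F^-1 absorbs Delta(1), and F^-1 F is Delta(1) again. The counital maps and the tensor
  product over the base are therefore unaffected by the twist.\<close>

lemma Dt_1: "teq2 sH (Dt 1) (D 1)"
proof -
  have "teq2 sH (tmul (tmul Fi (D 1)) F) (tmul Fi F)"
    by (intro teq2_tmul Fi_E teq2_refl)
  also note Fi_F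
  finally show ?thesis by simp
qed

lemma Dt_1_ev: "bil sc f \<Longrightarrow> tsum f (Dt 1) = tsum f (D 1)"
  by (rule teq2_tsum[OF Dt_1])

lemma epst_twist: "epst Ht = et"
  unfolding epst_def[abs_def] twist_simps(1,2) by (rule ext, rule Dt_1_ev[of sH]) (intro lin_rules)

lemma epss_twist: "epss Ht = es"
  unfolding epss_def[abs_def] twist_simps(1,2) by (rule ext, rule Dt_1_ev[of sH]) (intro lin_rules)

lemma target_twist: "target_space Ht = K" and source_twist: "source_space Ht = source_space H"
  unfolding target_space_def source_space_def epst_twist epss_twist by auto

lemma unit_act_twist: "unit_act Ht h z = et (h * z)"
  by (simp add: unit_act_def epst_twist)

text \<open>Each product is F_12 F_23^-1 or F_23 F_12^-1 folded with antipodes. The cocycle identity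
  rewrites it with Delta on inner factors, which fold to values of eps_s and eps_t; once these are
  exchanged, \<open>F\<close> and its inverse collapse independently.\<close>

lemma vi_v: "vi * v = 1" and v_vi: "v * vi = 1"
proof -
  have swap: "es p * (et x * w) = et x * (es p * w)" for p x w
    using K_comm[OF es_in_K et_in_K, of p x] by (metis mult.assoc)
  have "vi * v = (\<Sum>x y\<in>F. \<Sum>p q\<in>Fi. S x * (y * p) * S q)"
    unfolding vi_def v_def by (simp add: tsum_times_left tsum_times_right mult.assoc tsum_commute[where t = Fi])
  also have "\<dots> = (\<Sum>p q\<in>Fi. \<Sum>a b\<in>D p. \<Sum>x y\<in>F. \<Sum>c d\<in>D y. S (a * x) * (b * c) * S (q * d))"
    by (rule F12_Fi23[of sH "\<lambda>a b c. S a * b * S c"]) (intro lin_rules)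
  also have "\<dots> = (\<Sum>p q\<in>Fi. \<Sum>x y\<in>F. \<Sum>a b\<in>D p. \<Sum>c d\<in>D y. S (a * x) * (b * c) * S (q * d))"
    by (rule tsum_cong, rule tsum_commute)
  also have "\<dots> = (\<Sum>p q\<in>Fi. \<Sum>x y\<in>F. S x * es p * et y * S q)"
  proof (rule tsum_cong, rule tsum_cong)
    fix p q x y
    have "S x * es p * et y * S q = (\<Sum>a b\<in>D p. S x * (S a * b) * (\<Sum>c d\<in>D y. c * S d) * S q)"
      unfolding S_id[symmetric] id_S[symmetric] tsum_times_left[of "S x"] tsum_times_right ..
    then show "(\<Sum>a b\<in>D p. \<Sum>c d\<in>D y. S (a * x) * (b * c) * S (q * d)) = S x * es p * et y * S q"
      by (simp add: S_mult tsum_times_left tsum_times_right mult.assoc)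
  qed
  also have "\<dots> = (\<Sum>p q\<in>Fi. (\<Sum>x y\<in>F. S x * et y) * (es p * S q))"
    by (simp add: tsum_times_right mult.assoc swap)
  also have "(\<Sum>x y\<in>F. S x * et y) = 1"
    using balanced_et(1)[OF F_balanced, of sH "\<lambda>x y. S x * y"] S_id[of 1] by (simp add: lin_rules es_1)
  also have "(\<Sum>p q\<in>Fi. 1 * (es p * S q)) = 1"
    using balanced_et(4)[OF Fi_balanced, of sH "\<lambda>x y. x * S y"] id_S[of 1] by (simp add: lin_rules et_1)
  finally show "vi * v = 1" .
  have "v * vi = (\<Sum>x y\<in>F. \<Sum>p q\<in>Fi. p * S (x * q) * y)"
    unfolding vi_def v_def by (simp add: tsum_times_left tsum_times_right mult.assoc S_mult)
  also have "\<dots> = (\<Sum>p q\<in>Fi. \<Sum>a b\<in>D q. \<Sum>x y\<in>F. \<Sum>c d\<in>D x. (p * c) * S (a * d) * (b * y))"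
    by (rule F23_Fi12[of sH "\<lambda>a b c. a * S b * c"]) (intro lin_rules)
  also have "\<dots> = (\<Sum>p q\<in>Fi. \<Sum>x y\<in>F. \<Sum>a b\<in>D q. \<Sum>c d\<in>D x. (p * c) * S (a * d) * (b * y))"
    by (rule tsum_cong, rule tsum_commute)
  also have "\<dots> = (\<Sum>p q\<in>Fi. \<Sum>x y\<in>F. p * et x * es q * y)"
  proof (rule tsum_cong, rule tsum_cong)
    fix p q x y
    have "p * et x * es q * y = (\<Sum>a b\<in>D q. p * (\<Sum>c d\<in>D x. c * S d) * (S a * b) * y)"
      unfolding S_id[symmetric] id_S[symmetric] tsum_times_left[of "p * _"] tsum_times_right ..
    then show "(\<Sum>a b\<in>D q. \<Sum>c d\<in>D x. (p * c) * S (a * d) * (b * y)) = p * et x * es q * y"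
      by (simp add: S_mult tsum_times_left tsum_times_right mult.assoc)
  qed
  also have "\<dots> = (\<Sum>p q\<in>Fi. (p * es q) * (\<Sum>x y\<in>F. et x * y))"
    by (simp add: tsum_times_left mult.assoc swap)
  also have "(\<Sum>x y\<in>F. et x * y) = 1"
    using balanced_et(2)[OF F_balanced mult_bil] by (simp add: E_mult)
  also have "(\<Sum>p q\<in>Fi. (p * es q) * 1) = 1"
    using balanced_et(3)[OF Fi_balanced mult_bil] by (simp add: E_mult)
  finally show "v * vi = 1" .
qed

lemma v_K: assumes z: "z \<in> K" shows "v * z = z * v" "vi * z = z * vi"
proof -
  have b: "bil sH (\<lambda>a b. a * S b)" by (intro lin_rules)
  show 1: "v * z = z * v"
    unfolding v_def tsum_times_left tsum_times_right
    using balanced_K(1)[OF Fi_balanced b z] by (simp add: S_mult S_K z mult.assoc)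
  have "vi * (v * z) * vi = vi * (z * v) * vi" by (simp add: 1)
  then show "vi * z = z * vi" by (metis mult.assoc v_vi vi_v mult_1_left mult_1_right)
qed

lemma inj_St: "inj St"
proof (rule injI)
  fix x y assume "St x = St y"
  then have "vi * (v * S x * vi) * v = vi * (v * S y * vi) * v" by simp
  then have "S x = S y" by (metis mult.assoc vi_v mult_1_left mult_1_right)
  then show "x = y" by (metis S_S)
qed

lemma inv_St: assumes z: "z \<in> K" shows "inv St z = z"
proof -
  have "St z = z"
    using v_K(1)[OF z] by (simp add: S_K z mult.assoc v_vi)
  then show ?thesis by (metis inj_St inv_f_f)
qed

section \<open>Algebra and coalgebra axioms of the cocycle Hopf algebra\<close>

lemma A_simps [simp]:
  "car A = C" "vscal A = sH" "act A = Ad" "mu A a b = (\<Sum>x y\<in>F. Ad x a * Ad y b)" "eta A z = z"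
  "eps A = et" "anti A = S"
  by (simp_all add: centralizer_F_def)

lemma A_eta: "eta A = (\<lambda>x. x)" and A_mu: "mu A = (\<lambda>a b. \<Sum>x y\<in>F. Ad x a * Ad y b)"
  by (simp_all add: centralizer_F_def)

lemma delta_def_ev:
  "tsum f (delta A a) = (\<Sum>e e'\<in>D 1. \<Sum>x y\<in>Fi. \<Sum>a1 a2\<in>D a. f (Ad e (Ad x a1)) (Ad e' (Ad y a2)))"
  by (simp add: centralizer_F_def tsum_tact tsum_concat_map tsum_map case_prod_beta)

text \<open>The projection by Delta(1) in the definition of \<open>delta\<close> is absorbed by
  F^-1, because Ad is multiplicative in the acting element.\<close>

lemma delta_ev:
  assumes f: "bil sc f"
  shows "tsum f (delta A a) = (\<Sum>x y\<in>Fi. \<Sum>a1 a2\<in>D a. f (Ad x a1) (Ad y a2))"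
proof -
  note [lin_rules] = bil_rules[OF f]
  show ?thesis
    unfolding delta_def_ev Ad_mult[symmetric]
    by (rule balanced_E(1)[OF Fi_balanced, of sc "\<lambda>x y. \<Sum>a1 a2\<in>D a. f (Ad x a1) (Ad y a2)"]) (intro lin_rules)
qed

lemma delta_C: "set (delta A a) \<subseteq> C \<times> C"
  unfolding centralizer_F_def tact_def by (auto simp: Ad_C)

lemma delta_tlinear: "tlinear sH (delta A)"
proof (rule tlinearI)
  fix f assume f: "bil ((*) :: 'k \<Rightarrow> _) f"
  note [lin_rules] = bil_rules[OF f]
  show "lin sH (*) (\<lambda>x. tsum f (delta A x))"
    unfolding delta_ev[OF f] by (intro lin_rules)
qed

lemmas lin_delta [lin_rules] = lin_tsum_tlinear[OF vs delta_tlinear]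

lemma mu_bil: "bil sH (mu A)"
  unfolding A_mu by (intro lin_rules)

lemma A_left_module: "left_module Ht sH C Ad"
  unfolding left_module_def using vs C_subspace Ad_bil Ad_C Ad_1 Ad_mult by simp

lemma mu_C: "mu A a b \<in> C"
  by (auto intro!: tsum_C C_mult Ad_C)

text \<open>The product is formed with \<open>F\<close>, so \<open>F_Dt\<close> exchanges the
  comultiplication that governs ordinary products in \<open>C\<close> for the twisted one.\<close>

lemma Ad_mu: "a \<in> C \<Longrightarrow> b \<in> C \<Longrightarrow> Ad h (mu A a b) = tsum (mu A) (tact Ht Ad h [(a, b)])"
proof -
  assume a: "a \<in> C" and b: "b \<in> C"
  have "tsum (mu A) (tact Ht Ad h [(a, b)]) = (\<Sum>p q\<in>Dt h. \<Sum>x y\<in>F. Ad (x * p) a * Ad (y * q) b)"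
    unfolding tsum_tact A_mu by (simp add: Ad_mult del: twist_simps)
  also have "\<dots> = (\<Sum>a' b'\<in>tmul F (Dt h). Ad a' a * Ad b' b)"
    unfolding tsum_tmul[of _ F] by (rule tsum_commute)
  also have "\<dots> = (\<Sum>a' b'\<in>tmul (D h) F. Ad a' a * Ad b' b)"
    by (rule teq2_tsum[OF F_Dt, of sH]) (intro lin_rules)
  also have "\<dots> = (\<Sum>x y\<in>F. \<Sum>p q\<in>D h. Ad (p * x) a * Ad (q * y) b)"
    unfolding tsum_tmul by (rule tsum_commute)
  also have "\<dots> = (\<Sum>x y\<in>F. Ad h (Ad x a * Ad y b))"
    by (simp add: Ad_prod[OF Ad_C] Ad_mult)
  also have "\<dots> = Ad h (mu A a b)"
    unfolding A_mu by (rule lin_tsum_apply[of sH sH "Ad h", symmetric]) (intro lin_rules)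
  finally show ?thesis by simp
qed

text \<open>By \<open>Ad_prod\<close>, the two bracketings are the two sides of the cocycle identity
  acting on \<open>a\<close>, \<open>b\<close> and \<open>c\<close>.\<close>

lemma mu_assoc: "mu A (mu A a b) c = mu A a (mu A b c)"
proof -
  have l: "Ad x (tsum g t) = (\<Sum>p q\<in>t. Ad x (g p q))" for x g t
    by (rule lin_tsum_apply[of sH sH]) (intro lin_rules)
  have "mu A (mu A a b) c = (\<Sum>x y\<in>F. \<Sum>u w\<in>F. \<Sum>p q\<in>D x. Ad (p * u) a * (Ad (q * w) b * Ad y c))"
    by (simp add: l Ad_prod[OF Ad_C] Ad_mult tsum_times_right mult.assoc)
  also have "\<dots> = (\<Sum>x y\<in>F. \<Sum>p q\<in>D x. \<Sum>u w\<in>F. Ad (p * u) a * (Ad (q * w) b * Ad y c))"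
    by (rule tsum_cong, rule tsum_commute)
  also have "\<dots> = (\<Sum>x y\<in>F. \<Sum>p q\<in>D y. \<Sum>u w\<in>F. Ad x a * (Ad (p * u) b * Ad (q * w) c))"
    by (rule cocycle_ev[of sH "\<lambda>x y z. Ad x a * (Ad y b * Ad z c)"]) (intro lin_rules)
  also have "\<dots> = (\<Sum>x y\<in>F. \<Sum>u w\<in>F. \<Sum>p q\<in>D y. Ad x a * (Ad (p * u) b * Ad (q * w) c))"
    by (rule tsum_cong, rule tsum_commute)
  also have "\<dots> = mu A a (mu A b c)"
    by (simp add: l Ad_prod[OF Ad_C] Ad_mult tsum_times_left mult.assoc)
  finally show ?thesis .
qed

lemma mu_unit:
  assumes z: "z \<in> K" shows "mu A z a = Ad z a" "mu A a z = Ad z a"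
proof -
  have l: "(\<Sum>p q\<in>t. Ad (g p q) a) = Ad (tsum g t) a" for g t
    by (rule lin_tsum_apply[of sH sH "\<lambda>x. Ad x a", symmetric]) (intro lin_rules)
  have "mu A z a = (\<Sum>x y\<in>F. Ad (et (x * z) * y) a)"
    by (simp add: Ad_K[OF z] Ad_mult Ad_K_C[OF et_in_K Ad_C])
  then show "mu A z a = Ad z a"
    by (simp only: l balanced_unit[OF F_balanced z])
  have "mu A a z = (\<Sum>x y\<in>F. Ad (et (y * z) * x) a)"
    by (simp add: Ad_K[OF z] Ad_mult Ad_K_C[OF et_in_K Ad_C] C_comm[OF Ad_C et_in_K])
  then show "mu A a z = Ad z a"
    by (simp only: l balanced_unit[OF F_balanced z])
qed

lemma A_algebra: "algebra_in Ht A"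
  unfolding algebra_in_def
proof (intro conjI ballI allI)
  show "left_module Ht (vscal A) (car A) (act A)" using A_left_module by simp
  show "bilinear_map (vscal A) (vscal A) (vscal A) (mu A)" using mu_bil by simp
  show "mu A a b \<in> car A" for a b using mu_C by simp
  show "a \<in> car A \<Longrightarrow> b \<in> car A \<Longrightarrow> act A h (mu A a b) = tsum (mu A) (tact Ht (act A) h [(a, b)])" for h a b
    using Ad_mu by simp
  show "module_morphism (scal Ht) (target_space Ht) (unit_act Ht) (vscal A) (car A) (act A) (eta A)"
    unfolding module_morphism_def A_eta target_twist unit_act_twist using lin_ident K_sub_C
    by (auto simp: Ad_K)
  show "mu A (mu A a b) c = mu A a (mu A b c)" for a b c by (rule mu_assoc)
  show "z \<in> target_space Ht \<Longrightarrow> mu A (eta A z) a = act A z a" for z a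
    using mu_unit(1) unfolding target_twist A_simps(5) A_simps(3) by simp
  show "z \<in> target_space Ht \<Longrightarrow> mu A a (eta A z) = act A (inv St z) a" for z a
    using mu_unit(2) inv_St unfolding target_twist A_simps(5) A_simps(3) by simp
qed

lemma delta_Ad: "teq2 sH (delta A (Ad h a)) (tact Ht Ad h (delta A a))"
proof (rule teq2I[OF vs])
  fix f assume f: "bil ((*) :: 'k \<Rightarrow> _) f"
  note [lin_rules] = bil_rules[OF f]
  have g: "bil (*) (\<lambda>p q. \<Sum>a1 a2\<in>D a. f (Ad p a1) (Ad q a2))"
    by (intro lin_rules)
  have b: "bil (*) (\<lambda>x y. f (Ad p x) (Ad q y))" for p q by (intro lin_rules)
  have "tsum f (delta A (Ad h a)) = (\<Sum>p q\<in>tmul Fi (D h). \<Sum>a1 a2\<in>D a. f (Ad p a1) (Ad q a2))"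
    unfolding delta_ev[OF f] D_Ad[OF b] tsum_tmul Ad_mult ..
  also have "\<dots> = (\<Sum>p q\<in>tmul (Dt h) Fi. \<Sum>a1 a2\<in>D a. f (Ad p a1) (Ad q a2))"
    by (rule teq2_tsum[OF Dt_Fi g, symmetric])
  also have "\<dots> = tsum f (tact Ht Ad h (delta A a))"
    unfolding tsum_tmul[of _ _ Fi] tsum_tact delta_ev[OF b] Ad_mult ..
  finally show "tsum f (delta A (Ad h a)) = tsum f (tact Ht Ad h (delta A a))" .
qed

lemma delta_in_tens: "in_tens_t Ht sH C Ad (delta A a)"
proof -
  let ?u = "[(Ad x a1, Ad y a2). (x, y) \<leftarrow> Fi, (a1, a2) \<leftarrow> D a]"
  have "teq2 sH (delta A a) (tens_t Ht Ad ?u)"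
  proof (rule teq2I[OF vs])
    fix f assume f: "bil ((*) :: 'k \<Rightarrow> _) f"
    note [lin_rules] = bil_rules[OF f]
    show "tsum f (delta A a) = tsum f (tens_t Ht Ad ?u)"
      unfolding centralizer_F_def hopf_data.simps tsum_tact
      by (rule Dt_1_ev[of "(*)", symmetric]) (intro lin_rules)
  qed
  moreover have "set ?u \<subseteq> C \<times> C" by (auto simp: Ad_C)
  ultimately show ?thesis unfolding in_tens_t_def by blast
qed

text \<open>Most steps reorder sums. \<open>D_Ad\<close> moves the adjoint actions out of the
  comultiplication, so that the inverse cocycle identity and the coassociativity of \<open>H\<close>
  act on separate variables.\<close>

lemma delta_coassoc: "teq3 sH (map_left (delta A) (delta A a)) (map_right (delta A) (delta A a))"
proof (rule teq3I[OF vs])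
  fix f assume f: "tri ((*) :: 'k \<Rightarrow> _) f"
  note [lin_rules] = tri_rules[OF f]
  have b: "bil (*) (\<lambda>p q. f p q y)" "bil (*) (\<lambda>p q. f y p q)"
    "bil (*) (\<lambda>x y. \<Sum>p q\<in>delta A x. f p q y)"
    "bil (*) (\<lambda>x y. \<Sum>p q\<in>delta A y. f x p q)" for y by (intro lin_rules)+
  have b': "bil (*) (\<lambda>p q. f (Ad u p) (Ad w q) y)" "bil (*) (\<lambda>p q. f y (Ad u p) (Ad w q))"
    for y u w by (intro lin_rules)+
  let ?g = "\<lambda>p q y A B C. f (Ad A p) (Ad B q) (Ad C y)"
  have "tsum3 f (map_left (delta A) (delta A a)) =
    (\<Sum>x y\<in>Fi. \<Sum>a1 a2\<in>D a. \<Sum>u w\<in>Fi. \<Sum>x1 x2\<in>D x. \<Sum>p q\<in>D a1. ?g p q a2 (u * x1) (w * x2) y)"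
    unfolding tsum3_map_left delta_ev[OF b(3)] unfolding delta_ev[OF b(1)] D_Ad[OF b'(1)] Ad_mult ..
  also have "\<dots> = (\<Sum>x y\<in>Fi. \<Sum>a1 a2\<in>D a. \<Sum>u w\<in>Fi. \<Sum>p q\<in>D a1. \<Sum>x1 x2\<in>D x. ?g p q a2 (u * x1) (w * x2) y)"
    by (rule tsum_cong, rule tsum_cong, rule tsum_cong, rule tsum_commute)
  also have "\<dots> = (\<Sum>x y\<in>Fi. \<Sum>a1 a2\<in>D a. \<Sum>p q\<in>D a1. \<Sum>u w\<in>Fi. \<Sum>x1 x2\<in>D x. ?g p q a2 (u * x1) (w * x2) y)"
    by (rule tsum_cong, rule tsum_cong, rule tsum_commute)
  also have "\<dots> = (\<Sum>a1 a2\<in>D a. \<Sum>x y\<in>Fi. \<Sum>p q\<in>D a1. \<Sum>u w\<in>Fi. \<Sum>x1 x2\<in>D x. ?g p q a2 (u * x1) (w * x2) y)"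
    by (rule tsum_commute)
  also have "\<dots> = (\<Sum>a1 a2\<in>D a. \<Sum>p q\<in>D a1. \<Sum>x y\<in>Fi. \<Sum>u w\<in>Fi. \<Sum>x1 x2\<in>D x. ?g p q a2 (u * x1) (w * x2) y)"
    by (rule tsum_cong, rule tsum_commute)
  also have "\<dots> = (\<Sum>a1 a2\<in>D a. \<Sum>p q\<in>D a1. \<Sum>u w\<in>Fi. \<Sum>x y\<in>Fi. \<Sum>x1 x2\<in>D x. ?g p q a2 (u * x1) (w * x2) y)"
    by (rule tsum_cong, rule tsum_cong, rule tsum_commute)
  also have "\<dots> = (\<Sum>a1 a2\<in>D a. \<Sum>p q\<in>D a1. \<Sum>u w\<in>Fi. \<Sum>x y\<in>Fi. \<Sum>y1 y2\<in>D y. ?g p q a2 x (u * y1) (w * y2))"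
    by (rule tsum_cong, rule tsum_cong, rule inverse_cocycle[of "(*)" "?g _ _ _"]) (intro lin_rules)
  also have "\<dots> = (\<Sum>a1 a2\<in>D a. \<Sum>p q\<in>D a2. \<Sum>u w\<in>Fi. \<Sum>x y\<in>Fi. \<Sum>y1 y2\<in>D y. ?g a1 p q x (u * y1) (w * y2))"
    by (rule coassoc[of "(*)" "\<lambda>p q a2. \<Sum>u w\<in>Fi. \<Sum>x y\<in>Fi. \<Sum>y1 y2\<in>D y.
          ?g p q a2 x (u * y1) (w * y2)"]) (intro lin_rules)
  also have "\<dots> = (\<Sum>a1 a2\<in>D a. \<Sum>p q\<in>D a2. \<Sum>x y\<in>Fi. \<Sum>u w\<in>Fi. \<Sum>y1 y2\<in>D y. ?g a1 p q x (u * y1) (w * y2))"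
    by (rule tsum_cong, rule tsum_cong, rule tsum_commute)
  also have "\<dots> = (\<Sum>a1 a2\<in>D a. \<Sum>x y\<in>Fi. \<Sum>p q\<in>D a2. \<Sum>u w\<in>Fi. \<Sum>y1 y2\<in>D y. ?g a1 p q x (u * y1) (w * y2))"
    by (rule tsum_cong, rule tsum_commute)
  also have "\<dots> = (\<Sum>x y\<in>Fi. \<Sum>a1 a2\<in>D a. \<Sum>p q\<in>D a2. \<Sum>u w\<in>Fi. \<Sum>y1 y2\<in>D y. ?g a1 p q x (u * y1) (w * y2))"
    by (rule tsum_commute)
  also have "\<dots> = (\<Sum>x y\<in>Fi. \<Sum>a1 a2\<in>D a. \<Sum>u w\<in>Fi. \<Sum>p q\<in>D a2. \<Sum>y1 y2\<in>D y. ?g a1 p q x (u * y1) (w * y2))"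
    by (rule tsum_cong, rule tsum_cong, rule tsum_commute)
  also have "\<dots> = (\<Sum>x y\<in>Fi. \<Sum>a1 a2\<in>D a. \<Sum>u w\<in>Fi. \<Sum>y1 y2\<in>D y. \<Sum>p q\<in>D a2. ?g a1 p q x (u * y1) (w * y2))"
    by (rule tsum_cong, rule tsum_cong, rule tsum_cong, rule tsum_commute)
  also have "\<dots> = tsum3 f (map_right (delta A) (delta A a))"
    unfolding tsum3_map_right delta_ev[OF b(4)] unfolding delta_ev[OF b(2)] D_Ad[OF b'(2)] Ad_mult ..
  finally show "tsum3 f (map_left (delta A) (delta A a)) = tsum3 f (map_right (delta A) (delta A a))" .
qed

lemma delta_counit:
  assumes a: "a \<in> C"
  shows "(\<Sum>x y\<in>delta A a. Ad (et x) y) = a" "(\<Sum>x y\<in>delta A a. Ad (et y) x) = a"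
proof -
  have l: "(\<Sum>p q\<in>t. Ad (g p q) c) = Ad (tsum g t) c" for g t c
    by (rule lin_tsum_apply[of sH sH "\<lambda>x. Ad x c", symmetric]) (intro lin_rules)
  have e: "et (Ad x c) = et (x * et c)" if "c \<in> C" for x c
    by (simp add: et_Ad[OF that] et_mult_et)
  have b: "bil sH (\<lambda>x y. Ad (et x) y)" "bil sH (\<lambda>x y. Ad (et y) x)" by (intro lin_rules)+
  have b': "bil sH (\<lambda>a1 a2. Ad (et (Ad x a1)) (Ad y a2))" "bil sH (\<lambda>a1 a2. Ad (et (Ad y a2)) (Ad x a1))"
    for x y by (intro lin_rules)+
  have m: "bil sH (\<lambda>x y. et x * y)" "bil sH (\<lambda>x y. et y * x)" by (intro lin_rules)+
  \<comment> \<open>\<open>comult_C\<close> replaces the legs of Delta(a) by elements of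
    \<open>C\<close>, as required for commuting eps_t with the adjoint action.\<close>
  have "(\<Sum>x y\<in>delta A a. Ad (et x) y) = (\<Sum>x y\<in>Fi. \<Sum>p q\<in>D 1. \<Sum>a1 a2\<in>D a.
        Ad (et (x * et (Ad p a1)) * y) (Ad q a2))"
    unfolding delta_ev[OF b(1)] comult_C[OF b'(1) a] e[OF Ad_C] Ad_mult ..
  also have "\<dots> = (\<Sum>p q\<in>D 1. \<Sum>a1 a2\<in>D a. \<Sum>x y\<in>Fi. Ad (et (x * et (Ad p a1)) * y) (Ad q a2))"
    unfolding tsum_commute[where t = Fi] ..
  also have "\<dots> = (\<Sum>p q\<in>D 1. \<Sum>a1 a2\<in>D a. et (Ad p a1) * Ad q a2)"
    unfolding l balanced_unit[OF Fi_balanced et_in_K] Ad_K_C[OF et_in_K Ad_C] ..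
  also have "\<dots> = a"
    unfolding comult_C[OF m(1) a, symmetric] et_mult ..
  finally show "(\<Sum>x y\<in>delta A a. Ad (et x) y) = a" .
  have "(\<Sum>x y\<in>delta A a. Ad (et y) x) = (\<Sum>x y\<in>Fi. \<Sum>p q\<in>D 1. \<Sum>a1 a2\<in>D a.
        Ad (et (y * et (Ad q a2)) * x) (Ad p a1))"
    unfolding delta_ev[OF b(2)] comult_C[OF b'(2) a] e[OF Ad_C] Ad_mult ..
  also have "\<dots> = (\<Sum>p q\<in>D 1. \<Sum>a1 a2\<in>D a. \<Sum>x y\<in>Fi. Ad (et (y * et (Ad q a2)) * x) (Ad p a1))"
    unfolding tsum_commute[where t = Fi] ..
  also have "\<dots> = (\<Sum>p q\<in>D 1. \<Sum>a1 a2\<in>D a. et (Ad q a2) * Ad p a1)"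
    unfolding l balanced_unit[OF Fi_balanced et_in_K] Ad_K_C[OF et_in_K Ad_C] ..
  also have "\<dots> = a"
    unfolding comult_C[OF m(2) a, symmetric] using cocomm[OF m(1), of a] et_mult by simp
  finally show "(\<Sum>x y\<in>delta A a. Ad (et y) x) = a" .
qed

lemma A_coalgebra: "coalgebra_in Ht A"
  unfolding coalgebra_in_def
proof (intro conjI ballI allI)
  show "left_module Ht (vscal A) (car A) (act A)" using A_left_module by simp
  show "tlinear (vscal A) (delta A)" using delta_tlinear by simp
  show "in_tens_t Ht (vscal A) (car A) (act A) (delta A a)" for a using delta_in_tens by simp
  show "teq2 (vscal A) (delta A (act A h a)) (tact Ht (act A) h (delta A a))" for h a using delta_Ad by simp
  show "module_morphism (vscal A) (car A) (act A) (scal Ht) (target_space Ht) (unit_act Ht) (eps A)"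
    unfolding module_morphism_def target_twist unit_act_twist using et_lin et_in_K et_Ad et_mult_et by simp
  show "teq3 (vscal A) (map_left (delta A) (delta A a)) (map_right (delta A) (delta A a))" for a
    using delta_coassoc by simp
  fix a assume a: "a \<in> car A"
  show "(\<Sum>x y\<in>delta A a. act A (eps A x) y) = a"
    using a delta_counit(1) by simp
  show "(\<Sum>x y\<in>delta A a. act A (inv St (eps A y)) x) = a"
    using a delta_counit(2) unfolding A_simps inv_St[OF et_in_K] by simp
qed

end

section \<open>Braided bialgebra axioms and antipode of the cocycle Hopf algebra\<close>

context cocycle_twist begin

abbreviation "R \<equiv> twist_R (cocomm_R H) F Fi"

text \<open>The factor Delta^cop(1) Delta(1) equals Delta(1) and is absorbed by \<open>F\<close>, so
  the twisted R-matrix is F_21^-1 F.\<close>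

lemma R_ev:
  assumes f: "bil sc f"
  shows "tsum f R = (\<Sum>p q\<in>Fi. \<Sum>x y\<in>F. f (q * x) (p * y))"
proof -
  have e: "teq2 sH (tmul (tswap (D 1)) (D 1)) (D 1)"
    by (rule teq2_trans[OF teq2_tmul[OF E_swap teq2_refl] E_E])
  have "teq2 sH (tmul (tswap Fi) (tmul (tmul (tswap (D 1)) (D 1)) F)) (tmul (tswap Fi) (tmul (D 1) F))"
    by (intro teq2_tmul teq2_refl e)
  then have "teq2 sH R (tmul (tswap Fi) (tmul (D 1) F))"
    unfolding twist_R_def cocomm_R_def tmul_assoc .
  also have "teq2 sH \<dots> (tmul (tswap Fi) F)"
    by (intro teq2_tmul teq2_refl F_E)
  finally show ?thesis
    using teq2_tsum[OF _ f] by (simp add: tsum_tmul tsum_tswap)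
qed

lemma tsum_braided_mul:
  "tsum f (braided_mul Ht R A t u) = (\<Sum>e e'\<in>Dt 1. \<Sum>a b\<in>t. \<Sum>c d\<in>u. \<Sum>r1 r2\<in>R.
        f (Ad e (mu A a (Ad r2 c))) (Ad e' (mu A (Ad r1 b) d)))"
  unfolding braided_mul_def A_simps(3) by (simp add: tsum_tact tsum_concat_map tsum_map case_prod_beta del: A_simps twist_simps)

lemma D_mu:
  assumes h: "bil sc h"
  shows "tsum h (D (mu A a b)) = (\<Sum>x y\<in>F. \<Sum>x1 x2\<in>D x. \<Sum>a1 a2\<in>D a. \<Sum>y1 y2\<in>D y. \<Sum>b1 b2\<in>D b.
        h (Ad x1 a1 * Ad y1 b1) (Ad x2 a2 * Ad y2 b2))"
proof -
  note [lin_rules] = bil_rules[OF h]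
  have b: "bil sc (\<lambda>m n. \<Sum>c d\<in>D z. h (m * c) (n * d))"
    "bil sc (\<lambda>c d. h (m * c) (n * d))" for m n z by (intro lin_rules)+
  have "tsum h (D (mu A a b)) = (\<Sum>x y\<in>F. tsum h (D (Ad x a * Ad y b)))"
    unfolding A_simps(4) by (rule lin_tsum_apply[of sH sc "\<lambda>x. tsum h (D x)"]) (intro lin_rules h)
  also have "\<dots> = (\<Sum>x y\<in>F. \<Sum>x1 x2\<in>D x. \<Sum>a1 a2\<in>D a. \<Sum>y1 y2\<in>D y. \<Sum>b1 b2\<in>D b.
        h (Ad x1 a1 * Ad y1 b1) (Ad x2 a2 * Ad y2 b2))"
    unfolding D_mult[OF h] D_Ad[OF b(1)] unfolding D_Ad[OF b(2)] ..
  finally show ?thesis .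
qed

text \<open>With all adjoint actions collected, the left side is (Delta \<otimes> Delta)(F^-1) times
  (Delta \<otimes> Delta)(F), with differently grouped legs, acting on the legs of Delta(a) and
  Delta(b). The solved exchange identity factors it into two copies of \<open>F\<close> for the
  products, the R-matrix for the braiding and two copies of F^-1 for the comultiplications.\<close>

lemma delta_mu:
  assumes a: "a \<in> C" and b: "b \<in> C"
  shows "teq2 sH (delta A (mu A a b)) (braided_mul Ht R A (delta A a) (delta A b))"
proof (rule teq2I[OF vs])
  fix f assume f: "bil ((*) :: 'k \<Rightarrow> _) f"
  \<comment> \<open>Both sides carry the same projection to the tensor product over the base; it is
    kept inside \<open>f'\<close> so as not to interfere.\<close>
  define f' where "f' m n = (\<Sum>e e'\<in>D 1. f (Ad e m) (Ad e' n))" for m n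
  have f': "bil (*) f'"
  proof -
    note [lin_rules] = bil_rules[OF f]
    show ?thesis unfolding f'_def by (intro lin_rules)
  qed
  define g where "g a1 a2 b1 b2 A B C D = f' (Ad A a1 * Ad C b1) (Ad B a2 * Ad D b2)" for a1 a2 b1 b2 A B C D
  have g: "quad (*) (g a1 a2 b1 b2)" for a1 a2 b1 b2
  proof -
    note [lin_rules] = bil_rules[OF f']
    show ?thesis unfolding g_def by (intro lin_rules)
  qed
  have "tsum f (delta A (mu A a b)) = (\<Sum>p q\<in>Fi. \<Sum>c1 c2\<in>D (mu A a b). f' (Ad p c1) (Ad q c2))"
    unfolding delta_def_ev f'_def tsum_commute[where t = "D 1"] ..
  also have "\<dots> = (\<Sum>p q\<in>Fi. \<Sum>x y\<in>F. \<Sum>x1 x2\<in>D x. \<Sum>a1 a2\<in>D a. \<Sum>y1 y2\<in>D y. \<Sum>b1 b2\<in>D b.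
        f' (Ad p (Ad x1 a1 * Ad y1 b1)) (Ad q (Ad x2 a2 * Ad y2 b2)))"
  proof -
    note [lin_rules] = bil_rules[OF f']
    have c: "bil (*) (\<lambda>c1 c2. f' (Ad p c1) (Ad q c2))" for p q by (intro lin_rules)
    show ?thesis by (rule tsum_cong, rule D_mu[OF c])
  qed
  also have "\<dots> = (\<Sum>p q\<in>Fi. \<Sum>x y\<in>F. \<Sum>x1 x2\<in>D x. \<Sum>a1 a2\<in>D a. \<Sum>y1 y2\<in>D y. \<Sum>b1 b2\<in>D b. \<Sum>p1 p2\<in>D p. \<Sum>q1 q2\<in>D q.
        g a1 a2 b1 b2 (p1 * x1) (q1 * x2) (p2 * y1) (q2 * y2))"
    unfolding Ad_prod[OF Ad_C] bil_tsum[OF f'] g_def Ad_mult ..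
  also have "\<dots> = (\<Sum>a1 a2\<in>D a. \<Sum>b1 b2\<in>D b. \<Sum>p q\<in>Fi. \<Sum>x y\<in>F. \<Sum>x1 x2\<in>D x. \<Sum>y1 y2\<in>D y. \<Sum>p1 p2\<in>D p. \<Sum>q1 q2\<in>D q.
        g a1 a2 b1 b2 (p1 * x1) (q1 * x2) (p2 * y1) (q2 * y2))"
    unfolding tsum_commute[where u = "D b"] unfolding tsum_commute[where u = "D a"] ..
  also have "\<dots> = (\<Sum>a1 a2\<in>D a. \<Sum>b1 b2\<in>D b. \<Sum>p q\<in>Fi. \<Sum>p1 p2\<in>D p. \<Sum>q1 q2\<in>D q. \<Sum>x y\<in>F. \<Sum>x1 x2\<in>D x. \<Sum>y1 y2\<in>D y.
        g a1 a2 b1 b2 (p1 * x1) (q1 * x2) (p2 * y1) (q2 * y2))"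
  proof (rule tsum_cong, rule tsum_cong, rule tsum_cong)
    fix a1 a2 b1 b2 p q
    show "(\<Sum>x y\<in>F. \<Sum>x1 x2\<in>D x. \<Sum>y1 y2\<in>D y. \<Sum>p1 p2\<in>D p. \<Sum>q1 q2\<in>D q.
          g a1 a2 b1 b2 (p1 * x1) (q1 * x2) (p2 * y1) (q2 * y2)) =
      (\<Sum>p1 p2\<in>D p. \<Sum>q1 q2\<in>D q. \<Sum>x y\<in>F. \<Sum>x1 x2\<in>D x. \<Sum>y1 y2\<in>D y.
            g a1 a2 b1 b2 (p1 * x1) (q1 * x2) (p2 * y1) (q2 * y2))"
      unfolding tsum_commute[where u = "D q"] unfolding tsum_commute[where u = "D p"] ..
  qed
  also have "\<dots> = (\<Sum>a1 a2\<in>D a. \<Sum>b1 b2\<in>D b. \<Sum>r t\<in>F. \<Sum>u w\<in>F. \<Sum>p q\<in>Fi. \<Sum>x y\<in>F. \<Sum>p1 q1\<in>Fi. \<Sum>p2 q2\<in>Fi.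
        g a1 a2 b1 b2 (u * p1) (r * q * x * q1) (w * p * y * p2) (t * q2))"
    by (rule tsum_cong, rule tsum_cong, rule cocycle_exchange_inverse_ev[OF g])
  also have "\<dots> = (\<Sum>a1 a2\<in>D a. \<Sum>b1 b2\<in>D b. \<Sum>p1 q1\<in>Fi. \<Sum>p2 q2\<in>Fi. \<Sum>p q\<in>Fi. \<Sum>x y\<in>F. \<Sum>u w\<in>F. \<Sum>r t\<in>F.
        g a1 a2 b1 b2 (u * p1) (r * q * x * q1) (w * p * y * p2) (t * q2))"
    by (rule tsum_cong, rule tsum_cong, rule tsum_permute6[symmetric])
  also have "\<dots> = (\<Sum>p1 q1\<in>Fi. \<Sum>a1 a2\<in>D a. \<Sum>p2 q2\<in>Fi. \<Sum>b1 b2\<in>D b. \<Sum>p q\<in>Fi. \<Sum>x y\<in>F. \<Sum>u w\<in>F. \<Sum>r t\<in>F.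
        g a1 a2 b1 b2 (u * p1) (r * q * x * q1) (w * p * y * p2) (t * q2))"
    unfolding tsum_commute[where u = "D b"] unfolding tsum_commute[where u = "D a"] ..
  also have "\<dots> = (\<Sum>p1 q1\<in>Fi. \<Sum>a1 a2\<in>D a. \<Sum>p2 q2\<in>Fi. \<Sum>b1 b2\<in>D b. \<Sum>r1 r2\<in>R.
        f' (mu A (Ad p1 a1) (Ad r2 (Ad p2 b1))) (mu A (Ad r1 (Ad q1 a2)) (Ad q2 b2)))"
  proof (rule tsum_cong, rule tsum_cong, rule tsum_cong, rule tsum_cong)
    fix p1 q1 a1 a2 p2 q2 b1 b2
    note [lin_rules] = bil_rules[OF f'] bil_rules[OF mu_bil]
    have "(\<Sum>r1 r2\<in>R. f' (mu A (Ad p1 a1) (Ad r2 (Ad p2 b1))) (mu A (Ad r1 (Ad q1 a2)) (Ad q2 b2))) =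
      (\<Sum>p q\<in>Fi. \<Sum>x y\<in>F. f' (mu A (Ad p1 a1) (Ad (p * y) (Ad p2 b1))) (mu A (Ad (q * x) (Ad q1 a2)) (Ad q2 b2)))"
      by (rule R_ev[of "(*)"]) (intro lin_rules)
    then show "(\<Sum>p q\<in>Fi. \<Sum>x y\<in>F. \<Sum>u w\<in>F. \<Sum>r t\<in>F.
          g a1 a2 b1 b2 (u * p1) (r * q * x * q1) (w * p * y * p2) (t * q2)) =
      (\<Sum>r1 r2\<in>R. f' (mu A (Ad p1 a1) (Ad r2 (Ad p2 b1))) (mu A (Ad r1 (Ad q1 a2)) (Ad q2 b2)))"
      by (simp add: bil_tsum[OF f'] g_def Ad_mult)
  qed
  also have "\<dots> = (\<Sum>m n\<in>delta A a. \<Sum>c d\<in>delta A b. \<Sum>r1 r2\<in>R. f' (mu A m (Ad r2 c)) (mu A (Ad r1 n) d))"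
  proof -
    note [lin_rules] = bil_rules[OF f'] bil_rules[OF mu_bil]
    have c: "bil (*) (\<lambda>c d. \<Sum>r1 r2\<in>R. f' (mu A a (Ad r2 c)) (mu A (Ad r1 b) d))" for a b
      by (intro lin_rules)
    have d: "bil (*) (\<lambda>a b'. \<Sum>c d\<in>delta A b. \<Sum>r1 r2\<in>R. f' (mu A a (Ad r2 c)) (mu A (Ad r1 b') d))"
      by (intro lin_rules)
    show ?thesis unfolding delta_ev[OF d] unfolding delta_ev[OF c] ..
  qed
  also have "\<dots> = (\<Sum>e e'\<in>D 1. \<Sum>m n\<in>delta A a. \<Sum>c d\<in>delta A b. \<Sum>r1 r2\<in>R.
        f (Ad e (mu A m (Ad r2 c))) (Ad e' (mu A (Ad r1 n) d)))"
    unfolding f'_def tsum_commute[where t = "D 1"] ..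
  also have "\<dots> = tsum f (braided_mul Ht R A (delta A a) (delta A b))"
  proof -
    note [lin_rules] = bil_rules[OF f]
    show ?thesis unfolding tsum_braided_mul by (rule Dt_1_ev[of "(*)", symmetric]) (intro lin_rules)
  qed
  finally show "tsum f (delta A (mu A a b)) = tsum f (braided_mul Ht R A (delta A a) (delta A b))" .
qed

text \<open>On \<open>C\<close> the map eps_t is multiplicative and commutes with Ad, where Ad acts
  on base elements through eps_t. This reduces the claim to base elements, settled by the unit
  law.\<close>

lemma et_mu:
  assumes a: "a \<in> C" and b: "b \<in> C" shows "et (mu A a b) = et a * et b"
proof -
  have m: "et (x * y) = et x * et y" if "x \<in> C" "y \<in> C" for x y
    using that by (metis C_comm K_comm et_in_K et_mult_et et_z_mult)
  have "et (mu A a b) = (\<Sum>x y\<in>F. Ad x (et a) * Ad y (et b))"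
    unfolding A_simps(4) lin_tsum_apply[OF et_lin]
    by (simp add: m Ad_C Ad_K et_in_K et_mult_et et_Ad a b)
  also have "\<dots> = mu A (et a) (et b)" by simp
  also have "\<dots> = et a * et b"
    unfolding mu_unit(1)[OF et_in_K] by (rule Ad_K_C[OF et_in_K]) (use et_in_K K_sub_C in blast)
  finally show ?thesis .
qed

text \<open>On base elements Ad is multiplication followed by eps_t, so the second leg of F^-1
  occurs only under eps_t and F^-1 collapses to Delta(1); the factor \<open>w\<close> is then moved
  to the other leg.\<close>

lemma delta_K:
  assumes z: "z \<in> K" and w: "w \<in> K"
  shows "teq2 sH (delta A (z * w)) (tens_t Ht Ad [(z, w)])"
proof (rule teq2I[OF vs])
  fix f assume f: "bil ((*) :: 'k \<Rightarrow> _) f"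
  note [lin_rules] = bil_rules[OF f]
  have b: "bil (*) (\<lambda>x y. f (Ad p x) (Ad q y))" for p q by (intro lin_rules)
  let ?c = "z * w"
  have c: "?c \<in> K" using K_mult[OF z w] .
  have "tsum f (delta A ?c) = (\<Sum>x y\<in>Fi. \<Sum>e e'\<in>D 1. f (Ad x (e * ?c)) (Ad y e'))"
    unfolding delta_ev[OF f] D_K(1)[OF b c] ..
  also have "\<dots> = (\<Sum>x y\<in>Fi. \<Sum>e e'\<in>D 1. f (et ((x * e) * ?c)) (et (y * e')))"
    by (rule tsum_cong, rule E_K[of "(*)"])
      ((intro lin_rules)+, simp add: Ad_K K_mult c mult.assoc, intro lin_rules)
  also have "\<dots> = (\<Sum>x y\<in>Fi. f (et (x * ?c)) (et y))"
    by (rule balanced_E(2)[OF Fi_balanced, of "(*)" "\<lambda>p q. f (et (p * ?c)) (et q)"]) (intro lin_rules)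
  also have "\<dots> = (\<Sum>e e'\<in>D 1. f (et (e * ?c)) e')"
    by (rule balanced_et(1)[OF Fi_balanced, of "(*)" "\<lambda>p q. f (et (p * ?c)) q"]) (intro lin_rules)
  also have "\<dots> = (\<Sum>e e'\<in>D 1. f (e * w * z) e')"
    by (rule E_K[of "(*)"])
      ((intro lin_rules)+, simp add: et_K K_mult c K_comm[OF z w] mult.assoc[symmetric], simp add: mult.assoc et_K K_mult z w, intro lin_rules)
  also have "\<dots> = (\<Sum>e e'\<in>D 1. f (e * z) (e' * w))"
  proof -
    have "bil (*) (\<lambda>e e'. f (e * z) e')" by (intro lin_rules)
    from D_K(1,3)[OF this w] show ?thesis by simp
  qed
  also have "\<dots> = (\<Sum>e e'\<in>D 1. f (Ad e z) (Ad e' w))"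
    by (rule E_K[of "(*)"]) ((intro lin_rules)+, simp add: Ad_K et_K K_mult z w, intro lin_rules)
  also have "\<dots> = tsum f (tens_t Ht Ad [(z, w)])"
    unfolding tsum_tact tsum_Cons tsum_Nil fst_conv snd_conv add_0_right
    by (rule Dt_1_ev[of "(*)", symmetric]) (intro lin_rules)
  finally show "tsum f (delta A ?c) = tsum f (tens_t Ht Ad [(z, w)])" .
qed

lemma A_bialgebra: "bialgebra_in Ht R A"
  unfolding bialgebra_in_def
proof (intro conjI ballI allI)
  show "algebra_in Ht A" "coalgebra_in Ht A" by (rule A_algebra A_coalgebra)+
  show "a \<in> car A \<Longrightarrow> b \<in> car A \<Longrightarrow>
      teq2 (vscal A) (delta A (mu A a b)) (braided_mul Ht R A (delta A a) (delta A b))" for a b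
    using delta_mu unfolding A_simps(1,2) by blast
  show "a \<in> car A \<Longrightarrow> b \<in> car A \<Longrightarrow> eps A (mu A a b) = unit_act Ht (eps A a) (eps A b)" for a b
    using et_mu[of a b] K_mult[OF et_in_K et_in_K] unfolding unit_act_twist A_simps(1,6) by (simp add: et_K del: A_simps)
  show "z \<in> target_space Ht \<Longrightarrow> w \<in> target_space Ht \<Longrightarrow>
      teq2 (vscal A) (delta A (eta A (unit_act Ht z w))) (tens_t Ht (act A) [(eta A z, eta A w)])" for z w
    using delta_K[of z w] K_mult[of z w] unfolding target_twist unit_act_twist A_simps(2,3,5) by (simp add: et_K)
qed

text \<open>The antipode commutes with Ad, so the \<open>F\<close> of the product meets the F^-1 of
  the comultiplication. What remains is the antipode axiom of \<open>H\<close> on \<open>C\<close>,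
  where eps_s and eps_t agree.\<close>

lemma A_antipode:
  assumes a: "a \<in> C"
  shows "(\<Sum>x y\<in>delta A a. mu A (S x) y) = et a" "(\<Sum>x y\<in>delta A a. mu A x (S y)) = et a"
proof -
  note [lin_rules] = bil_rules[OF mu_bil]
  have b: "bil sH (\<lambda>x y. mu A (S x) y)" "bil sH (\<lambda>x y. mu A x (S y))"
    by (intro lin_rules)+
  have m: "bil sH (\<lambda>x y. S x * y)" "bil sH (\<lambda>x y. x * S y)" by (intro lin_rules)+
  have "(\<Sum>x y\<in>delta A a. mu A (S x) y) =
      (\<Sum>x y\<in>Fi. \<Sum>a1 a2\<in>D a. \<Sum>u w\<in>F. Ad (u * x) (S a1) * Ad (w * y) a2)"
    unfolding delta_ev[OF b(1)] by (simp add: S_Ad Ad_mult)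
  also have "\<dots> = (\<Sum>u w\<in>F. \<Sum>x y\<in>Fi. \<Sum>a1 a2\<in>D a. Ad (u * x) (S a1) * Ad (w * y) a2)"
    unfolding tsum_commute[where u = F] ..
  also have "\<dots> = (\<Sum>e e'\<in>D 1. \<Sum>a1 a2\<in>D a. Ad e (S a1) * Ad e' a2)"
    by (rule F_Fi_ev[of sH "\<lambda>e e'. \<Sum>a1 a2\<in>D a. Ad e (S a1) * Ad e' a2"]) (intro lin_rules)
  also have "\<dots> = et a"
    unfolding S_Ad[symmetric] comult_C[OF m(1) a, symmetric] S_id es_C[OF a] ..
  finally show "(\<Sum>x y\<in>delta A a. mu A (S x) y) = et a" .
  have "(\<Sum>x y\<in>delta A a. mu A x (S y)) =
      (\<Sum>x y\<in>Fi. \<Sum>a1 a2\<in>D a. \<Sum>u w\<in>F. Ad (u * x) a1 * Ad (w * y) (S a2))"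
    unfolding delta_ev[OF b(2)] by (simp add: S_Ad Ad_mult)
  also have "\<dots> = (\<Sum>u w\<in>F. \<Sum>x y\<in>Fi. \<Sum>a1 a2\<in>D a. Ad (u * x) a1 * Ad (w * y) (S a2))"
    unfolding tsum_commute[where u = F] ..
  also have "\<dots> = (\<Sum>e e'\<in>D 1. \<Sum>a1 a2\<in>D a. Ad e a1 * Ad e' (S a2))"
    by (rule F_Fi_ev[of sH "\<lambda>e e'. \<Sum>a1 a2\<in>D a. Ad e a1 * Ad e' (S a2)"]) (intro lin_rules)
  also have "\<dots> = et a"
    unfolding S_Ad[symmetric] comult_C[OF m(2) a, symmetric] id_S ..
  finally show "(\<Sum>x y\<in>delta A a. mu A x (S y)) = et a" .
qed

lemma A_hopf: "hopf_algebra_in Ht R A"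
  unfolding hopf_algebra_in_def
proof (intro conjI ballI)
  show "bialgebra_in Ht R A" by (rule A_bialgebra)
  show "module_morphism (vscal A) (car A) (act A) (vscal A) (car A) (act A) (anti A)"
    unfolding module_morphism_def using S_lin S_C S_Ad by simp
  show "a \<in> car A \<Longrightarrow> (\<Sum>x y\<in>delta A a. mu A (anti A x) y) = eta A (eps A a)"
    "a \<in> car A \<Longrightarrow> (\<Sum>x y\<in>delta A a. mu A x (anti A y)) = eta A (eps A a)" for a
    using A_antipode unfolding A_simps(1,5,6,7) by blast+
qed

end

context cocycle_twist begin

section \<open>The isomorphism\<close>

definition "alpha a = (\<Sum>x y\<in>F. Ad x a * y)"
definition "alpha_inv g = (\<Sum>x y\<in>F. x * g * v * S y)"

abbreviation "B \<equiv> centralizer_hopf Ht R"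

lemma alpha_lin: "lin sH sH alpha"
  unfolding alpha_def[abs_def] by (intro lin_rules)

lemmas lin_alpha [lin_rules] = lin_comp[OF _ alpha_lin]
lemma Adt_ev: "Adt h g = (\<Sum>p q\<in>Fi. \<Sum>a b\<in>D h. \<Sum>x y\<in>F. (p * a * x) * g * (v * S (q * b * y) * vi))"
  unfolding adj_def twist_simps tsum_tmul ..

lemma Adt_bil: "bil sH Adt"
proof -
  have "Adt = (\<lambda>h g. \<Sum>p q\<in>Fi. \<Sum>a b\<in>D h. \<Sum>x y\<in>F. (p * a * x) * g * (v * S (q * b * y) * vi))"
    by (intro ext) (rule Adt_ev)
  then show ?thesis by (simp only:) (intro lin_rules)
qed

lemma lin_Adt [lin_rules]:
  "lin s0 sH f \<Longrightarrow> lin s0 sH (\<lambda>x. Adt (f x) c)" "lin s0 sH f \<Longrightarrow> lin s0 sH (\<lambda>x. Adt c (f x))"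
  by (rule bil_lin1[OF Adt_bil] bil_lin2[OF Adt_bil], assumption)+

lemma lin_St [lin_rules]: "lin s0 sH f \<Longrightarrow> lin s0 sH (\<lambda>x. St (f x))"
  unfolding twist_simps by (intro lin_rules)

lemma Dt_tlinear: "tlinear sH Dt"
proof (rule tlinearI)
  fix f assume f: "bil ((*) :: 'k \<Rightarrow> _) f"
  note [lin_rules] = bil_rules[OF f]
  show "lin sH (*) (\<lambda>x. tsum f (Dt x))"
    unfolding twist_simps tsum_tmul by (intro lin_rules)
qed

lemmas lin_Dt [lin_rules] = lin_tsum_tlinear[OF vs Dt_tlinear]

text \<open>The leg identity for \<open>(\<Delta> \<otimes> id)(F)\<close> turns \<open>\<alpha>\<close> into a conjugation-like map, from which its inverse
  and its compatibility with the two adjoint actions can be read off.\<close>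
lemma alpha_eq: "alpha a = (\<Sum>p q\<in>Fi. p * a * S q) * vi"
proof -
  have "alpha a = (\<Sum>x y\<in>F. \<Sum>a1 a2\<in>D x. a1 * a * S a2 * y)"
    unfolding alpha_def adj_def tsum_times_right ..
  also have "\<dots> = (\<Sum>x y\<in>F. \<Sum>c d\<in>D y. \<Sum>u w\<in>F. \<Sum>p q\<in>Fi. (x * p) * a * S (c * u * q) * (d * w))"
    by (rule comult_left_F[of sH "\<lambda>a1 a2 y. a1 * a * S a2 * y"]) (intro lin_rules)
  also have "\<dots> = (\<Sum>x y\<in>F. \<Sum>u w\<in>F. \<Sum>p q\<in>Fi. \<Sum>c d\<in>D y. (x * p) * a * S (c * u * q) * (d * w))"
    unfolding tsum_commute[where t = "D _"] ..
  also have "\<dots> = (\<Sum>x y\<in>F. \<Sum>u w\<in>F. \<Sum>p q\<in>Fi. (x * p) * a * S q * S u * es y * w)"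
    by (simp add: S_mult S_id[symmetric] tsum_times_left tsum_times_right mult.assoc)
  \<comment> \<open>The second leg of the first \<open>F\<close> now occurs only under eps_s, so
    this \<open>F\<close> collapses to Delta(1).\<close>
  also have "\<dots> = (\<Sum>x y\<in>D 1. \<Sum>u w\<in>F. \<Sum>p q\<in>Fi. (x * p) * a * S q * S u * y * w)"
    by (rule balanced_et(3)[OF F_balanced, of sH "\<lambda>x y. \<Sum>u w\<in>F. \<Sum>p q\<in>Fi. (x * p) * a * S q * S u * y * w"])
      (intro lin_rules)
  also have "\<dots> = (\<Sum>x y\<in>D 1. \<Sum>p q\<in>Fi. (x * p) * a * S (y * q) * vi)"
  proof (rule E_K[of sH], (intro lin_rules)[1])
    fix x y assume y: "y \<in> K"
    have "bil sH (\<lambda>u w. S u * w)" by (intro lin_rules)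
    from balanced_K(1,2)[OF F_balanced this y]
    have *: "(\<Sum>u w\<in>F. S u * y * w) = y * vi"
      unfolding vi_def by (simp add: S_mult S_K y tsum_times_left mult.assoc)
    have "(\<Sum>u w\<in>F. \<Sum>p q\<in>Fi. (x * p) * a * S q * S u * y * w) = (\<Sum>p q\<in>Fi. (x * p) * a * S q * (\<Sum>u w\<in>F.
          S u * y * w))"
      by (rule HOL.trans[OF tsum_commute]) (simp add: tsum_times_left mult.assoc)
    then show "(\<Sum>u w\<in>F. \<Sum>p q\<in>Fi. (x * p) * a * S q * S u * y * w) = (\<Sum>p q\<in>Fi. (x * p) * a * S (y * q) * vi)"
      by (simp add: *[unfolded mult.assoc] S_mult S_K y mult.assoc)
  qed (intro lin_rules)
  also have "\<dots> = (\<Sum>p q\<in>Fi. p * a * S q * vi)"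
    by (rule balanced_E(1)[OF Fi_balanced, of sH "\<lambda>p q. p * a * S q * vi"]) (intro lin_rules)
  finally show ?thesis by (simp add: tsum_times_right)
qed

lemma alpha_v: "alpha a * v = (\<Sum>p q\<in>Fi. p * a * S q)"
  by (simp add: alpha_eq mult.assoc vi_v)

lemma F_v: "(\<Sum>u w\<in>F. u * v * S w) = 1"
proof -
  have "(\<Sum>u w\<in>F. u * v * S w) = (\<Sum>u w\<in>F. \<Sum>p q\<in>Fi. (u * p) * S (w * q))"
    unfolding v_def by (simp add: S_mult tsum_times_left tsum_times_right mult.assoc)
  also have "\<dots> = (\<Sum>e e'\<in>D 1. e * S e')"
    by (rule F_Fi_ev[of sH]) (intro lin_rules)
  finally show ?thesis by (simp add: id_S et_1)
qed

text \<open>The \<open>v\<close> in \<open>alpha_inv\<close> cancels the last factor of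
  \<open>alpha_eq\<close>, and \<open>F\<close> meets its inverse. The remaining Ad_1 is the
  identity on \<open>C\<close>.\<close>

lemma alpha_inv_alpha: "alpha_inv (alpha a) = Ad 1 a"
proof -
  have "alpha_inv (alpha a) = (\<Sum>x y\<in>F. x * (alpha a * v) * S y)"
    unfolding alpha_inv_def by (simp add: mult.assoc)
  also have "\<dots> = (\<Sum>x y\<in>F. \<Sum>p q\<in>Fi. (x * p) * a * S (y * q))"
    unfolding alpha_v by (simp add: S_mult tsum_times_left tsum_times_right mult.assoc)
  also have "\<dots> = (\<Sum>e e'\<in>D 1. e * a * S e')"
    by (rule F_Fi_ev[of sH]) (intro lin_rules)
  finally show ?thesis by (simp add: adj_def)
qed

lemma v_C: "v \<in> C"
  using v_K by (simp add: C_iff)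

lemma alpha_alpha_inv: assumes g: "g \<in> C" shows "alpha (alpha_inv g) = g"
proof -
  have "alpha (alpha_inv g) = (\<Sum>p q\<in>Fi. \<Sum>x y\<in>F. (p * x) * (g * v) * S (q * y)) * vi"
    unfolding alpha_eq alpha_inv_def by (simp add: S_mult tsum_times_left tsum_times_right mult.assoc)
  also have "(\<Sum>p q\<in>Fi. \<Sum>x y\<in>F. (p * x) * (g * v) * S (q * y)) = (\<Sum>e e'\<in>D 1. e * (g * v) * S e')"
    by (rule Fi_F_ev[of sH]) (intro lin_rules)
  also have "\<dots> = g * v"
    using Ad_1[OF C_mult[OF g v_C]] by (simp add: adj_def)
  finally show ?thesis by (simp add: mult.assoc v_vi)
qed

lemma alpha_C: "alpha a \<in> C" and alpha_inv_C: "alpha_inv g \<in> C"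
proof -
  have b: "bil sH (\<lambda>p q. p * a * S q)" "bil sH (\<lambda>p q. p * g * v * S q)"
    by (intro lin_rules)+
  have "alpha a * z = z * alpha a" "alpha_inv g * z = z * alpha_inv g" if z: "z \<in> K" for z
  proof -
    have "z * (\<Sum>p q\<in>Fi. p * a * S q) = (\<Sum>p q\<in>Fi. p * a * S q) * z"
      unfolding tsum_times_left tsum_times_right
      using balanced_K(1)[OF Fi_balanced b(1) z] by (simp add: S_mult S_K z mult.assoc)
    then show "alpha a * z = z * alpha a"
      unfolding alpha_eq mult.assoc[of _ vi z] v_K(2)[OF z] by (simp only: mult.assoc[symmetric])
    show "alpha_inv g * z = z * alpha_inv g"
      unfolding alpha_inv_def tsum_times_left tsum_times_right
      using balanced_K(1)[OF F_balanced b(2) z] by (simp add: S_mult S_K z mult.assoc)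
  qed
  then show "alpha a \<in> C" "alpha_inv g \<in> C" by (simp_all add: C_iff)
qed

lemma alpha_bij: "bij_betw alpha C C"
  by (rule bij_betw_byWitness[where f' = alpha_inv]) (use alpha_C alpha_inv_C alpha_alpha_inv alpha_inv_alpha Ad_1 in auto)

text \<open>In the expanded twisted adjoint action on g, the innermost part is
  \<open>alpha_inv g\<close> and the outermost part is \<open>alpha_eq\<close>; the action is thus
  the conjugate of Ad by \<open>alpha\<close>.\<close>

lemma alpha_Ad: "alpha (Ad h a) = Adt h (alpha a)"
proof -
  have "Adt h (alpha a) = (\<Sum>p q\<in>Fi. \<Sum>a' b\<in>D h. p * (a' * alpha_inv (alpha a) * S b) * S q * vi)"
    unfolding Adt_ev alpha_inv_def by (simp add: S_mult tsum_times_left tsum_times_right mult.assoc)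
  also have "\<dots> = (\<Sum>p q\<in>Fi. p * Ad h (Ad 1 a) * S q * vi)"
    unfolding alpha_inv_alpha by (simp add: adj_def[of H h] tsum_times_left tsum_times_right mult.assoc)
  also have "\<dots> = alpha (Ad h a)"
    unfolding alpha_eq Ad_mult[symmetric] by (simp add: tsum_times_right)
  finally show ?thesis by simp
qed

text \<open>The cocycle identity acts on \<open>a\<close>, \<open>b\<close> and the free third
  factor; the comultiplied leg then pulls through \<open>b\<close> by the smash product rule
  \<open>mult_Ad\<close>.\<close>

lemma alpha_mu: "alpha (mu A a b) = alpha a * alpha b"
proof -
  have l: "Ad x (tsum g t) = (\<Sum>p q\<in>t. Ad x (g p q))" for x g t
    by (rule lin_tsum_apply[of sH sH]) (intro lin_rules)
  have "alpha (mu A a b) = (\<Sum>x y\<in>F. \<Sum>u w\<in>F. \<Sum>p q\<in>D x. Ad (p * u) a * Ad (q * w) b * y)"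
    unfolding alpha_def A_simps(4) l Ad_prod[OF Ad_C] Ad_mult tsum_times_right ..
  also have "\<dots> = (\<Sum>x y\<in>F. \<Sum>p q\<in>D x. \<Sum>u w\<in>F. Ad (p * u) a * Ad (q * w) b * y)"
    by (rule tsum_cong, rule tsum_commute)
  also have "\<dots> = (\<Sum>x y\<in>F. \<Sum>c d\<in>D y. \<Sum>u w\<in>F. Ad x a * Ad (c * u) b * (d * w))"
    by (rule cocycle_ev[of sH "\<lambda>x y z. Ad x a * Ad y b * z"]) (intro lin_rules)
  also have "\<dots> = (\<Sum>x y\<in>F. \<Sum>u w\<in>F. \<Sum>c d\<in>D y. Ad x a * Ad (c * u) b * (d * w))"
    by (rule tsum_cong, rule tsum_commute)
  also have "\<dots> = (\<Sum>x y\<in>F. \<Sum>u w\<in>F. Ad x a * (y * Ad u b) * w)"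
    unfolding mult_Ad[OF Ad_C, of _ _ b] Ad_mult by (simp add: tsum_times_left tsum_times_right mult.assoc)
  also have "\<dots> = alpha a * alpha b"
    unfolding alpha_def[of a] tsum_times_right unfolding alpha_def tsum_times_left by (simp add: mult.assoc)
  finally show ?thesis .
qed

lemma alpha_K: "z \<in> K \<Longrightarrow> alpha z = z"
  unfolding alpha_def using balanced_unit(1)[OF F_balanced] by (simp add: Ad_K)

lemma alpha_Ad_K: assumes z: "z \<in> K" shows "alpha (Ad z a) = z * alpha a"
  using alpha_mu[of z a] unfolding mu_unit(1)[OF z] alpha_K[OF z] .

text \<open>The free second leg of \<open>F\<close> may be put under eps_t, which collapses
  \<open>F\<close> to Delta(1).\<close>

lemma et_alpha: assumes a: "a \<in> C" shows "et (alpha a) = et a"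
proof -
  have "et (alpha a) = (\<Sum>x y\<in>F. et (Ad x a * et y))"
    unfolding alpha_def lin_tsum_apply[OF et_lin] et_mult_et ..
  also have "\<dots> = (\<Sum>e e'\<in>D 1. et (Ad e a * e'))"
    by (rule balanced_et(1)[OF F_balanced, of sH "\<lambda>x y. et (Ad x a * y)"]) (intro lin_rules)
  also have "\<dots> = (\<Sum>e e'\<in>D 1. et (a * (e * e')))"
    by (rule E_K[of sH]) ((intro lin_rules)+, simp add: Ad_K_C a C_comm[OF a] mult.assoc[symmetric], intro lin_rules)
  also have "\<dots> = et a"
    unfolding lin_tsum_apply[OF et_lin, symmetric] tsum_times_left[symmetric] E_mult by simp
  finally show ?thesis .
qed

text \<open>The leg identity for F_13 F_21^-1 F_12 is folded with \<open>v\<close> and S in the last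
  two legs. One copy of \<open>F\<close> cancels by \<open>F_v\<close>; another then has its second
  leg under eps_t and collapses. The sum occurs both in the cancellation of R-matrices and in the
  antipode of \<open>B\<close>.\<close>

lemma twist_leg_identity:
  assumes f: "bil sc f"
  shows "(\<Sum>x0 y0\<in>F. \<Sum>p q\<in>Fi. \<Sum>x y\<in>F. f (x0 * q * x) (p * y * v * S y0)) =
    (\<Sum>p q\<in>Fi. \<Sum>a b\<in>D q. f a (p * S b))"
proof -
  note [lin_rules] = bil_rules[OF f]
  have l: "(\<Sum>u w\<in>t. f x (g u w)) = f x (tsum g t)" for x g t
    by (rule lin_tsum_apply[of sH sc "f x", symmetric]) (intro lin_rules)
  have "(\<Sum>x0 y0\<in>F. \<Sum>p q\<in>Fi. \<Sum>x y\<in>F. f (x0 * q * x) (p * y * v * S y0)) =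
    (\<Sum>p q\<in>Fi. \<Sum>a b\<in>D q. \<Sum>x y\<in>F. \<Sum>c d\<in>D y. \<Sum>u w\<in>F. f (a * x) (p * c * u * v * S (b * d * w)))"
    by (rule F13_Fi21_F12[of sc "\<lambda>a b c. f a (b * v * S c)"]) (intro lin_rules)
  also have "\<dots> = (\<Sum>p q\<in>Fi. \<Sum>a b\<in>D q. \<Sum>x y\<in>F. f (a * x) (p * et y * S b))"
  proof (rule tsum_cong, rule tsum_cong, rule tsum_cong)
    fix p q a b x y
    have "(\<Sum>c d\<in>D y. \<Sum>u w\<in>F. p * c * u * v * S (b * d * w)) = (\<Sum>c d\<in>D y. p * c * (\<Sum>u w\<in>F.
          u * v * S w) * S d * S b)"
      by (simp add: S_mult tsum_times_left tsum_times_right mult.assoc)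
    also have "\<dots> = p * et y * S b"
      unfolding F_v id_S[symmetric] by (simp add: tsum_times_left tsum_times_right mult.assoc)
    finally show "(\<Sum>c d\<in>D y. \<Sum>u w\<in>F. f (a * x) (p * c * u * v * S (b * d * w))) = f (a * x) (p * et y * S b)"
      unfolding l by simp
  qed
  also have "\<dots> = (\<Sum>p q\<in>Fi. \<Sum>a b\<in>D q. \<Sum>x y\<in>D 1. f (a * x) (p * y * S b))"
    by (rule tsum_cong, rule tsum_cong, rule balanced_et(1)[OF F_balanced, of sc "\<lambda>x y. f (_ * x) (_ * y * S _)"]) (intro lin_rules)
  also have "\<dots> = (\<Sum>p q\<in>Fi. \<Sum>a b\<in>D q. \<Sum>x y\<in>D 1. f (a * x) (p * S (b * y)))"
    by (rule tsum_cong, rule tsum_cong, rule E_K[of sc]) ((intro lin_rules)+, simp add: S_mult S_K mult.assoc, intro lin_rules)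
  also have "\<dots> = (\<Sum>p q\<in>Fi. \<Sum>a b\<in>D q. f a (p * S b))"
    by (rule tsum_cong, rule D_E_right[of sc "\<lambda>a b. f a (_ * S b)", symmetric]) (intro lin_rules)
  finally show ?thesis .
qed

text \<open>\<open>twist_leg_identity\<close> trades one R-matrix for a comultiplied F^-1. The
  inverse cocycle identity moves this comultiplication to where it folds to eps_t, and the last F^-1
  folds to \<open>v\<close>, which cancels \<open>vi\<close>. This is the form of R-matrix inversion
  that the comultiplication of \<open>B\<close> calls for.\<close>

lemma R_antipode:
  assumes f: "bil sc f"
  shows "(\<Sum>r1' r2'\<in>R. \<Sum>r1 r2\<in>R. f (r1 * r1') (r2' * St r2)) = tsum f (D 1)"
proof -
  note [lin_rules] = bil_rules[OF f]
  have b: "bil sc (\<lambda>r1 r2. f (r1 * r1') (r2' * St r2))"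
    "bil sc (\<lambda>r1' r2'. \<Sum>r1 r2\<in>R. f (r1 * r1') (r2' * St r2))" for r1' r2'
    by (intro lin_rules)+
  have "(\<Sum>r1' r2'\<in>R. \<Sum>r1 r2\<in>R. f (r1 * r1') (r2' * St r2)) =
    (\<Sum>p' q'\<in>Fi. \<Sum>x' y'\<in>F. \<Sum>p q\<in>Fi. \<Sum>x y\<in>F. f (q * x * (q' * x')) (p' * y' * St (p * y)))"
    unfolding R_ev[OF b(2)] unfolding R_ev[OF b(1)] ..
  also have "\<dots> = (\<Sum>p q\<in>Fi. \<Sum>x y\<in>F. \<Sum>p' q'\<in>Fi. \<Sum>x' y'\<in>F. f (q * (x * q' * x')) (p' * y' * v * S y * S p * vi))"
    unfolding twist_simps S_mult mult.assoc by (rule tsum_permute4(1))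
  also have "\<dots> = (\<Sum>p q\<in>Fi. \<Sum>p' q'\<in>Fi. \<Sum>a b\<in>D q'. f (q * a) (p' * S b * S p * vi))"
    by (rule tsum_cong, rule twist_leg_identity[of sc "\<lambda>a b. f (_ * a) (b * S _ * vi)"]) (intro lin_rules)
  also have "\<dots> = (\<Sum>p q\<in>Fi. \<Sum>p' q'\<in>Fi. \<Sum>a b\<in>D q'. f (q * b) (p' * S (p * a) * vi))"
    unfolding S_mult mult.assoc by (rule tsum_cong, rule tsum_cong, rule cocomm[of sc]) (intro lin_rules)
  also have "\<dots> = (\<Sum>p q\<in>Fi. \<Sum>p' q'\<in>Fi. \<Sum>a b\<in>D p'. f q' (p * a * S (q * b) * vi))"
    by (rule inverse_cocycle[of sc "\<lambda>a b c. f c (a * S b * vi)", symmetric]) (intro lin_rules)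
  also have "\<dots> = (\<Sum>p q\<in>Fi. \<Sum>p' q'\<in>Fi. f q' (p * et p' * S q * vi))"
  proof (rule tsum_cong, rule tsum_cong)
    fix p q p' q'
    have "(\<Sum>a b\<in>D p'. p * a * S (q * b) * vi) = p * et p' * S q * vi"
      unfolding id_S[symmetric] by (simp add: S_mult tsum_times_left tsum_times_right mult.assoc)
    then show "(\<Sum>a b\<in>D p'. f q' (p * a * S (q * b) * vi)) = f q' (p * et p' * S q * vi)"
      by (subst lin_tsum_apply[of sH sc "f q'", symmetric]) ((intro lin_rules)[1], simp)
  qed
  also have "\<dots> = (\<Sum>p q\<in>Fi. \<Sum>e e'\<in>D 1. f e' (p * e * S q * vi))"
    by (rule tsum_cong, rule balanced_et(2)[OF Fi_balanced, of sc "\<lambda>e e'. f e' (_ * e * S _ * vi)"]) (intro lin_rules)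
  also have "\<dots> = (\<Sum>e e'\<in>D 1. \<Sum>p q\<in>Fi. f e' (p * e * S q * vi))"
    by (rule tsum_commute)
  also have "\<dots> = (\<Sum>e e'\<in>D 1. f e' e)"
  proof (rule E_K[of sc], (intro lin_rules)[1])
    fix e e' assume e: "e \<in> K"
    have "bil sH (\<lambda>p q. p * S q)" by (intro lin_rules)
    from balanced_K(2)[OF Fi_balanced this e] have "(\<Sum>p q\<in>Fi. p * e * S q) = e * v"
      unfolding v_def by (simp add: tsum_times_left mult.assoc)
    then have "(\<Sum>p q\<in>Fi. p * e * S q * vi) = e * v * vi"
      unfolding tsum_times_right[symmetric] by simp
    then show "(\<Sum>p q\<in>Fi. f e' (p * e * S q * vi)) = f e' e"
      by (subst lin_tsum_apply[of sH sc "f e'", symmetric]) ((intro lin_rules)[1], simp add: mult.assoc v_vi)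
  qed (intro lin_rules)
  also have "\<dots> = tsum f (D 1)"
    by (rule cocomm[OF f, symmetric])
  finally show ?thesis .
qed

lemma D_alpha:
  assumes h: "bil sc h"
  shows "tsum h (D (alpha a)) = (\<Sum>x y\<in>F. \<Sum>x1 x2\<in>D x. \<Sum>a1 a2\<in>D a. \<Sum>y1 y2\<in>D y. h (Ad x1 a1 * y1) (Ad x2 a2 * y2))"
proof -
  note [lin_rules] = bil_rules[OF h]
  have b: "bil sc (\<lambda>m n. \<Sum>c d\<in>D z. h (m * c) (n * d))" for z by (intro lin_rules)
  have "tsum h (D (alpha a)) = (\<Sum>x y\<in>F. tsum h (D (Ad x a * y)))"
    unfolding alpha_def by (rule lin_tsum_apply[of sH sc "\<lambda>x. tsum h (D x)"]) (intro lin_rules h)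
  then show ?thesis unfolding D_mult[OF h] D_Ad[OF b] .
qed

text \<open>The comultiplication of \<open>A\<close> appears by letting F F^-1 = Delta(1) act on the
  legs of Delta(a): F^-1 is the one inside \<open>delta A\<close>, while \<open>F\<close> completes
  the exchange identity, whose R-matrix factor is shared between the two legs.\<close>

lemma Dt_alpha:
  assumes f: "bil sc f" and a: "a \<in> C"
  shows "tsum f (Dt (alpha a)) = (\<Sum>p q\<in>Fi. \<Sum>a1 a2\<in>D a. \<Sum>r1 r2\<in>R.
        f (alpha (Ad p a1) * r2) (alpha (Ad r1 (Ad q a2))))"
proof -
  note [lin_rules] = bil_rules[OF f]
  define g where "g a1 a2 A B C D = f (Ad A a1 * C) (Ad B a2 * D)" for a1 a2 A B C D
  have g: "quad sc (g a1 a2)" for a1 a2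
    unfolding g_def by (intro lin_rules)
  define G where "G a1 a2 = (\<Sum>p q\<in>Fi. \<Sum>p1 p2\<in>D p. \<Sum>q1 q2\<in>D q. \<Sum>x y\<in>F. \<Sum>x1 x2\<in>D x. \<Sum>y1 y2\<in>D y. \<Sum>r t\<in>F.
        g a1 a2 (p1 * x1) (q1 * x2) (p2 * y1 * r) (q2 * y2 * t))" for a1 a2
  have b: "bil sc (\<lambda>m n. \<Sum>r t\<in>F. f (p * m * r) (q * n * t))" for p q by (intro lin_rules)
  have G: "bil sc G"
    unfolding G_def g_def by (intro lin_rules)
  have e: "p * (Ad x a1 * y) * r = (\<Sum>p1 p2\<in>D p. Ad (p1 * x) a1 * (p2 * y * r))" for p x a1 y r
    by (simp add: mult.assoc[symmetric] mult_Ad[OF Ad_C] tsum_times_right Ad_mult)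
  have "tsum f (Dt (alpha a)) = (\<Sum>p q\<in>Fi. \<Sum>m n\<in>D (alpha a). \<Sum>r t\<in>F. f (p * m * r) (q * n * t))"
    by (simp add: tsum_tmul)
  also have "\<dots> = (\<Sum>p q\<in>Fi. \<Sum>x y\<in>F. \<Sum>x1 x2\<in>D x. \<Sum>a1 a2\<in>D a. \<Sum>y1 y2\<in>D y. \<Sum>r t\<in>F. \<Sum>p1 p2\<in>D p. \<Sum>q1 q2\<in>D q.
        g a1 a2 (p1 * x1) (q1 * x2) (p2 * y1 * r) (q2 * y2 * t))"
    unfolding D_alpha[OF b] e bil_tsum[OF f] g_def ..
  also have "\<dots> = (\<Sum>a1 a2\<in>D a. \<Sum>p q\<in>Fi. \<Sum>x y\<in>F. \<Sum>x1 x2\<in>D x. \<Sum>y1 y2\<in>D y. \<Sum>r t\<in>F. \<Sum>p1 p2\<in>D p. \<Sum>q1 q2\<in>D q.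
        g a1 a2 (p1 * x1) (q1 * x2) (p2 * y1 * r) (q2 * y2 * t))"
    unfolding tsum_commute[where u = "D a"] ..
  also have "\<dots> = tsum G (D a)"
    unfolding G_def
  proof (rule tsum_cong, rule tsum_cong)
    fix a1 a2 p q
    show "(\<Sum>x y\<in>F. \<Sum>x1 x2\<in>D x. \<Sum>y1 y2\<in>D y. \<Sum>r t\<in>F. \<Sum>p1 p2\<in>D p. \<Sum>q1 q2\<in>D q.
          g a1 a2 (p1 * x1) (q1 * x2) (p2 * y1 * r) (q2 * y2 * t)) =
      (\<Sum>p1 p2\<in>D p. \<Sum>q1 q2\<in>D q. \<Sum>x y\<in>F. \<Sum>x1 x2\<in>D x. \<Sum>y1 y2\<in>D y. \<Sum>r t\<in>F.
            g a1 a2 (p1 * x1) (q1 * x2) (p2 * y1 * r) (q2 * y2 * t))"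
      unfolding tsum_commute[where u = "D q"] unfolding tsum_commute[where u = "D p"] ..
  qed
  also have "\<dots> = (\<Sum>e e'\<in>D 1. \<Sum>a1 a2\<in>D a. G (Ad e a1) (Ad e' a2))"
    by (rule comult_C[OF G a])
  also have "\<dots> = (\<Sum>u w\<in>F. \<Sum>p q\<in>Fi. \<Sum>a1 a2\<in>D a. G (Ad (u * p) a1) (Ad (w * q) a2))"
  proof -
    note [lin_rules] = bil_rules[OF G]
    show ?thesis by (rule F_Fi_ev[of sc "\<lambda>e e'. \<Sum>a1 a2\<in>D a.
          G (Ad e a1) (Ad e' a2)", symmetric]) (intro lin_rules)
  qed
  also have "\<dots> = (\<Sum>p' q'\<in>Fi. \<Sum>a1 a2\<in>D a. \<Sum>p q\<in>Fi. \<Sum>p1 p2\<in>D p. \<Sum>q1 q2\<in>D q. \<Sum>x y\<in>F. \<Sum>x1 x2\<in>D x. \<Sum>y1 y2\<in>D y.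
        \<Sum>r t\<in>F. \<Sum>u w\<in>F. g (Ad p' a1) (Ad q' a2) (p1 * x1 * u) (q1 * x2 * w) (p2 * y1 * r) (q2 * y2 * t))"
    unfolding G_def by (subst tsum_move_in9) (simp only: g_def Ad_mult)
  also have "\<dots> = (\<Sum>p' q'\<in>Fi. \<Sum>a1 a2\<in>D a. \<Sum>r t\<in>F. \<Sum>u w\<in>F. \<Sum>p q\<in>Fi. \<Sum>x y\<in>F.
        g (Ad p' a1) (Ad q' a2) u (r * q * x) (w * p * y) t)"
    by (rule tsum_cong, rule tsum_cong, rule cocycle_exchange_ev[OF g])
  also have "\<dots> = (\<Sum>p' q'\<in>Fi. \<Sum>a1 a2\<in>D a. \<Sum>r1 r2\<in>R. f (alpha (Ad p' a1) * r2) (alpha (Ad r1 (Ad q' a2))))"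
  proof (rule tsum_cong, rule tsum_cong)
    fix p' q' a1 a2
    have "(\<Sum>r1 r2\<in>R. f (alpha (Ad p' a1) * r2) (alpha (Ad r1 (Ad q' a2)))) =
        (\<Sum>p q\<in>Fi. \<Sum>x y\<in>F. f (alpha (Ad p' a1) * (p * y)) (alpha (Ad (q * x) (Ad q' a2))))"
      by (rule R_ev[of sc]) (intro lin_rules)
    also have "\<dots> = (\<Sum>p q\<in>Fi. \<Sum>x y\<in>F. \<Sum>u w\<in>F. \<Sum>r t\<in>F. g (Ad p' a1) (Ad q' a2) u (r * q * x) (w * p * y) t)"
      unfolding alpha_def tsum_times_right bil_tsum[OF f] g_def Ad_mult mult.assoc ..
    also have "\<dots> = (\<Sum>r t\<in>F. \<Sum>u w\<in>F. \<Sum>p q\<in>Fi. \<Sum>x y\<in>F. g (Ad p' a1) (Ad q' a2) u (r * q * x) (w * p * y) t)"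
      by (rule tsum_permute4(2))
    finally show "(\<Sum>r t\<in>F. \<Sum>u w\<in>F. \<Sum>p q\<in>Fi. \<Sum>x y\<in>F. g (Ad p' a1) (Ad q' a2) u (r * q * x) (w * p * y) t) =
      (\<Sum>r1 r2\<in>R. f (alpha (Ad p' a1) * r2) (alpha (Ad r1 (Ad q' a2))))" by simp
  qed
  finally show ?thesis .
qed

lemma tsum_delta_B:
  "tsum f (delta B g) = (\<Sum>e e'\<in>Dt 1. \<Sum>g1 g2\<in>Dt g. \<Sum>r1 r2\<in>R. f (Adt e (g1 * St r2)) (Adt e' (Adt r1 g2)))"
  unfolding centralizer_hopf_def hopf_data.simps
  by (simp add: tsum_tact tsum_concat_map tsum_map case_prod_beta del: twist_simps)

text \<open>\<open>Dt_alpha\<close> contributes one R-matrix and the comultiplication of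
  \<open>B\<close> a second one under \<open>St\<close>. As \<open>alpha\<close> intertwines the two
  actions, they stand in the order in which \<open>R_antipode\<close> cancels them.\<close>

lemma delta_alpha:
  assumes a: "a \<in> C"
  shows "teq2 sH (map (map_prod alpha alpha) (delta A a)) (delta B (alpha a))"
proof (rule teq2I[OF vs])
  fix f assume f: "bil ((*) :: 'k \<Rightarrow> _) f"
  define f' where "f' m n = (\<Sum>e e'\<in>D 1. f (Adt e m) (Adt e' n))" for m n
  have f': "bil (*) f'"
  proof -
    note [lin_rules] = bil_rules[OF f]
    show ?thesis unfolding f'_def by (intro lin_rules)
  qed
  note [lin_rules] = bil_rules[OF f] bil_rules[OF f']
  have b: "bil (*) (\<lambda>m n. \<Sum>r1 r2\<in>R. f' (m * St r2) (Adt r1 n))" by (intro lin_rules)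
  have "tsum f (delta B (alpha a)) =
      (\<Sum>e e'\<in>D 1. \<Sum>g1 g2\<in>Dt (alpha a). \<Sum>r1 r2\<in>R. f (Adt e (g1 * St r2)) (Adt e' (Adt r1 g2)))"
    unfolding tsum_delta_B by (rule Dt_1_ev[of "(*)"]) (intro lin_rules)
  also have "\<dots> = (\<Sum>g1 g2\<in>Dt (alpha a). \<Sum>r1 r2\<in>R. f' (g1 * St r2) (Adt r1 g2))"
    unfolding f'_def tsum_commute[where t = "D 1"] ..
  also have "\<dots> = (\<Sum>p q\<in>Fi. \<Sum>a1 a2\<in>D a. \<Sum>r1' r2'\<in>R. \<Sum>r1 r2\<in>R.
        f' (alpha (Ad p a1) * (r2' * St r2)) (alpha (Ad (r1 * r1') (Ad q a2))))"
    unfolding Dt_alpha[OF b a] alpha_Ad[symmetric] Ad_mult mult.assoc ..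
  also have "\<dots> = (\<Sum>p q\<in>Fi. \<Sum>a1 a2\<in>D a. \<Sum>e e'\<in>D 1. f' (alpha (Ad p a1) * e') (alpha (Ad e (Ad q a2))))"
    by (rule tsum_cong, rule tsum_cong, rule R_antipode[of "(*)" "\<lambda>e e'. f' (alpha _ * e') (alpha (Ad e _))"]) (intro lin_rules)
  \<comment> \<open>The leftover Delta(1) consists of base elements, whose product with values of
    \<open>alpha\<close> is the adjoint action; F^-1 absorbs it further on.\<close>
  also have "\<dots> = (\<Sum>p q\<in>Fi. \<Sum>a1 a2\<in>D a. \<Sum>e e'\<in>D 1. f' (alpha (Ad e' (Ad p a1))) (alpha (Ad e (Ad q a2))))"
    by (rule tsum_cong, rule tsum_cong, rule E_K[of "(*)"])
      ((intro lin_rules)+, simp add: alpha_Ad_K C_comm[OF alpha_C], intro lin_rules)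
  also have "\<dots> = (\<Sum>p q\<in>Fi. \<Sum>a1 a2\<in>D a. \<Sum>e e'\<in>D 1. f' (alpha (Ad e (Ad p a1))) (alpha (Ad e' (Ad q a2))))"
    by (rule tsum_cong, rule tsum_cong, rule cocomm[of "(*)"]) (intro lin_rules)
  also have "\<dots> = (\<Sum>e e'\<in>D 1. \<Sum>p q\<in>Fi. \<Sum>a1 a2\<in>D a. f' (alpha (Ad (e * p) a1)) (alpha (Ad (e' * q) a2)))"
    unfolding tsum_commute[where u = "D 1"] Ad_mult ..
  also have "\<dots> = (\<Sum>p q\<in>Fi. \<Sum>a1 a2\<in>D a. f' (alpha (Ad p a1)) (alpha (Ad q a2)))"
    by (rule balanced_E(1)[OF Fi_balanced, of "(*)" "\<lambda>p q. \<Sum>a1 a2\<in>D a.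
          f' (alpha (Ad p a1)) (alpha (Ad q a2))"]) (intro lin_rules)
  also have "\<dots> = (\<Sum>e e'\<in>D 1. \<Sum>p q\<in>Fi. \<Sum>a1 a2\<in>D a. f (alpha (Ad e (Ad p a1))) (alpha (Ad e' (Ad q a2))))"
    unfolding f'_def alpha_Ad[symmetric] tsum_commute[where t = "D 1"] ..
  also have "\<dots> = tsum f (map (map_prod alpha alpha) (delta A a))"
    unfolding tsum_map by (simp add: delta_def_ev)
  finally show "tsum f (map (map_prod alpha alpha) (delta A a)) = tsum f (delta B (alpha a))" by simp
qed

lemma anti_B: "anti B g = (\<Sum>r1 r2\<in>R. r2 * St (Adt r1 g))"
  by (simp add: centralizer_hopf_def)

text \<open>\<open>St\<close> contributes the \<open>v\<close> that produces the sum of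
  \<open>twist_leg_identity\<close>; \<open>S_mult_Ad\<close> then frees S(a), and
  \<open>alpha_eq\<close> recognises the result.\<close>

lemma alpha_S: assumes a: "a \<in> C" shows "alpha (S a) = anti B (alpha a)"
proof -
  have c: "S a \<in> C" by (rule S_C[OF a])
  have "anti B (alpha a) = (\<Sum>r1 r2\<in>R. r2 * St (alpha (Ad r1 a)))"
    unfolding anti_B alpha_Ad ..
  also have "\<dots> = (\<Sum>p q\<in>Fi. \<Sum>x y\<in>F. p * y * St (alpha (Ad (q * x) a)))"
    by (rule R_ev[of sH]) (intro lin_rules)
  also have "\<dots> = (\<Sum>p q\<in>Fi. \<Sum>x y\<in>F. \<Sum>x0 y0\<in>F. p * y * v * S y0 * Ad (x0 * q * x) (S a) * vi)"
    unfolding alpha_def lin_tsum_apply[OF S_lin] twist_simps S_mult S_Ad tsum_times_left tsum_times_right Ad_mult mult.assoc ..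
  also have "\<dots> = (\<Sum>x0 y0\<in>F. \<Sum>p q\<in>Fi. \<Sum>x y\<in>F. p * y * v * S y0 * Ad (x0 * q * x) (S a) * vi)"
    by (rule tsum_rotate3)
  also have "\<dots> = (\<Sum>p q\<in>Fi. \<Sum>a' b\<in>D q. p * S b * Ad a' (S a) * vi)"
    by (rule twist_leg_identity[of sH "\<lambda>x y. y * Ad x (S a) * vi"]) (intro lin_rules)
  also have "\<dots> = (\<Sum>p q\<in>Fi. p * (S a * S q) * vi)"
    by (rule tsum_cong) (simp add: S_mult_Ad[OF c, symmetric] tsum_times_left tsum_times_right mult.assoc)
  also have "\<dots> = alpha (S a)"
    unfolding alpha_eq tsum_times_right by (simp add: mult.assoc)
  finally show ?thesis by simp
qed

end

section \<open>Transport of a Hopf algebra structure along a bijection\<close>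

text \<open>\<open>f\<close> is bijective only between the carriers, while formal sums live on the
  ambient spaces. Hence linearity of the structure maps of \<open>B\<close> is assumed on the
  ambient space, and \<open>legs\<close> keeps the entries of \<open>delta A a\<close> in the
  carrier, so that compatibility of \<open>f\<close> applies entry by entry.\<close>

locale hopf_transport =
  fixes G :: "('k::field, 'h::{ring, monoid_mult}) qgroupoid" and R :: "('h \<times> 'h) list"
    and A :: "('k, 'h, 'v::ab_group_add) hopf_data" and B :: "('k, 'h, 'w::ab_group_add) hopf_data"
    and f :: "'v \<Rightarrow> 'w"
  assumes hopf_A: "hopf_algebra_in G R A"
    and legs: "\<And>a. a \<in> car A \<Longrightarrow> set (delta A a) \<subseteq> car A \<times> car A"
    and f_morphism: "module_morphism (vscal A) (car A) (act A) (vscal B) (car B) (act B) f"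
    and f_bij: "bij_betw f (car A) (car B)"
    and f_mu: "\<And>a b. a \<in> car A \<Longrightarrow> b \<in> car A \<Longrightarrow> f (mu A a b) = mu B (f a) (f b)"
    and f_eta: "\<And>z. z \<in> target_space G \<Longrightarrow> f (eta A z) = eta B z"
    and f_delta: "\<And>a. a \<in> car A \<Longrightarrow> teq2 (vscal B) (map (map_prod f f) (delta A a)) (delta B (f a))"
    and f_eps: "\<And>a. a \<in> car A \<Longrightarrow> eps B (f a) = eps A a"
    and f_anti: "\<And>a. a \<in> car A \<Longrightarrow> f (anti A a) = anti B (f a)"
    and B_subspace: "module.subspace (vscal B) (car B)"
    and B_act: "bilinear_map (scal G) (vscal B) (vscal B) (act B)"
    and B_mu: "bilinear_map (vscal B) (vscal B) (vscal B) (mu B)"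
    and B_eta: "lin (scal G) (vscal B) (eta B)"
    and B_delta: "tlinear (vscal B) (delta B)"
    and B_eps: "lin (vscal B) (scal G) (eps B)"
    and B_anti: "lin (vscal B) (vscal B) (anti B)"
    and G_inv: "lin (scal G) (scal G) (inv (antipode G))"
begin

abbreviation "sA \<equiv> vscal A"
abbreviation "sB \<equiv> vscal B"

lemma f_lin: "lin sA sB f" and f_car: "a \<in> car A \<Longrightarrow> f a \<in> car B"
  and f_act: "a \<in> car A \<Longrightarrow> f (act A h a) = act B h (f a)"
  using f_morphism unfolding module_morphism_def by blast+

lemma vsB: "vector_space sB"
  by (rule lin_vs2[OF f_lin])

lemma bialgebra_A: "bialgebra_in G R A" and algebra_A: "algebra_in G A" and coalgebra_A: "coalgebra_in G A"
  using hopf_A unfolding hopf_algebra_in_def bialgebra_in_def by blast+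

lemma module_A: "left_module G sA (car A) (act A)"
  using algebra_A unfolding algebra_in_def by blast

lemma act_car: "a \<in> car A \<Longrightarrow> act A h a \<in> car A"
  using module_A unfolding left_module_def by blast

lemma mu_car: "a \<in> car A \<Longrightarrow> b \<in> car A \<Longrightarrow> mu A a b \<in> car A"
  using algebra_A unfolding algebra_in_def by blast

lemma eta_car: "z \<in> target_space G \<Longrightarrow> eta A z \<in> car A"
  using algebra_A unfolding algebra_in_def module_morphism_def by blast

lemma anti_car: "a \<in> car A \<Longrightarrow> anti A a \<in> car A"
  using hopf_A unfolding hopf_algebra_in_def module_morphism_def by blast

lemma unit_act_target: "unit_act G h z \<in> target_space G"
  unfolding unit_act_def target_space_def by blast

lemma from_A: "b \<in> car B \<Longrightarrow> \<exists>a\<in>car A. b = f a"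
  using f_bij unfolding bij_betw_def by blast

lemma bil_f: "bilinear_map sB sB sc g \<Longrightarrow> bilinear_map sA sA sc (\<lambda>x y. g (f x) (f y))"
  by (rule bil_comp_same[OF _ f_lin])

text \<open>The comultiplications correspond only up to tensor equality, so
  \<open>delta B (f a)\<close> can be replaced only inside a bilinear evaluation. The axioms of
  \<open>B\<close> that involve \<open>delta B\<close> all pass through this rule.\<close>

lemma tsum_delta_B:
  assumes g: "bilinear_map sB sB sc g" and a: "a \<in> car A"
  shows "tsum g (delta B (f a)) = (\<Sum>x y\<in>delta A a. g (f x) (f y))"
  using teq2_tsum[OF f_delta[OF a] g] by (simp add: tsum_map)

lemma tsum_legs_cong:
  assumes "a \<in> car A" "\<And>x y. x \<in> car A \<Longrightarrow> y \<in> car A \<Longrightarrow> g x y = h x y"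
  shows "tsum g (delta A a) = tsum h (delta A a)"
  using assms legs by (intro tsum_cong) blast

lemma lin_identB: "lin sB sB (\<lambda>x. x)"
  using vsB by (simp add: Vector_Spaces.linear_iff)

lemma lin_actB: "lin s0 sB g \<Longrightarrow> lin s0 sB (\<lambda>x. act B h (g x))"
  by (rule bil_lin2[OF B_act])

lemmas lin_B = bilI triI lin_identB lin_actB bil_lin1[OF B_mu] bil_lin2[OF B_mu] lin_tsum[OF vsB vsB] lin_tsum[OF vsB vector_space_field]
  lin_tsum_tlinear[OF vsB B_delta] lin_comp[OF _ B_anti]

lemma algebra_B: "algebra_in G B"
  unfolding algebra_in_def
proof (intro conjI ballI allI)
  have A1: "a \<in> car A \<Longrightarrow> act A 1 a = a" "a \<in> car A \<Longrightarrow> act A (h * l) a = act A h (act A l a)" for a h l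
    using module_A unfolding left_module_def by blast+
  have "act B h b \<in> car B" "act B 1 b = b" "act B (h * l) b = act B h (act B l b)" if b: "b \<in> car B" for b h l
  proof -
    obtain a where a: "a \<in> car A" "b = f a" using from_A[OF b] by blast
    show "act B h b \<in> car B" "act B 1 b = b" "act B (h * l) b = act B h (act B l b)"
      using a A1 f_act f_car act_car by metis+
  qed
  then show "left_module G sB (car B) (act B)"
    unfolding left_module_def using vsB B_subspace B_act by blast
  show "bilinear_map sB sB sB (mu B)" by (rule B_mu)
  have "lin (scal G) sB (eta B)" by (rule B_eta)
  moreover have "eta B z \<in> car B" if "z \<in> target_space G" for z
    using f_eta[OF that] f_car[OF eta_car[OF that]] by simp
  moreover have "eta B (unit_act G h z) = act B h (eta B z)" if z: "z \<in> target_space G" for h z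
  proof -
    have "eta A (unit_act G h z) = act A h (eta A z)"
      using algebra_A z unfolding algebra_in_def module_morphism_def by blast
    then show ?thesis using f_eta[OF z] f_eta[OF unit_act_target, of h z] f_act[OF eta_car[OF z]] by simp
  qed
  ultimately show "module_morphism (scal G) (target_space G) (unit_act G) sB (car B) (act B) (eta B)"
    unfolding module_morphism_def by blast
  show "mu B a b \<in> car B" if "a \<in> car B" "b \<in> car B" for a b
    using that from_A f_mu f_car mu_car by metis
  show "act B h (mu B a b) = tsum (mu B) (tact G (act B) h [(a, b)])" if ab: "a \<in> car B" "b \<in> car B" for h a b
  proof -
    obtain a' b' where a: "a' \<in> car A" "a = f a'" "b' \<in> car A" "b = f b'" using from_A ab by metis
    have "act B h (mu B a b) = f (act A h (mu A a' b'))"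
      using a f_act[OF mu_car] f_mu by simp
    also have "act A h (mu A a' b') = tsum (mu A) (tact G (act A) h [(a', b')])"
      using algebra_A a unfolding algebra_in_def by blast
    also have "f \<dots> = (\<Sum>p q\<in>comult G h. mu B (act B p a) (act B q b))"
      using a by (simp add: tsum_tact lin_tsum_apply[OF f_lin] f_mu act_car f_act)
    finally show ?thesis by (simp add: tsum_tact)
  qed
  show "mu B (mu B a b) c = mu B a (mu B b c)" if abc: "a \<in> car B" "b \<in> car B" "c \<in> car B" for a b c
  proof -
    obtain a' b' c' where a: "a' \<in> car A" "a = f a'" "b' \<in> car A" "b = f b'" "c' \<in> car A" "c = f c'"
      using from_A abc by metis
    have "mu A (mu A a' b') c' = mu A a' (mu A b' c')" using algebra_A a unfolding algebra_in_def by blast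
    then show ?thesis using a f_mu mu_car by metis
  qed
  fix z b assume z: "z \<in> target_space G" and "b \<in> car B"
  then obtain a where a: "a \<in> car A" "b = f a" using from_A by blast
  have "mu A (eta A z) a = act A z a" "mu A a (eta A z) = act A (inv (antipode G) z) a"
    using algebra_A a z unfolding algebra_in_def by blast+
  then show "mu B (eta B z) b = act B z b" "mu B b (eta B z) = act B (inv (antipode G) z) b"
    using a z f_mu f_eta eta_car f_act by metis+
qed

lemma tsum_tact_B:
  assumes g: "bilinear_map sB sB ((*) :: 'k \<Rightarrow> _) g" and u: "set u \<subseteq> car A \<times> car A"
  shows "(\<Sum>x y\<in>tact G (act A) h u. g (f x) (f y)) = tsum g (tact G (act B) h (map (map_prod f f) u))"
  unfolding tsum_tact tsum_map by (intro tsum_cong) (use u f_act in auto)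

lemma tsum_tact_B_delta:
  assumes g: "bilinear_map sB sB ((*) :: 'k \<Rightarrow> _) g" and a: "a \<in> car A"
  shows "tsum g (tact G (act B) h (delta B (f a))) = tsum g (tact G (act B) h (map (map_prod f f) (delta A a)))"
proof -
  note l = lin_B bil_lin1[OF g] bil_lin2[OF g]
  have b: "bilinear_map sB sB (*) (\<lambda>x y. g (act B p x) (act B q y))" for p q by (intro l)
  show ?thesis unfolding tsum_tact tsum_map tsum_delta_B[OF b a] by simp
qed

lemma coalgebra_B: "coalgebra_in G B"
  unfolding coalgebra_in_def
proof (intro conjI)
  show "left_module G sB (car B) (act B)" using algebra_B unfolding algebra_in_def by blast
  show "tlinear sB (delta B)" by (rule B_delta)
  show "\<forall>b\<in>car B. in_tens_t G sB (car B) (act B) (delta B b)"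
  proof
    fix b assume "b \<in> car B"
    then obtain a where a: "a \<in> car A" "b = f a" using from_A by blast
    then obtain u where u: "set u \<subseteq> car A \<times> car A" "teq2 sA (delta A a) (tens_t G (act A) u)"
      using coalgebra_A unfolding coalgebra_in_def in_tens_t_def by blast
    have "teq2 sB (delta B b) (tens_t G (act B) (map (map_prod f f) u))"
    proof (rule teq2I[OF vsB])
      fix g assume g: "bilinear_map sB sB ((*) :: 'k \<Rightarrow> _) g"
      show "tsum g (delta B b) = tsum g (tens_t G (act B) (map (map_prod f f) u))"
        unfolding a(2) tsum_delta_B[OF g a(1)] teq2_tsum[OF u(2) bil_f[OF g]] by (rule tsum_tact_B[OF g u(1)])
    qed
    moreover have "set (map (map_prod f f) u) \<subseteq> car B \<times> car B" using u(1) f_car by auto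
    ultimately show "in_tens_t G sB (car B) (act B) (delta B b)" unfolding in_tens_t_def by blast
  qed
  show "\<forall>h. \<forall>b\<in>car B. teq2 sB (delta B (act B h b)) (tact G (act B) h (delta B b))"
  proof (intro allI ballI)
    fix h b assume "b \<in> car B"
    then obtain a where a: "a \<in> car A" "b = f a" using from_A by blast
    have d: "teq2 sA (delta A (act A h a)) (tact G (act A) h (delta A a))"
      using coalgebra_A a unfolding coalgebra_in_def by blast
    show "teq2 sB (delta B (act B h b)) (tact G (act B) h (delta B b))"
    proof (rule teq2I[OF vsB])
      fix g assume g: "bilinear_map sB sB ((*) :: 'k \<Rightarrow> _) g"
      show "tsum g (delta B (act B h b)) = tsum g (tact G (act B) h (delta B b))"
        unfolding a(2) f_act[OF a(1), symmetric] tsum_delta_B[OF g act_car[OF a(1)]] teq2_tsum[OF d bil_f[OF g]]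
          tsum_tact_B_delta[OF g a(1)] by (rule tsum_tact_B[OF g legs[OF a(1)]])
    qed
  qed
  have eA: "a \<in> car A \<Longrightarrow> eps A a \<in> target_space G" "a \<in> car A \<Longrightarrow> eps A (act A h a) = unit_act G h (eps A a)" for a h
    using coalgebra_A unfolding coalgebra_in_def module_morphism_def by blast+
  show "module_morphism sB (car B) (act B) (scal G) (target_space G) (unit_act G) (eps B)"
    unfolding module_morphism_def
  proof (intro conjI ballI allI)
    show "lin sB (scal G) (eps B)" by (rule B_eps)
    show "eps B b \<in> target_space G" if "b \<in> car B" for b
      using from_A[OF that] eA(1) f_eps by auto
    show "eps B (act B h b) = unit_act G h (eps B b)" if "b \<in> car B" for h b
      using from_A[OF that] eA(2) f_eps f_act act_car by metis
  qed
  show "\<forall>b\<in>car B. teq3 sB (map_left (delta B) (delta B b)) (map_right (delta B) (delta B b))"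
  proof
    fix b assume "b \<in> car B"
    then obtain a where a: "a \<in> car A" "b = f a" using from_A by blast
    have d: "teq3 sA (map_left (delta A) (delta A a)) (map_right (delta A) (delta A a))"
      using coalgebra_A a unfolding coalgebra_in_def by blast
    show "teq3 sB (map_left (delta B) (delta B b)) (map_right (delta B) (delta B b))"
    proof (rule teq3I[OF vsB])
      fix g assume g: "trilinear_map sB ((*) :: 'k \<Rightarrow> _) g"
      note l = lin_B tri_lin1[OF g] tri_lin2[OF g] tri_lin3[OF g]
      have b: "bilinear_map sB sB (*) (\<lambda>x y. \<Sum>p q\<in>delta B x. g p q y)"
        "bilinear_map sB sB (*) (\<lambda>x y. \<Sum>p q\<in>delta B y. g x p q)"
        "bilinear_map sB sB (*) (\<lambda>p q. g p q y)" "bilinear_map sB sB (*) (\<lambda>p q. g y p q)" for y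
        by (intro l)+
      have gf: "trilinear_map sA (*) (\<lambda>x y z. g (f x) (f y) (f z))"
        by (rule triI) (intro tri_lin1[OF g] tri_lin2[OF g] tri_lin3[OF g] f_lin)+
      \<comment> \<open>The outer comultiplication is transferred first; its legs lie in the carrier
        of \<open>A\<close>, so the inner one can be transferred as well.\<close>
      have "tsum3 g (map_left (delta B) (delta B b)) = (\<Sum>x y\<in>delta A a. \<Sum>p q\<in>delta A x. g (f p) (f q) (f y))"
        unfolding tsum3_map_left a(2) tsum_delta_B[OF b(1) a(1)] by (rule tsum_legs_cong[OF a(1)], rule tsum_delta_B[OF b(3)])
      also have "\<dots> = (\<Sum>x y\<in>delta A a. \<Sum>p q\<in>delta A y. g (f x) (f p) (f q))"
        using teq3_tsum3[OF d gf] unfolding tsum3_map_left tsum3_map_right .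
      also have "\<dots> = tsum3 g (map_right (delta B) (delta B b))"
        unfolding tsum3_map_right a(2) tsum_delta_B[OF b(2) a(1)] by (rule tsum_legs_cong[OF a(1)], rule tsum_delta_B[OF b(4), symmetric])
      finally show "tsum3 g (map_left (delta B) (delta B b)) = tsum3 g (map_right (delta B) (delta B b))" .
    qed
  qed
  have e: "lin sB sB (\<lambda>x. act B (eps B x) y)" "lin sB sB (\<lambda>x. act B (inv (antipode G) (eps B x)) y)" for y
    by (rule bil_lin1[OF B_act], rule B_eps, rule bil_lin1[OF B_act], rule lin_comp[OF B_eps G_inv])
  have b: "bilinear_map sB sB sB (\<lambda>x y. act B (eps B x) y)" "bilinear_map sB sB sB (\<lambda>x y. act B (inv (antipode G) (eps B y)) x)"
    by (intro lin_B e)+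
  show "\<forall>b\<in>car B. (\<Sum>x y\<in>delta B b. act B (eps B x) y) = b"
  proof
    fix b assume "b \<in> car B"
    then obtain a where a: "a \<in> car A" "b = f a" using from_A by blast
    have d: "(\<Sum>x y\<in>delta A a. act A (eps A x) y) = a"
      using coalgebra_A a unfolding coalgebra_in_def by blast
    have "(\<Sum>x y\<in>delta B b. act B (eps B x) y) = (\<Sum>x y\<in>delta A a. f (act A (eps A x) y))"
      unfolding a(2) tsum_delta_B[OF b(1) a(1)] by (rule tsum_legs_cong[OF a(1)]) (simp add: f_eps f_act)
    then show "(\<Sum>x y\<in>delta B b. act B (eps B x) y) = b"
      using d a(2) by (simp add: lin_tsum_apply[OF f_lin, symmetric])
  qed
  show "\<forall>b\<in>car B. (\<Sum>x y\<in>delta B b. act B (inv (antipode G) (eps B y)) x) = b"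
  proof
    fix b assume "b \<in> car B"
    then obtain a where a: "a \<in> car A" "b = f a" using from_A by blast
    have d: "(\<Sum>x y\<in>delta A a. act A (inv (antipode G) (eps A y)) x) = a"
      using coalgebra_A a unfolding coalgebra_in_def by blast
    have "(\<Sum>x y\<in>delta B b. act B (inv (antipode G) (eps B y)) x) = (\<Sum>x y\<in>delta A a.
          f (act A (inv (antipode G) (eps A y)) x))"
      unfolding a(2) tsum_delta_B[OF b(2) a(1)] by (rule tsum_legs_cong[OF a(1)]) (simp add: f_eps f_act)
    then show "(\<Sum>x y\<in>delta B b. act B (inv (antipode G) (eps B y)) x) = b"
      using d a(2) by (simp add: lin_tsum_apply[OF f_lin, symmetric])
  qed
qed

lemma tsum_braided_mul:
  fixes Z :: "('k, 'h, 'u::ab_group_add) hopf_data"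
  shows "tsum g (braided_mul G R Z t u) = (\<Sum>e e'\<in>comult G 1. \<Sum>a b\<in>t. \<Sum>c d\<in>u. \<Sum>r1 r2\<in>R.
        g (act Z e (mu Z a (act Z r2 c))) (act Z e' (mu Z (act Z r1 b) d)))"
  unfolding braided_mul_def by (simp add: tsum_tact tsum_concat_map tsum_map case_prod_beta)

text \<open>\<open>braided_mul\<close> contains two comultiplications, so the replacement is made
  twice, at first with the inner sum still over \<open>delta B\<close>.\<close>

lemma bialgebra_B: "bialgebra_in G R B"
  unfolding bialgebra_in_def
proof (intro conjI ballI)
  show "algebra_in G B" "coalgebra_in G B" by (rule algebra_B coalgebra_B)+
  fix a b assume "a \<in> car B" "b \<in> car B"
  then obtain a' b' where a: "a' \<in> car A" "a = f a'" and b: "b' \<in> car A" "b = f b'" using from_A by metis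
  have d: "teq2 sA (delta A (mu A a' b')) (braided_mul G R A (delta A a') (delta A b'))"
    and e: "eps A (mu A a' b') = unit_act G (eps A a') (eps A b')"
    using bialgebra_A a b unfolding bialgebra_in_def by blast+
  show "eps B (mu B a b) = unit_act G (eps B a) (eps B b)"
    using e f_mu[OF a(1) b(1)] f_eps[OF mu_car[OF a(1) b(1)]] f_eps[OF a(1)] f_eps[OF b(1)] a b by simp
  show "teq2 sB (delta B (mu B a b)) (braided_mul G R B (delta B a) (delta B b))"
  proof (rule teq2I[OF vsB])
    fix g assume g: "bilinear_map sB sB ((*) :: 'k \<Rightarrow> _) g"
    note l = lin_B bil_lin1[OF g] bil_lin2[OF g]
    have c: "bilinear_map sB sB (*) (\<lambda>m n. \<Sum>c d\<in>delta B b. \<Sum>r1 r2\<in>R.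
          g (act B e (mu B m (act B r2 c))) (act B e' (mu B (act B r1 n) d)))"
      "bilinear_map sB sB (*) (\<lambda>c d. \<Sum>r1 r2\<in>R.
            g (act B e (mu B m (act B r2 c))) (act B e' (mu B (act B r1 n) d)))" for e e' m n
      by (intro l)+
    have "tsum g (delta B (mu B a b)) = (\<Sum>x y\<in>braided_mul G R A (delta A a') (delta A b'). g (f x) (f y))"
      unfolding a(2) b(2) f_mu[OF a(1) b(1), symmetric] tsum_delta_B[OF g mu_car[OF a(1) b(1)]]
      by (rule teq2_tsum[OF d bil_f[OF g]])
    also have "\<dots> = (\<Sum>e e'\<in>comult G 1. \<Sum>m n\<in>delta A a'. \<Sum>c d\<in>delta A b'. \<Sum>r1 r2\<in>R.
          g (act B e (mu B (f m) (act B r2 (f c)))) (act B e' (mu B (act B r1 (f n)) (f d))))"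
      unfolding tsum_braided_mul
      by (rule tsum_cong, rule tsum_legs_cong[OF a(1)], rule tsum_legs_cong[OF b(1)])
        (simp add: f_act f_mu act_car mu_car)
    also have "\<dots> = tsum g (braided_mul G R B (delta B a) (delta B b))"
      unfolding tsum_braided_mul unfolding a(2) tsum_delta_B[OF c(1) a(1)] unfolding b(2) tsum_delta_B[OF c(2) b(1)] ..
    finally show "tsum g (delta B (mu B a b)) = tsum g (braided_mul G R B (delta B a) (delta B b))" .
  qed
next
  fix z w assume z: "z \<in> target_space G" and w: "w \<in> target_space G"
  have d: "teq2 sA (delta A (eta A (unit_act G z w))) (tens_t G (act A) [(eta A z, eta A w)])"
    using bialgebra_A z w unfolding bialgebra_in_def by blast
  have u: "set [(eta A z, eta A w)] \<subseteq> car A \<times> car A" using eta_car z w by simp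
  show "teq2 sB (delta B (eta B (unit_act G z w))) (tens_t G (act B) [(eta B z, eta B w)])"
  proof (rule teq2I[OF vsB])
    fix g assume g: "bilinear_map sB sB ((*) :: 'k \<Rightarrow> _) g"
    show "tsum g (delta B (eta B (unit_act G z w))) = tsum g (tens_t G (act B) [(eta B z, eta B w)])"
      using tsum_tact_B[OF g u, of 1] f_eta[OF z] f_eta[OF w]
      unfolding f_eta[OF unit_act_target, symmetric] tsum_delta_B[OF g eta_car[OF unit_act_target]] teq2_tsum[OF d bil_f[OF g]]
      by simp
  qed
qed

lemma hopf_B: "hopf_algebra_in G R B"
  unfolding hopf_algebra_in_def
proof (intro conjI ballI)
  show "bialgebra_in G R B" by (rule bialgebra_B)
  have m: "a \<in> car A \<Longrightarrow> anti A (act A h a) = act A h (anti A a)" for a h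
    using hopf_A unfolding hopf_algebra_in_def module_morphism_def by blast
  have "anti B b \<in> car B" "anti B (act B h b) = act B h (anti B b)" if "b \<in> car B" for h b
    using from_A[OF that] m f_anti f_act act_car anti_car f_car by metis+
  then show "module_morphism sB (car B) (act B) sB (car B) (act B) (anti B)"
    unfolding module_morphism_def using B_anti by blast
  fix b assume "b \<in> car B"
  then obtain a where a: "a \<in> car A" "b = f a" using from_A by blast
  have d: "(\<Sum>x y\<in>delta A a. mu A (anti A x) y) = eta A (eps A a)"
    "(\<Sum>x y\<in>delta A a. mu A x (anti A y)) = eta A (eps A a)"
    using hopf_A a unfolding hopf_algebra_in_def by blast+
  have ea: "eps A a \<in> target_space G"
    using coalgebra_A a unfolding coalgebra_in_def module_morphism_def by blast
  have bl: "bilinear_map sB sB sB (\<lambda>x y. mu B (anti B x) y)" "bilinear_map sB sB sB (\<lambda>x y. mu B x (anti B y))"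
    by (intro lin_B)+
  have "(\<Sum>x y\<in>delta B b. mu B (anti B x) y) = (\<Sum>x y\<in>delta A a. f (mu A (anti A x) y))"
    unfolding a(2) tsum_delta_B[OF bl(1) a(1)] by (rule tsum_legs_cong[OF a(1)]) (simp add: f_mu f_anti anti_car)
  then show "(\<Sum>x y\<in>delta B b. mu B (anti B x) y) = eta B (eps B b)"
    using d(1) a f_eps f_eta[OF ea] by (simp add: lin_tsum_apply[OF f_lin, symmetric])
  have "(\<Sum>x y\<in>delta B b. mu B x (anti B y)) = (\<Sum>x y\<in>delta A a. f (mu A x (anti A y)))"
    unfolding a(2) tsum_delta_B[OF bl(2) a(1)] by (rule tsum_legs_cong[OF a(1)]) (simp add: f_mu f_anti anti_car)
  then show "(\<Sum>x y\<in>delta B b. mu B x (anti B y)) = eta B (eps B b)"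
    using d(2) a f_eps f_eta[OF ea] by (simp add: lin_tsum_apply[OF f_lin, symmetric])
qed

lemma hopf_isomorphism: "hopf_isomorphism_in G R A B f"
  unfolding hopf_isomorphism_in_def
  using hopf_A hopf_B f_morphism f_bij f_mu f_eta f_delta f_eps f_anti by blast

end

section \<open>Application of the transport to \<open>alpha\<close>\<close>

context cocycle_twist begin

lemma B_simps:
  "car B = C" "vscal B = sH" "act B = Adt" "mu B = (\<lambda>g l. g * l)" "eta B = (\<lambda>z. z)" "eps B = et"
  by (simp_all add: centralizer_hopf_def source_twist epst_twist)

text \<open>As S is an involution and \<open>vi\<close> inverts \<open>v\<close>, the inverse of
  \<open>St\<close> sends y to S(vi y v), which is visibly linear.\<close>

lemma inv_St_lin: "lin sH sH (inv St)"
proof -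
  have surj: "St (S (vi * y * v)) = y" for y
  proof -
    have "St (S (vi * y * v)) = (v * vi) * y * (v * vi)" by (simp add: S_S mult.assoc)
    then show ?thesis by (simp add: v_vi)
  qed
  have "inv St = (\<lambda>y. S (vi * y * v))"
    by (rule ext) (metis inj_St inv_f_f surj)
  then show ?thesis by (simp only:) (intro lin_rules)
qed

lemma delta_B_tlinear: "tlinear sH (delta B)"
proof (rule tlinearI)
  fix f assume f: "bil ((*) :: 'k \<Rightarrow> _) f"
  note [lin_rules] = bil_rules[OF f]
  show "lin sH (*) (\<lambda>x. tsum f (delta B x))"
    unfolding tsum_delta_B by (intro lin_rules)
qed

lemma anti_B_lin: "lin sH sH (anti B)"
  unfolding anti_B[abs_def] by (intro lin_rules)

lemma hopf_isomorphism_alpha: "hopf_isomorphism_in Ht R A B alpha"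
proof -
  have A_car: "car A = C" "vscal A = sH" "act A = Ad" by simp_all
  interpret hopf_transport Ht R A B alpha
  proof (rule hopf_transport.intro)
    show "hopf_algebra_in Ht R A" by (rule A_hopf)
    show "set (delta A a) \<subseteq> car A \<times> car A" for a using delta_C by simp
    show "module_morphism (vscal A) (car A) (act A) (vscal B) (car B) (act B) alpha"
      unfolding module_morphism_def A_car B_simps using alpha_lin alpha_C alpha_Ad by blast
    show "bij_betw alpha (car A) (car B)" unfolding A_car B_simps by (rule alpha_bij)
    show "alpha (mu A a b) = mu B (alpha a) (alpha b)" for a b unfolding B_simps by (rule alpha_mu)
    show "alpha (eta A z) = eta B z" if "z \<in> target_space Ht" for z
      using that unfolding target_twist B_simps A_simps(5) by (rule alpha_K)
    show "teq2 (vscal B) (map (map_prod alpha alpha) (delta A a)) (delta B (alpha a))" if "a \<in> car A" for a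
      using that unfolding A_car B_simps by (rule delta_alpha)
    show "eps B (alpha a) = eps A a" if "a \<in> car A" for a
      using that unfolding A_car B_simps A_simps(6) by (rule et_alpha)
    show "alpha (anti A a) = anti B (alpha a)" if "a \<in> car A" for a
      using that unfolding A_car A_simps(7) by (rule alpha_S)
    show "module.subspace (vscal B) (car B)" unfolding B_simps by (rule C_subspace)
    show "bilinear_map (scal Ht) (vscal B) (vscal B) (act B)" unfolding B_simps twist_simps(1) by (rule Adt_bil)
    show "bilinear_map (vscal B) (vscal B) (vscal B) (mu B)" unfolding B_simps by (rule mult_bil)
    show "lin (scal Ht) (vscal B) (eta B)" unfolding B_simps twist_simps(1) by (rule lin_ident)
    show "tlinear (vscal B) (delta B)" unfolding B_simps by (rule delta_B_tlinear)
    show "lin (vscal B) (scal Ht) (eps B)" unfolding B_simps twist_simps(1) by (rule et_lin)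
    show "lin (vscal B) (vscal B) (anti B)" unfolding B_simps by (rule anti_B_lin)
    show "lin (scal Ht) (scal Ht) (inv St)" unfolding twist_simps(1) by (rule inv_St_lin)
  qed
  show ?thesis by (rule hopf_isomorphism)
qed

end

theorem theorem4p7:
  fixes H :: "('k::field, 'h::{ring, monoid_mult}) qgroupoid"
    and F Fi :: "('h \<times> 'h) list"
  assumes "quantum_groupoid H"
    and "cocommutative H"
    and "weak_inv_unit_2cocycle H F Fi"
  shows "hopf_isomorphism_in (twist H F Fi) (twist_R (cocomm_R H) F Fi)
           (centralizer_F H F Fi)
           (centralizer_hopf (twist H F Fi) (twist_R (cocomm_R H) F Fi))
           (\<lambda>a. tsum (\<lambda>x y. adj H x a * y) F)"
proof -
  interpret cocycle_twist H F Fi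
    using assms by (simp add: cocycle_twist_def cocomm_groupoid_def cocycle_twist_axioms_def)
  show ?thesis using hopf_isomorphism_alpha unfolding alpha_def[abs_def] .
qed

end
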